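(* Let $k$ be an algebraically closed field of characteristic $0$. Let $n,m$ be integers with $m>n\ge 2$ such that there exists a natural number $\gamma$ with $\frac mn\le\gamma\le\frac{m-1}{n-1}$, and let $\Theta\in\Sigma_n$. Write $m=en+t$, where $e$ is the integer part of $\frac mn$. Let $\mathcal A_m(\Theta)=\{\Xi\in\Sigma_m\mid\Xi\le_p\Theta\}$. Then $$\dim(\mathcal A_m(\Theta))=\begin{cases} e-1 & \text{if } t=0,\\ e-n+t & \text{if } t>0.\end{cases}$$
   Context: For $A,B\subseteq k$, $A\le_p B$ means that there is a polynomial $P\in k[X]$ with $A=P^{-1}(B)$; $A\equiv_p B$ means $A\le_p B$ and $B\le_p A$; $[A]$ is the $\equiv_p$-class of $A$; $[A]\le_p[B]$ iff $A\le_p B$. $\mathcal P_n$ is the set of $n$-element subsets of $k$, and $\Sigma_n=\{[A]\mid A\in\mathcal P_n\}$. Two elements of $\mathcal P_n$ are $\equiv_p$-equivalent if and only if one is the image of the other under a linear polynomial $cX+c'$ with $c\neq 0$. Variety structures: let $f_n=\prod_{j\ne j'}(X_j-X_{j'})$ and let $D(f_n)\subseteq k^n$ be the open set of points with pairwise distinct coordinates, an affine variety with ring of regular functions $k[X_1,\ldots,X_n]_{f_n}$. $\mathcal P_n$ is the affine variety obtained as the geometric quotient of $D(f_n)$ by the symmetric group $Sym_n$ permuting coordinates; its regular functions are the $Sym_n$-invariant regular functions on $D(f_n)$. $\Sigma_n$ is the affine variety obtained as the geometric quotient of $\mathcal P_n$ by the action $(P,A)\mapsto P(A)$ of the group of linear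 polynomials: it has the quotient topology (so a subset of $\Sigma_n$ is closed iff its preimage under $D(f_n)\to\Sigma_n$, $(a_1,\ldots,a_n)\mapsto[\{a_1,\ldots,a_n\}]$, is closed in $D(f_n)$), and its regular functions are the regular functions on $\mathcal P_n$ invariant under this action. The set $\mathcal A_m(\Theta)$ is a Zariski closed subset (subvariety) of $\Sigma_m$. *)

theory Defs
  imports
    "HOL-Analysis.Analysis"
    "HOL-Library.Poly_Mapping"
    "HOL-Computational_Algebra.Polynomial"
begin

section \<open>Polynomial reducibility\<close>

definition poly_red :: "'k::comm_ring_1 set \<Rightarrow> 'k set \<Rightarrow> bool"  (infix "\<le>\<^sub>p" 50)
  where "A \<le>\<^sub>p B \<longleftrightarrow> (\<exists>P. A = poly P -` B)"

definition poly_equiv :: "'k::comm_ring_1 set \<Rightarrow> 'k set \<Rightarrow> bool"  (infix "\<equiv>\<^sub>p" 50)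
  where "A \<equiv>\<^sub>p B \<longleftrightarrow> A \<le>\<^sub>p B \<and> B \<le>\<^sub>p A"

definition poly_class :: "'k::comm_ring_1 set \<Rightarrow> 'k set set"
  where "poly_class A = {B. B \<equiv>\<^sub>p A}"

definition class_red :: "'k::comm_ring_1 set set \<Rightarrow> 'k set set \<Rightarrow> bool"  (infix "\<le>\<^sub>c" 50)
  where "\<Xi> \<le>\<^sub>c \<Theta> \<longleftrightarrow> (\<exists>A\<in>\<Xi>. \<exists>B\<in>\<Theta>. A \<le>\<^sub>p B)"

definition n_sets :: "nat \<Rightarrow> 'k set set"
  where "n_sets n = {A. finite A \<and> card A = n}"

definition n_classes :: "nat \<Rightarrow> 'k::comm_ring_1 set set set"
  where "n_classes n = poly_class ` n_sets n"

definition classes_below :: "nat \<Rightarrow> 'k::comm_ring_1 set set \<Rightarrow> 'k set set set"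
  where "classes_below m \<Theta> = {\<Xi> \<in> n_classes m. \<Xi> \<le>\<^sub>c \<Theta>}"

lemma poly_red_refl: "A \<le>\<^sub>p A"
  unfolding poly_red_def by (rule exI[of _ "[:0, 1:]"]) auto

lemma poly_red_trans:
  assumes "A \<le>\<^sub>p B" "B \<le>\<^sub>p C"
  shows "A \<le>\<^sub>p C"
proof -
  obtain P Q where "A = poly P -` B" "B = poly Q -` C"
    using assms unfolding poly_red_def by blast
  then have "A = poly (pcompose Q P) -` C"
    by (auto simp: poly_pcompose)
  then show ?thesis
    unfolding poly_red_def by blast
qed

lemma poly_class_eq_iff: "poly_class A = poly_class B \<longleftrightarrow> A \<equiv>\<^sub>p B"
  unfolding poly_class_def poly_equiv_def using poly_red_refl poly_red_trans by blast

lemma class_red_poly_class: "poly_class A \<le>\<^sub>c poly_class B \<longleftrightarrow> A \<le>\<^sub>p B"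
  unfolding class_red_def poly_class_def poly_equiv_def
  using poly_red_refl poly_red_trans by blast


section \<open>The Zariski topology on affine space\<close>

text \<open>
  A polynomial in the variables \<open>X\<^sub>i\<close> (\<open>i :: nat\<close>) is a finitely supported map from
  monomials to coefficients, a monomial being a finitely supported map from variables to exponents.
\<close>

type_synonym 'k mpoly = "(nat \<Rightarrow>\<^sub>0 nat) \<Rightarrow>\<^sub>0 'k"

definition mono_eval :: "(nat \<Rightarrow>\<^sub>0 nat) \<Rightarrow> (nat \<Rightarrow> 'k::comm_ring_1) \<Rightarrow> 'k"
  where "mono_eval a x = (\<Prod>i\<in>Poly_Mapping.keys a. x i ^ Poly_Mapping.lookup a i)"

definition mpoly_eval :: "'k::comm_ring_1 mpoly \<Rightarrow> (nat \<Rightarrow> 'k) \<Rightarrow> 'k"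
  where "mpoly_eval p x =
    (\<Sum>a\<in>Poly_Mapping.keys p. Poly_Mapping.lookup p a * mono_eval a x)"

definition mpolys :: "nat \<Rightarrow> 'k::comm_ring_1 mpoly set"
  where "mpolys n = {p. \<forall>a\<in>Poly_Mapping.keys p. Poly_Mapping.keys a \<subseteq> {..<n}}"

text \<open>
  An \<open>n\<close>-tuple is a function on \<open>{..<n}\<close>, extended by \<open>undefined\<close> so that each
  tuple is represented once.
\<close>

definition affine_space :: "nat \<Rightarrow> (nat \<Rightarrow> 'k) set"
  where "affine_space n = ({..<n} \<rightarrow>\<^sub>E UNIV)"

definition zero_locus :: "nat \<Rightarrow> 'k::comm_ring_1 mpoly set \<Rightarrow> (nat \<Rightarrow> 'k) set"
  where "zero_locus n F = {x \<in> affine_space n. \<forall>p\<in>F. mpoly_eval p x = 0}"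

definition zariski :: "nat \<Rightarrow> (nat \<Rightarrow> 'k::idom) topology"
  where "zariski n = topology (\<lambda>U. \<exists>F\<subseteq>mpolys n. U = affine_space n - zero_locus n F)"

lemma mono_eval_superset:
  assumes "finite S" "Poly_Mapping.keys a \<subseteq> S"
  shows "mono_eval a x = (\<Prod>i\<in>S. x i ^ Poly_Mapping.lookup a i)"
  unfolding mono_eval_def
  by (rule prod.mono_neutral_left) (use assms in \<open>auto simp: in_keys_iff\<close>)

lemma mono_eval_add: "mono_eval (a + b) x = mono_eval a x * mono_eval b x"
proof -
  define S where "S = Poly_Mapping.keys a \<union> Poly_Mapping.keys b"
  have "finite S" "Poly_Mapping.keys a \<subseteq> S" "Poly_Mapping.keys b \<subseteq> S"
    "Poly_Mapping.keys (a + b) \<subseteq> S"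
    using Poly_Mapping.keys_add[of a b] by (auto simp: S_def)
  then show ?thesis
    by (simp add: mono_eval_superset[of S] lookup_add power_add prod.distrib)
qed

lemma mpoly_eval_superset:
  assumes "finite S" "Poly_Mapping.keys p \<subseteq> S"
  shows "mpoly_eval p x = (\<Sum>a\<in>S. Poly_Mapping.lookup p a * mono_eval a x)"
  unfolding mpoly_eval_def
  by (rule sum.mono_neutral_left) (use assms in \<open>auto simp: in_keys_iff\<close>)

lemma mpoly_eval_zero [simp]: "mpoly_eval 0 x = 0"
  by (simp add: mpoly_eval_def)

lemma mpoly_eval_one [simp]: "mpoly_eval 1 x = 1"
  by (simp add: mpoly_eval_def mono_eval_def)

lemma mpoly_eval_single: "mpoly_eval (Poly_Mapping.single a c) x = c * mono_eval a x"
  by (simp add: mpoly_eval_def)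

lemma mpoly_eval_add: "mpoly_eval (p + q) x = mpoly_eval p x + mpoly_eval q x"
proof -
  define S where "S = Poly_Mapping.keys p \<union> Poly_Mapping.keys q"
  have "finite S" "Poly_Mapping.keys p \<subseteq> S" "Poly_Mapping.keys q \<subseteq> S"
    "Poly_Mapping.keys (p + q) \<subseteq> S"
    using Poly_Mapping.keys_add[of p q] by (auto simp: S_def)
  then show ?thesis
    by (simp add: mpoly_eval_superset[of S] lookup_add algebra_simps sum.distrib)
qed

lemma mpoly_eval_sum: "mpoly_eval (sum f I) x = (\<Sum>i\<in>I. mpoly_eval (f i) x)"
  by (induction I rule: infinite_finite_induct) (auto simp: mpoly_eval_add)

lemma sum_single_lookup:
  "(\<Sum>a\<in>Poly_Mapping.keys p. Poly_Mapping.single a (Poly_Mapping.lookup p a)) = p"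
proof (rule poly_mapping_eqI)
  fix b
  have "(\<Sum>a\<in>Poly_Mapping.keys p. Poly_Mapping.lookup (Poly_Mapping.single a (Poly_Mapping.lookup p a)) b)
    = (\<Sum>a\<in>Poly_Mapping.keys p. if a = b then Poly_Mapping.lookup p b else 0)"
    by (intro sum.cong) (auto simp: lookup_single when_def)
  also have "\<dots> = Poly_Mapping.lookup p b"
    by (simp add: in_keys_iff)
  finally show "Poly_Mapping.lookup (\<Sum>a\<in>Poly_Mapping.keys p.
      Poly_Mapping.single a (Poly_Mapping.lookup p a)) b = Poly_Mapping.lookup p b"
    by (simp add: lookup_sum)
qed

lemma mpoly_eval_mult: "mpoly_eval (p * q) x = mpoly_eval p x * mpoly_eval q x"
proof -
  have "p * q = (\<Sum>a\<in>Poly_Mapping.keys p. Poly_Mapping.single a (Poly_Mapping.lookup p a))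
    * (\<Sum>b\<in>Poly_Mapping.keys q. Poly_Mapping.single b (Poly_Mapping.lookup q b))"
    by (simp only: sum_single_lookup)
  then have "mpoly_eval (p * q) x
    = (\<Sum>a\<in>Poly_Mapping.keys p. \<Sum>b\<in>Poly_Mapping.keys q.
        (Poly_Mapping.lookup p a * mono_eval a x) * (Poly_Mapping.lookup q b * mono_eval b x))"
    by (simp add: sum_product mpoly_eval_sum mult_single mpoly_eval_single mono_eval_add
        algebra_simps)
  then show ?thesis
    by (simp add: sum_product mpoly_eval_def)
qed

lemma mpolys_one: "1 \<in> mpolys n"
  by (simp add: mpolys_def)

lemma mpolys_mult:
  assumes "p \<in> mpolys n" "q \<in> mpolys n"
  shows "p * q \<in> mpolys n"
  unfolding mpolys_def
proof (clarify)
  fix a i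
  assume "a \<in> Poly_Mapping.keys (p * q)" and i: "i \<in> Poly_Mapping.keys a"
  then obtain b c where "a = b + c" "b \<in> Poly_Mapping.keys p" "c \<in> Poly_Mapping.keys q"
    using keys_mult[of p q] by blast
  then show "i < n"
    using i assms Poly_Mapping.keys_add[of b c] unfolding mpolys_def by blast
qed

lemma istopology_zariski:
  "istopology (\<lambda>U :: (nat \<Rightarrow> 'k::idom) set.
     \<exists>F\<subseteq>mpolys n. U = affine_space n - zero_locus n F)"
  unfolding istopology_def
proof (intro conjI allI impI)
  fix U V :: "(nat \<Rightarrow> 'k) set"
  assume "\<exists>F\<subseteq>mpolys n. U = affine_space n - zero_locus n F"
    and "\<exists>F\<subseteq>mpolys n. V = affine_space n - zero_locus n F"
  then obtain F G where FG: "F \<subseteq> mpolys n" "G \<subseteq> mpolys n"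
    and UV: "U = affine_space n - zero_locus n F" "V = affine_space n - zero_locus n G"
    by blast
  define H where "H = {p * q | p q. p \<in> F \<and> q \<in> G}"
  have "H \<subseteq> mpolys n"
    using FG mpolys_mult unfolding H_def by blast
  moreover have "zero_locus n H = zero_locus n F \<union> zero_locus n G"
  proof (rule set_eqI)
    fix x :: "nat \<Rightarrow> 'k"
    have "(\<forall>h\<in>H. mpoly_eval h x = 0) \<longleftrightarrow>
      (\<forall>p\<in>F. \<forall>q\<in>G. mpoly_eval p x * mpoly_eval q x = 0)"
      unfolding H_def mpoly_eval_mult[symmetric] by blast
    then show "x \<in> zero_locus n H \<longleftrightarrow> x \<in> zero_locus n F \<union> zero_locus n G"
      unfolding zero_locus_def by auto
  qed
  ultimately show "\<exists>F\<subseteq>mpolys n. U \<inter> V = affine_space n - zero_locus n F"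
    using UV by (intro exI[of _ H]) auto
next
  fix \<U> :: "(nat \<Rightarrow> 'k) set set"
  assume "\<forall>U\<in>\<U>. \<exists>F\<subseteq>mpolys n. U = affine_space n - zero_locus n F"
  then obtain F where F: "\<And>U. U \<in> \<U> \<Longrightarrow> F U \<subseteq> mpolys n"
    "\<And>U. U \<in> \<U> \<Longrightarrow> U = affine_space n - zero_locus n (F U)"
    by metis
  have "\<Union>\<U> = (\<Union>U\<in>\<U>. affine_space n - zero_locus n (F U))"
    using F(2) by auto
  also have "\<dots> = affine_space n - zero_locus n (\<Union>U\<in>\<U>. F U)"
    unfolding zero_locus_def by auto
  finally show "\<exists>F\<subseteq>mpolys n. \<Union>\<U> = affine_space n - zero_locus n F"
    using F(1) by (intro exI[of _ "\<Union>U\<in>\<U>. F U"]) auto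
qed

lemma openin_zariski:
  "openin (zariski n) U \<longleftrightarrow> (\<exists>F\<subseteq>mpolys n. U = affine_space n - zero_locus n F)"
  unfolding zariski_def topology_inverse'[OF istopology_zariski] by (rule refl)

lemma topspace_zariski [simp]:
  "topspace (zariski n) = (affine_space n :: (nat \<Rightarrow> 'k::idom) set)"
proof -
  have "zero_locus n {1 :: 'k mpoly} = {}"
    by (simp add: zero_locus_def)
  then have "openin (zariski n) (affine_space n :: (nat \<Rightarrow> 'k) set)"
    unfolding openin_zariski using mpolys_one by (intro exI[of _ "{1}"]) auto
  then have "affine_space n \<subseteq> topspace (zariski n :: (nat \<Rightarrow> 'k) topology)"
    by (rule openin_subset)
  moreover have "topspace (zariski n :: (nat \<Rightarrow> 'k) topology) \<subseteq> affine_space n"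
    using openin_topspace[of "zariski n :: (nat \<Rightarrow> 'k) topology"]
    unfolding openin_zariski by blast
  ultimately show ?thesis
    by (rule subset_antisym[rotated])
qed

lemma closedin_zariski:
  "closedin (zariski n) Z \<longleftrightarrow> (\<exists>F\<subseteq>mpolys n. Z = zero_locus n F)"
proof -
  have "zero_locus n F \<subseteq> affine_space n" for F :: "'a mpoly set"
    by (auto simp: zero_locus_def)
  then show ?thesis
    unfolding closedin_def openin_zariski topspace_zariski
    by (metis Diff_Diff_Int inf.absorb_iff2)
qed


section \<open>Quotient topologies and the topologies of the two quotients\<close>

definition quotient_topology :: "'a topology \<Rightarrow> ('a \<Rightarrow> 'b) \<Rightarrow> 'b topology"
  where "quotient_topology X f =
    topology (\<lambda>U. U \<subseteq> f ` topspace X \<and> openin X {x \<in> topspace X. f x \<in> U})"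

lemma openin_quotient_topology:
  "openin (quotient_topology X f) U \<longleftrightarrow>
     U \<subseteq> f ` topspace X \<and> openin X {x \<in> topspace X. f x \<in> U}"
proof -
  have top: "istopology (\<lambda>U. U \<subseteq> f ` topspace X \<and> openin X {x \<in> topspace X. f x \<in> U})"
    unfolding istopology_def
  proof (intro conjI allI impI; (elim conjE)?)
    fix U V
    assume "openin X {x \<in> topspace X. f x \<in> U}" "openin X {x \<in> topspace X. f x \<in> V}"
    then have "openin X ({x \<in> topspace X. f x \<in> U} \<inter> {x \<in> topspace X. f x \<in> V})"
      by (rule openin_Int)
    also have "{x \<in> topspace X. f x \<in> U} \<inter> {x \<in> topspace X. f x \<in> V}
      = {x \<in> topspace X. f x \<in> U \<inter> V}"
      by auto
    finally show "openin X {x \<in> topspace X. f x \<in> U \<inter> V}" .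
  next
    fix \<U>
    assume "\<forall>U\<in>\<U>. U \<subseteq> f ` topspace X \<and> openin X {x \<in> topspace X. f x \<in> U}"
    then have "openin X (\<Union>U\<in>\<U>. {x \<in> topspace X. f x \<in> U})"
      by (intro openin_Union) auto
    also have "(\<Union>U\<in>\<U>. {x \<in> topspace X. f x \<in> U}) = {x \<in> topspace X. f x \<in> \<Union>\<U>}"
      by auto
    finally show "openin X {x \<in> topspace X. f x \<in> \<Union>\<U>}" .
  qed auto
  show ?thesis
    unfolding quotient_topology_def topology_inverse'[OF top] by (rule refl)
qed

lemma topspace_quotient_topology [simp]:
  "topspace (quotient_topology X f) = f ` topspace X"
proof
  show "topspace (quotient_topology X f) \<subseteq> f ` topspace X"
    using openin_topspace[of "quotient_topology X f"] unfolding openin_quotient_topology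
    by (rule conjunct1)
  have "{x \<in> topspace X. f x \<in> f ` topspace X} = topspace X"
    by auto
  then have "openin (quotient_topology X f) (f ` topspace X)"
    by (simp add: openin_quotient_topology)
  then show "f ` topspace X \<subseteq> topspace (quotient_topology X f)"
    by (rule openin_subset)
qed

lemma quotient_map_quotient_topology: "quotient_map X (quotient_topology X f) f"
  by (simp add: quotient_map_def openin_quotient_topology)

definition distinct_tuples :: "nat \<Rightarrow> (nat \<Rightarrow> 'k) set"
  where "distinct_tuples n = {x \<in> affine_space n. inj_on x {..<n}}"

definition n_sets_top :: "nat \<Rightarrow> 'k::idom set topology"
  where "n_sets_top n =
    quotient_topology (subtopology (zariski n) (distinct_tuples n)) (\<lambda>x. x ` {..<n})"

text \<open>
  Over an algebraically closed field of characteristic 0, the fibres of \<open>poly_class\<close> on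
  \<open>n_sets n\<close>, for \<open>n \<ge> 1\<close>, are the orbits of the group of linear polynomials.
\<close>

definition n_classes_top :: "nat \<Rightarrow> 'k::idom set set topology"
  where "n_classes_top n = quotient_topology (n_sets_top n) poly_class"

lemma topspace_n_sets_top [simp]:
  "topspace (n_sets_top n) = (n_sets n :: 'k::idom set set)"
proof -
  have "(\<lambda>x. x ` {..<n}) ` distinct_tuples n = (n_sets n :: 'k set set)"
  proof (intro equalityI subsetI)
    fix A :: "'k set"
    assume "A \<in> (\<lambda>x. x ` {..<n}) ` distinct_tuples n"
    then show "A \<in> n_sets n"
      by (auto simp: distinct_tuples_def n_sets_def card_image)
  next
    fix A :: "'k set"
    assume "A \<in> n_sets n"
    then obtain x where x: "bij_betw x {..<n} A"
      unfolding n_sets_def using ex_bij_betw_nat_finite[of A] by (auto simp: atLeast0LessThan)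
    define y where "y = restrict x {..<n}"
    have "bij_betw y {..<n} A"
      using x bij_betw_cong[of "{..<n}" y x A] by (simp add: y_def)
    moreover have "y \<in> affine_space n"
      by (auto simp: y_def affine_space_def)
    ultimately show "A \<in> (\<lambda>x. x ` {..<n}) ` distinct_tuples n"
      by (auto simp: distinct_tuples_def bij_betw_def)
  qed
  moreover have "affine_space n \<inter> distinct_tuples n = (distinct_tuples n :: (nat \<Rightarrow> 'k) set)"
    by (auto simp: distinct_tuples_def)
  ultimately show ?thesis
    by (simp add: n_sets_top_def)
qed

lemma topspace_n_classes_top [simp]: "topspace (n_classes_top n) = n_classes n"
  by (simp add: n_classes_top_def n_classes_def)

lemma quotient_map_n_classes_top:
  "quotient_map (subtopology (zariski n) (distinct_tuples n)) (n_classes_top n)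
     (\<lambda>x. poly_class (x ` {..<n}))"
  using quotient_map_compose[OF quotient_map_quotient_topology quotient_map_quotient_topology]
  unfolding n_classes_top_def n_sets_top_def comp_def .


section \<open>Krull dimension\<close>

definition irreducible_closed :: "'a topology \<Rightarrow> 'a set \<Rightarrow> bool"
  where "irreducible_closed X C \<longleftrightarrow> closedin X C \<and> C \<noteq> {} \<and>
    (\<forall>A B. closedin X A \<and> closedin X B \<and> C = A \<union> B \<longrightarrow> C = A \<or> C = B)"

text \<open>The dimension of the empty space is \<open>-\<infinity>\<close>, so that it differs from that of a point.\<close>

definition krull_dim :: "'a topology \<Rightarrow> ereal"
  where "krull_dim X = Sup {ereal (real d) | d.
    \<exists>C :: nat \<Rightarrow> 'a set. (\<forall>i\<le>d. irreducible_closed X (C i)) \<and> (\<forall>i<d. C i \<subset> C (Suc i))}"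

end

theory Submission
  imports Defs "HOL-Library.Function_Algebras"
begin


text \<open>
  Let \<open>\<Theta>\<close> be the class of the \<open>n\<close>-element set \<open>B\<close>. The classes below \<open>\<Theta>\<close> are those of the sets
  \<open>A = P\<^sup>-\<^sup>1(B)\<close>, and the class of \<open>A\<close> is its orbit under affine maps. If \<open>P\<close> has degree \<open>d\<close>, the \<open>n d\<close> roots of
  the polynomials \<open>P - b\<close> with \<open>b \<in> B\<close> fall into \<open>m\<close> points, so \<open>P\<close> has ramification \<open>r = n d - m\<close> over \<open>B\<close>.
  Modulo affine substitutions the polynomials of degree \<open>d\<close> form a family of dimension \<open>d - 1\<close>, and each unit
  of ramification costs one parameter. This leaves the dimension \<open>d - 1 - r = m - 1 - (n - 1) d\<close>. It is
  largest for the least \<open>d\<close> with \<open>m \<le> n d\<close>, which is \<open>e\<close> or \<open>e + 1\<close>; that it is not negative for this \<open>d\<close> is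
  the meaning of the hypothesis on \<open>\<gamma>\<close>.

  The upper bound is infinitesimal. Every class has representatives whose first two entries are \<open>0\<close> and \<open>1\<close>.
  The tuples of this form make up a slice that maps to the space of classes by a closed map with finite
  fibres, so a chain of irreducible closed sets of classes lifts to the slice (\<open>irreducible_chain_lift\<close>,
  \<open>slice_chain_lift\<close>). A chain of length \<open>k\<close> yields \<open>k\<close> algebraically independent functions on its largest
  member (\<open>independent_of_chain\<close>) and hence, in characteristic \<open>0\<close>, \<open>k\<close> linearly independent tangent vectors
  at some point of it (\<open>chain_point_derivations\<close>). If the values and the multiplicities of \<open>P\<close> at the entries
  are prescribed, a tangent vector changes \<open>P\<close> to first order by a polynomial of degree at most \<open>d\<close> that is
  divisible by \<open>\<Prod>\<^sub>i (X - x\<^sub>i)\<^bsup>\<mu>\<^sub>i - 1\<^esup>\<close>, a polynomial of degree \<open>r\<close>. These changes lie in a space of dimension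
  \<open>d - r + 1\<close>. It also contains \<open>P'\<close> and \<open>X P'\<close>, which come from affine substitutions and which the
  normalisation of the tuples excludes. Therefore \<open>k + 2 \<le> d - r + 1\<close> (\<open>stratum_tangent_bound\<close>).

  For the lower bound, all ramification is put at one point: \<open>P = b\<^sub>0 + X\<^bsup>r + 1\<^esup> Q\<close> with \<open>Q\<close> monic of degree
  \<open>N = d - 1 - r\<close>. Let \<open>\<Phi>\<^sub>i\<close> be the set of classes obtained from those \<open>Q\<close> whose difference from \<open>X\<^sup>N\<close> has degree
  less than \<open>i\<close>. The closures of \<open>\<Phi>\<^sub>1, \<dots>, \<Phi>\<^sub>N\<close>, preceded by a point, form a chain of length \<open>N\<close>
  (\<open>chain_exists\<close>). They are irreducible because two polynomials \<open>Q\<close> lie on a line, and along a line the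
  symmetric functions of the points of \<open>A\<close> are polynomials in one parameter (\<open>generic_root_tuples\<close>,
  \<open>family_irreducible\<close>). They increase strictly because the first nonzero coefficient of \<open>Q\<close> below \<open>X\<^sup>N\<close> is, up
  to a factor, an elementary symmetric function of \<open>A\<close> about the ramification point (\<open>family_in_flat_classes\<close>,
  \<open>family_not_in_flat_classes\<close>).
\<close>

section \<open>Lifting chains of irreducible closed sets\<close>

lemma irreducible_closed_subset_cover:
  assumes C: "irreducible_closed X C" and A: "closedin X A" and B: "closedin X B"
    and "C \<subseteq> A \<union> B"
  shows "C \<subseteq> A \<or> C \<subseteq> B"
proof -
  have "closedin X C" using C by (simp add: irreducible_closed_def)
  then have "closedin X (C \<inter> A)" "closedin X (C \<inter> B)" using A B by auto
  moreover have "C = (C \<inter> A) \<union> (C \<inter> B)" using assms(4) by auto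
  ultimately have "C = C \<inter> A \<or> C = C \<inter> B"
    using C unfolding irreducible_closed_def by blast
  then show ?thesis by auto
qed

text \<open>
  A closed subset of \<open>T\<close> that is minimal among those mapped onto \<open>C\<close> is irreducible: if it is the union of
  two closed sets, one of them is mapped onto \<open>C\<close> and is therefore everything. Zorn's lemma provides a
  minimal one, because the fibres are finite: over each point of \<open>C\<close> a chain of such subsets is eventually
  constant, so that its intersection still meets the fibre.
\<close>

lemma irreducible_closed_lift:
  assumes cont: "continuous_map X Y f" and closed: "closed_map X Y f"
    and fin: "\<And>y. finite {x \<in> topspace X. f x = y}"
    and C: "irreducible_closed Y C" and T: "closedin X T" and CT: "C \<subseteq> f ` T"
  shows "\<exists>T'. irreducible_closed X T' \<and> T' \<subseteq> T \<and> f ` T' = C"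
proof -
  define F where "F = {K. closedin X K \<and> K \<subseteq> T \<and> f ` K = C}"
  \<comment> \<open>Complements turn the minimal element sought into a maximal one.\<close>
  define G where "G = (\<lambda>K. topspace X - K) ` F"
  have Csub: "C \<subseteq> topspace Y" and clC: "closedin Y C" and Cne: "C \<noteq> {}"
    using C by (auto simp: irreducible_closed_def closedin_subset)
  have Tsub: "T \<subseteq> topspace X" using T by (rule closedin_subset)
  have "closedin X {x \<in> topspace X. f x \<in> C}"
    using cont clC by (rule closedin_continuous_map_preimage)
  then have "closedin X (T \<inter> {x \<in> topspace X. f x \<in> C})" using T by auto
  then have F0: "T \<inter> {x \<in> topspace X. f x \<in> C} \<in> F"
    unfolding F_def using CT Tsub by auto
  have "\<exists>M\<in>G. \<forall>X\<in>G. M \<subseteq> X \<longrightarrow> X = M"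
  proof (rule subset_Zorn_nonempty)
    show "G \<noteq> {}" using F0 by (auto simp: G_def)
    fix \<C> assume ne: "\<C> \<noteq> {}" and ch: "subset.chain G \<C>"
    define \<K> where "\<K> = {K \<in> F. topspace X - K \<in> \<C>}"
    have sub: "K \<subseteq> topspace X" if "K \<in> F" for K
      using that closedin_subset by (auto simp: F_def)
    have CK: "\<C> = (\<lambda>K. topspace X - K) ` \<K>"
      using ch unfolding subset.chain_def \<K>_def G_def by auto
    have \<K>ne: "\<K> \<noteq> {}" using ne CK by auto
    have \<K>F: "\<K> \<subseteq> F" by (auto simp: \<K>_def)
    have lin: "K \<subseteq> L \<or> L \<subseteq> K" if "K \<in> \<K>" "L \<in> \<K>" for K L
    proof -
      have "topspace X - K \<in> \<C>" "topspace X - L \<in> \<C>" using that by (simp_all add: \<K>_def)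
      then have "topspace X - K \<subseteq> topspace X - L \<or> topspace X - L \<subseteq> topspace X - K"
        using ch by (blast dest: subset.chain_total)
      then show ?thesis using sub that \<K>F by blast
    qed
    have "\<Inter>\<K> \<in> F"
      unfolding F_def
    proof (intro CollectI conjI)
      show "closedin X (\<Inter>\<K>)" using \<K>ne \<K>F by (intro closedin_Inter) (auto simp: F_def)
      show "\<Inter>\<K> \<subseteq> T" using \<K>ne \<K>F by (auto simp: F_def)
      show "f ` (\<Inter>\<K>) = C"
      proof
        show "f ` (\<Inter>\<K>) \<subseteq> C" using \<K>ne \<K>F by (auto simp: F_def)
        show "C \<subseteq> f ` (\<Inter>\<K>)"
        proof
          fix y assume y: "y \<in> C"
          define fb where "fb K = {x \<in> K. f x = y}" for K
          have fbf: "finite (fb K)" if "K \<in> \<K>" for K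
            by (rule finite_subset[OF _ fin[of y]]) (use sub that \<K>F in \<open>auto simp: fb_def\<close>)
          \<comment> \<open>A member of the chain with the fewest points over \<open>y\<close> has only points common to all members.\<close>
          obtain K0 where K0: "K0 \<in> \<K>" "\<And>K. K \<in> \<K> \<Longrightarrow> card (fb K0) \<le> card (fb K)"
            using \<K>ne ex_has_least_nat[of "\<lambda>K. K \<in> \<K>" _ "\<lambda>K. card (fb K)"] by blast
          have "y \<in> f ` K0" using y K0(1) \<K>F by (auto simp: F_def)
          then obtain x where x: "x \<in> fb K0" by (auto simp: fb_def)
          have "x \<in> K" if K: "K \<in> \<K>" for K
          proof (cases "K0 \<subseteq> K")
            case True then show ?thesis using x by (auto simp: fb_def)
          next
            case False
            then have "K \<subseteq> K0" using lin K K0 by blast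
            then have "fb K \<subseteq> fb K0" by (auto simp: fb_def)
            then have "fb K = fb K0" using K0 K fbf by (metis card_seteq)
            then show ?thesis using x by (auto simp: fb_def)
          qed
          then show "y \<in> f ` (\<Inter>\<K>)" using x by (auto simp: fb_def)
        qed
      qed
    qed
    moreover have "\<Union>\<C> = topspace X - \<Inter>\<K>" using CK by auto
    ultimately show "\<Union>\<C> \<in> G" by (auto simp: G_def)
  qed
  then obtain K where K: "K \<in> F" and min: "\<And>L. L \<in> F \<Longrightarrow> L \<subseteq> K \<Longrightarrow> L = K"
  proof -
    assume *: "\<And>K. K \<in> F \<Longrightarrow> (\<And>L. L \<in> F \<Longrightarrow> L \<subseteq> K \<Longrightarrow> L = K) \<Longrightarrow> thesis"
    assume "\<exists>M\<in>G. \<forall>X\<in>G. M \<subseteq> X \<longrightarrow> X = M"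
    then obtain K where K: "K \<in> F"
      and mx: "\<And>L. L \<in> F \<Longrightarrow> topspace X - K \<subseteq> topspace X - L \<Longrightarrow> topspace X - L = topspace X - K"
      by (auto simp: G_def)
    have "L = K" if "L \<in> F" "L \<subseteq> K" for L
    proof -
      have "topspace X - L = topspace X - K" using mx that by blast
      moreover have "L \<subseteq> topspace X" "K \<subseteq> topspace X"
        using that K closedin_subset unfolding F_def by blast+
      ultimately show ?thesis by blast
    qed
    then show thesis using * K by blast
  qed
  have "irreducible_closed X K"
    unfolding irreducible_closed_def
  proof (intro conjI allI impI)
    show "closedin X K" "K \<noteq> {}" using K Cne by (auto simp: F_def)
    fix A B assume AB: "closedin X A \<and> closedin X B \<and> K = A \<union> B"
    then have "closedin Y (f ` A)" "closedin Y (f ` B)" using closed by (auto simp: closed_map_def)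
    moreover have "C = f ` A \<union> f ` B" using K AB by (auto simp: F_def)
    ultimately have "C = f ` A \<or> C = f ` B" using C by (auto simp: irreducible_closed_def)
    then have "A \<in> F \<or> B \<in> F" using K AB by (auto simp: F_def)
    then show "K = A \<or> K = B" using min AB by blast
  qed
  then show ?thesis using K by (auto simp: F_def)
qed

text \<open>
  The largest member is lifted first; each further lift is made inside the previous one, which is why \<open>T\<close>
  is arbitrary.
\<close>

lemma irreducible_chain_lift:
  assumes cont: "continuous_map X Y f" and closed: "closed_map X Y f"
    and fin: "\<And>y. finite {x \<in> topspace X. f x = y}"
    and "\<And>i. i \<le> k \<Longrightarrow> irreducible_closed Y (C i)" "\<And>i. i < k \<Longrightarrow> C i \<subset> C (Suc i)"
    and "closedin X T" "C k \<subseteq> f ` T"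
  shows "\<exists>K. (\<forall>i\<le>k. irreducible_closed X (K i)) \<and> (\<forall>i<k. K i \<subset> K (Suc i)) \<and> K k \<subseteq> T \<and> f ` K k = C k"
  using assms(4-)
proof (induction k arbitrary: T)
  case 0
  obtain T' where "irreducible_closed X T'" "T' \<subseteq> T" "f ` T' = C 0"
    using irreducible_closed_lift[OF cont closed fin 0(1)[OF order_refl] 0(3,4)] by blast
  then show ?case by (intro exI[of _ "\<lambda>_. T'"]) simp
next
  case (Suc k)
  obtain T' where T': "irreducible_closed X T'" "T' \<subseteq> T" "f ` T' = C (Suc k)"
    using irreducible_closed_lift[OF cont closed fin Suc.prems(1)[OF order_refl] Suc.prems(3,4)] by blast
  have "closedin Y (C k)" using Suc.prems(1)[of k] by (simp add: irreducible_closed_def)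
  then have "closedin X {x \<in> topspace X. f x \<in> C k}"
    by (rule closedin_continuous_map_preimage[OF cont])
  moreover have clT': "closedin X T'" using T' by (simp add: irreducible_closed_def)
  ultimately have T'': "closedin X (T' \<inter> {x \<in> topspace X. f x \<in> C k})" by (intro closedin_Int)
  have CC: "C k \<subset> C (Suc k)" using Suc.prems(2)[of k] by simp
  have "T' \<subseteq> topspace X" using clT' by (rule closedin_subset)
  have "C k \<subseteq> f ` (T' \<inter> {x \<in> topspace X. f x \<in> C k})"
  proof
    fix y assume y: "y \<in> C k"
    then have "y \<in> f ` T'" using CC T'(3) by (simp add: subset_iff psubset_eq)
    then obtain x where "x \<in> T'" "y = f x" by (rule imageE)
    then show "y \<in> f ` (T' \<inter> {x \<in> topspace X. f x \<in> C k})"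
      using y \<open>T' \<subseteq> topspace X\<close> by (intro image_eqI[of _ _ x]) (simp_all add: subset_iff)
  qed
  then have "\<exists>K. (\<forall>i\<le>k. irreducible_closed X (K i)) \<and> (\<forall>i<k. K i \<subset> K (Suc i)) \<and>
      K k \<subseteq> T' \<inter> {x \<in> topspace X. f x \<in> C k} \<and> f ` K k = C k"
    by (intro Suc.IH Suc.prems T'') simp_all
  then obtain K where K: "\<forall>i\<le>k. irreducible_closed X (K i)" "\<forall>i<k. K i \<subset> K (Suc i)"
      "K k \<subseteq> T'" "f ` K k = C k" by blast
  have KT: "K k \<subset> T'" using K(3,4) CC T'(3) by blast
  define L where "L i = (if i \<le> k then K i else T')" for i
  have "irreducible_closed X (L i)" for i using K(1) T'(1) by (simp add: L_def)
  moreover have "L i \<subset> L (Suc i)" if "i < Suc k" for i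
  proof (cases "i < k")
    case True then show ?thesis using K(2) by (simp add: L_def)
  next
    case False
    then have "i = k" using that by simp
    then show ?thesis using KT by (simp add: L_def)
  qed
  moreover have "L (Suc k) = T'" by (simp add: L_def)
  ultimately show ?case using T'(2,3) by (intro exI[of _ L]) simp
qed


section \<open>Algebraic independence and derivations of function algebras\<close>

definition fun_algebra :: "('p \<Rightarrow> 'k::comm_ring_1) set \<Rightarrow> bool"
  where "fun_algebra A \<longleftrightarrow> (\<forall>c. (\<lambda>_. c) \<in> A) \<and> (\<forall>f\<in>A. \<forall>g\<in>A. f + g \<in> A \<and> f * g \<in> A)"

text \<open>
  The functions in \<open>R\<close> that vanish on \<open>T\<close> form a prime ideal of \<open>R\<close>. This is how irreducibility of \<open>T\<close> is used.
\<close>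

definition prime_on :: "('p \<Rightarrow> 'k::comm_ring_1) set \<Rightarrow> 'p set \<Rightarrow> bool"
  where "prime_on R T \<longleftrightarrow> T \<noteq> {} \<and> (\<forall>f\<in>R. \<forall>g\<in>R. (\<forall>x\<in>T. f x * g x = 0) \<longrightarrow>
    (\<forall>x\<in>T. f x = 0) \<or> (\<forall>x\<in>T. g x = 0))"

text \<open>
  A derivation of the ring of restrictions to \<open>T\<close> of the functions in \<open>A\<close>. It is represented on the functions
  themselves: the laws hold at the points of \<open>T\<close> only, and by the last condition the restriction of \<open>\<delta> a\<close> to \<open>T\<close>
  depends only on that of \<open>a\<close>.
\<close>

definition derivation_on ::
    "('p \<Rightarrow> 'k::comm_ring_1) set \<Rightarrow> ('p \<Rightarrow> 'k) set \<Rightarrow> 'p set \<Rightarrow> (('p \<Rightarrow> 'k) \<Rightarrow> 'p \<Rightarrow> 'k) \<Rightarrow> bool"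
  where "derivation_on A R T \<delta> \<longleftrightarrow> \<delta> ` A \<subseteq> R \<and>
    (\<forall>a\<in>A. \<forall>b\<in>A. \<forall>x\<in>T. \<delta> (a + b) x = \<delta> a x + \<delta> b x) \<and>
    (\<forall>a\<in>A. \<forall>b\<in>A. \<forall>x\<in>T. \<delta> (a * b) x = \<delta> a x * b x + a x * \<delta> b x) \<and>
    (\<forall>c. \<forall>x\<in>T. \<delta> (\<lambda>_. c) x = 0) \<and>
    (\<forall>a\<in>A. (\<forall>x\<in>T. a x = 0) \<longrightarrow> (\<forall>x\<in>T. \<delta> a x = 0))"

definition polys_over :: "'r::zero set \<Rightarrow> 'r poly set"
  where "polys_over A = {H. \<forall>i. coeff H i \<in> A}"

definition adjoin :: "('p \<Rightarrow> 'k::comm_ring_1) set \<Rightarrow> ('p \<Rightarrow> 'k) \<Rightarrow> ('p \<Rightarrow> 'k) set"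
  where "adjoin A g = (\<lambda>H. poly H g) ` polys_over A"

definition transcendental_on :: "'p set \<Rightarrow> ('p \<Rightarrow> 'k::comm_ring_1) set \<Rightarrow> ('p \<Rightarrow> 'k) \<Rightarrow> bool"
  where "transcendental_on T A g \<longleftrightarrow> (\<forall>H\<in>polys_over A. (\<forall>x\<in>T. poly H g x = 0) \<longrightarrow>
    (\<forall>i. \<forall>x\<in>T. coeff H i x = 0))"

lemma zero_fun_eq: "0 = (\<lambda>_. 0)"
  by (simp add: zero_fun_def)

lemma one_fun_eq: "1 = (\<lambda>_. 1)"
  by (simp add: fun_eq_iff)

lemma fun_algebraD:
  assumes "fun_algebra A"
  shows "(\<lambda>_. c) \<in> A" "0 \<in> A" "1 \<in> A" "f \<in> A \<Longrightarrow> g \<in> A \<Longrightarrow> f + g \<in> A"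
    "f \<in> A \<Longrightarrow> g \<in> A \<Longrightarrow> f * g \<in> A" "f \<in> A \<Longrightarrow> - f \<in> A"
proof -
  show *: "(\<lambda>_. c) \<in> A" "f \<in> A \<Longrightarrow> g \<in> A \<Longrightarrow> f + g \<in> A" "f \<in> A \<Longrightarrow> g \<in> A \<Longrightarrow> f * g \<in> A" for c f g
    using assms by (auto simp: fun_algebra_def)
  show "0 \<in> A" "1 \<in> A" by (simp_all only: zero_fun_eq one_fun_eq *)
  assume "f \<in> A"
  then have "(\<lambda>_. -1) * f \<in> A" using * by blast
  moreover have "(\<lambda>_. -1) * f = - f" by (auto simp: fun_eq_iff)
  ultimately show "- f \<in> A" by simp
qed

lemma fun_algebra_sum:
  assumes "fun_algebra A" "\<And>i. i \<in> I \<Longrightarrow> f i \<in> A"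
  shows "sum f I \<in> A"
  using assms(2) by (induction I rule: infinite_finite_induct) (auto intro: fun_algebraD[OF assms(1)])

lemma fun_algebra_power: "fun_algebra A \<Longrightarrow> f \<in> A \<Longrightarrow> f ^ i \<in> A"
  by (induction i) (auto intro: fun_algebraD)

lemma sum_fun_apply: "(\<Sum>i\<in>I. f i) x = (\<Sum>i\<in>I. f i x)"
  by (induction I rule: infinite_finite_induct) auto

lemma power_fun_apply: "(f ^ n) x = f x ^ n"
  by (induction n) auto

text \<open>
  The two specialisations of a polynomial with function coefficients at a point \<open>x\<close>:
  \<open>at_point x\<close> evaluates the coefficients, \<open>diff_at \<delta> x\<close> differentiates them first.
\<close>

definition at_point :: "'p \<Rightarrow> ('p \<Rightarrow> 'k::comm_ring_1) poly \<Rightarrow> 'k poly"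
  where "at_point x = map_poly (\<lambda>a. a x)"

definition diff_at :: "(('p \<Rightarrow> 'k) \<Rightarrow> 'p \<Rightarrow> 'k) \<Rightarrow> 'p \<Rightarrow> ('p \<Rightarrow> 'k::comm_ring_1) poly \<Rightarrow> 'k poly"
  where "diff_at \<delta> x = map_poly (\<lambda>a. \<delta> a x)"

lemma coeff_at_point [simp]: "coeff (at_point x H) i = coeff H i x"
  by (simp add: at_point_def coeff_map_poly)

lemma at_point_add: "at_point x (H + K) = at_point x H + at_point x K"
  by (rule poly_eqI) simp

lemma at_point_mult: "at_point x (H * K) = at_point x H * at_point x K"
  by (rule poly_eqI) (simp add: coeff_mult sum_fun_apply)

lemma degree_at_point: "degree (at_point x H) \<le> degree H"
  by (rule degree_le) (simp add: coeff_eq_0)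

lemma poly_sum_degree_le:
  fixes p :: "'a::comm_semiring_1 poly"
  assumes "degree p \<le> n"
  shows "poly p x = (\<Sum>i\<le>n. coeff p i * x ^ i)"
  by (subst poly_as_sum_of_monoms'[OF assms, symmetric]) (simp add: poly_sum poly_monom)

lemma poly_apply: "poly H g x = poly (at_point x H) (g x)"
  by (subst poly_sum_degree_le[OF degree_at_point], subst poly_sum_degree_le[OF order_refl])
    (simp add: sum_fun_apply power_fun_apply)

lemma polys_overD: "H \<in> polys_over A \<Longrightarrow> coeff H i \<in> A"
  by (simp add: polys_over_def)

lemma polys_over_closed:
  assumes A: "fun_algebra A"
  shows "H \<in> polys_over A \<Longrightarrow> K \<in> polys_over A \<Longrightarrow> H + K \<in> polys_over A"
    and "H \<in> polys_over A \<Longrightarrow> K \<in> polys_over A \<Longrightarrow> H * K \<in> polys_over A"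
    and "a \<in> A \<Longrightarrow> monom a i \<in> polys_over A"
    and "a \<in> A \<Longrightarrow> [:a:] \<in> polys_over A"
    and "[:0, 1:] \<in> polys_over A"
  using A by (auto simp: polys_over_def coeff_mult coeff_monom coeff_pCons split: nat.split
      intro!: fun_algebra_sum fun_algebraD)

lemma fun_algebra_poly:
  assumes "fun_algebra R" "H \<in> polys_over R" "g \<in> R"
  shows "poly H g \<in> R"
proof -
  have "poly H g = (\<Sum>i\<le>degree H. coeff H i * g ^ i)" by (rule poly_sum_degree_le) simp
  then show ?thesis using assms
    by (auto simp: polys_over_def intro!: fun_algebra_sum fun_algebraD fun_algebra_power)
qed

lemma adjoin_subset:
  assumes "fun_algebra R" "A \<subseteq> R" "g \<in> R"
  shows "adjoin A g \<subseteq> R"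
proof -
  have "polys_over A \<subseteq> polys_over R" using assms(2) by (auto simp: polys_over_def)
  then show ?thesis using assms by (auto simp: adjoin_def intro: fun_algebra_poly)
qed

lemma fun_algebra_adjoin:
  assumes "fun_algebra A"
  shows "fun_algebra (adjoin A g)" "A \<subseteq> adjoin A g" "g \<in> adjoin A g"
proof -
  show sub: "A \<subseteq> adjoin A g"
    using polys_over_closed(4)[OF assms] by (force simp: adjoin_def image_iff)
  show "g \<in> adjoin A g"
    using polys_over_closed(5)[OF assms] by (force simp: adjoin_def image_iff)
  show "fun_algebra (adjoin A g)"
    unfolding fun_algebra_def
  proof (intro conjI allI ballI)
    show "(\<lambda>_. c) \<in> adjoin A g" for c using sub fun_algebraD(1)[OF assms] by blast
    fix f h assume "f \<in> adjoin A g" "h \<in> adjoin A g"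
    then obtain F H where FH: "F \<in> polys_over A" "f = poly F g" "H \<in> polys_over A" "h = poly H g"
      by (auto simp: adjoin_def)
    show "f + h \<in> adjoin A g" unfolding adjoin_def
      by (rule image_eqI[of _ _ "F + H"]) (simp_all add: FH polys_over_closed[OF assms])
    show "f * h \<in> adjoin A g" unfolding adjoin_def
      by (rule image_eqI[of _ _ "F * H"]) (simp_all add: FH polys_over_closed[OF assms])
  qed
qed

lemma derivation_onD:
  assumes "derivation_on A R T \<delta>"
  shows "a \<in> A \<Longrightarrow> \<delta> a \<in> R"
    "a \<in> A \<Longrightarrow> b \<in> A \<Longrightarrow> x \<in> T \<Longrightarrow> \<delta> (a + b) x = \<delta> a x + \<delta> b x"
    "a \<in> A \<Longrightarrow> b \<in> A \<Longrightarrow> x \<in> T \<Longrightarrow> \<delta> (a * b) x = \<delta> a x * b x + a x * \<delta> b x"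
    "x \<in> T \<Longrightarrow> \<delta> (\<lambda>_. c) x = 0" "x \<in> T \<Longrightarrow> \<delta> 0 x = 0" "x \<in> T \<Longrightarrow> \<delta> 1 x = 0"
    "a \<in> A \<Longrightarrow> (\<And>x. x \<in> T \<Longrightarrow> a x = 0) \<Longrightarrow> x \<in> T \<Longrightarrow> \<delta> a x = 0"
  using assms unfolding derivation_on_def zero_fun_eq one_fun_eq by auto

lemma derivation_on_sum:
  assumes d: "derivation_on A R T \<delta>" and A: "fun_algebra A" and "\<And>i. i \<in> I \<Longrightarrow> f i \<in> A" and "x \<in> T"
  shows "\<delta> (sum f I) x = (\<Sum>i\<in>I. \<delta> (f i) x)"
  using assms(3)
proof (induction I rule: infinite_finite_induct)
  case (insert i I)
  then have "sum f I \<in> A" by (intro fun_algebra_sum[OF A]) auto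
  then have "\<delta> (f i + sum f I) x = \<delta> (f i) x + \<delta> (sum f I) x"
    using insert.prems \<open>x \<in> T\<close> by (intro derivation_onD(2)[OF d]) simp_all
  moreover have "\<delta> (sum f I) x = (\<Sum>i\<in>I. \<delta> (f i) x)"
    by (intro insert.IH insert.prems) simp
  ultimately show ?case unfolding sum.insert[OF insert.hyps(1,2)] by (simp only:)
qed (simp_all add: derivation_onD(5)[OF d \<open>x \<in> T\<close>])

context
  fixes A R :: "('p \<Rightarrow> 'k::field_char_0) set" and T :: "'p set" and \<delta> g
  assumes A: "fun_algebra A" and R: "fun_algebra R" and AR: "A \<subseteq> R" and gR: "g \<in> R"
    and d: "derivation_on A R T \<delta>"
begin

lemma coeff_diff_at: "x \<in> T \<Longrightarrow> coeff (diff_at \<delta> x H) i = \<delta> (coeff H i) x"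
  unfolding diff_at_def by (rule coeff_map_poly) (rule derivation_onD(5)[OF d])

lemma diff_at_add:
  assumes "x \<in> T" "H \<in> polys_over A" "K \<in> polys_over A"
  shows "diff_at \<delta> x (H + K) = diff_at \<delta> x H + diff_at \<delta> x K"
  by (rule poly_eqI) (use assms in \<open>simp add: coeff_diff_at derivation_onD(2)[OF d] polys_overD\<close>)

lemma diff_at_mult:
  assumes "x \<in> T" "H \<in> polys_over A" "K \<in> polys_over A"
  shows "diff_at \<delta> x (H * K) = diff_at \<delta> x H * at_point x K + at_point x H * diff_at \<delta> x K"
proof (rule poly_eqI)
  fix i
  have "\<delta> (coeff (H * K) i) x = (\<Sum>j\<le>i. \<delta> (coeff H j * coeff K (i - j)) x)"
    unfolding coeff_mult using assms
    by (intro derivation_on_sum[OF d A] fun_algebraD(5)[OF A]) (auto simp: polys_overD)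
  also have "\<dots> = (\<Sum>j\<le>i. \<delta> (coeff H j) x * coeff K (i - j) x + coeff H j x * \<delta> (coeff K (i - j)) x)"
    using assms by (simp add: derivation_onD(3)[OF d] polys_overD)
  finally show "coeff (diff_at \<delta> x (H * K)) i =
      coeff (diff_at \<delta> x H * at_point x K + at_point x H * diff_at \<delta> x K) i"
    using assms(1) by (simp add: coeff_diff_at coeff_mult sum.distrib)
qed

text \<open>
  By the product rule, a derivation that extends \<open>s \<delta>\<close> and sends \<open>g\<close> to \<open>u\<close> has the value \<open>prolong s u H\<close> at
  \<open>H(g)\<close>.
\<close>

definition prolong :: "('p \<Rightarrow> 'k) \<Rightarrow> ('p \<Rightarrow> 'k) \<Rightarrow> ('p \<Rightarrow> 'k) poly \<Rightarrow> 'p \<Rightarrow> 'k"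
  where "prolong s u H =
    (\<lambda>x. s x * poly (diff_at \<delta> x H) (g x) + u x * poly (pderiv (at_point x H)) (g x))"

lemma prolong_add:
  assumes "x \<in> T" "H \<in> polys_over A" "K \<in> polys_over A"
  shows "prolong s u (H + K) x = prolong s u H x + prolong s u K x"
  using assms by (simp add: prolong_def diff_at_add at_point_add pderiv_add algebra_simps)

lemma prolong_mult:
  assumes "x \<in> T" "H \<in> polys_over A" "K \<in> polys_over A"
  shows "prolong s u (H * K) x = prolong s u H x * poly K g x + poly H g x * prolong s u K x"
  using assms by (simp add: prolong_def diff_at_mult at_point_mult pderiv_mult poly_apply algebra_simps)

lemma prolong_const: "x \<in> T \<Longrightarrow> prolong s u [:a:] x = s x * \<delta> a x"
proof -
  assume x: "x \<in> T"
  have "diff_at \<delta> x [:a:] = [:\<delta> a x:]"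
    by (rule poly_eqI) (auto simp: coeff_diff_at[OF x] coeff_pCons derivation_onD(5)[OF d x] split: nat.split)
  moreover have "at_point x [:a:] = [:a x:]"
    by (rule poly_eqI) (auto simp: coeff_pCons split: nat.split)
  ultimately show ?thesis by (simp add: prolong_def)
qed

lemma prolong_var: "x \<in> T \<Longrightarrow> prolong s u [:0, 1:] x = u x"
proof -
  assume x: "x \<in> T"
  have "diff_at \<delta> x [:0, 1:] = 0"
    by (rule poly_eqI) (auto simp: coeff_diff_at[OF x] coeff_pCons derivation_onD(5,6)[OF d x] split: nat.split)
  moreover have "at_point x [:0, 1:] = [:0, 1 :: 'k:]"
    by (rule poly_eqI) (auto simp: coeff_pCons split: nat.split)
  ultimately show ?thesis by (simp add: prolong_def pderiv_pCons)
qed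

lemma prolong_zero:
  assumes "x \<in> T" "H \<in> polys_over A" "\<And>i y. y \<in> T \<Longrightarrow> coeff H i y = 0"
  shows "prolong s u H x = 0"
proof -
  have "diff_at \<delta> x H = 0"
    by (rule poly_eqI) (use assms in \<open>simp add: coeff_diff_at derivation_onD(7)[OF d] polys_overD\<close>)
  moreover have "at_point x H = 0"
    by (rule poly_eqI) (use assms in simp)
  ultimately show ?thesis by (simp add: prolong_def)
qed

lemma poly_fun_in_algebra:
  assumes f: "\<And>i. (\<lambda>x. coeff (F x) i) \<in> R" and deg: "\<And>x. degree (F x) \<le> n"
  shows "(\<lambda>x. poly (F x) (g x)) \<in> R"
proof -
  have "(\<Sum>i\<le>n. (\<lambda>x. coeff (F x) i) * g ^ i) \<in> R"
    using f gR by (intro fun_algebra_sum[OF R] fun_algebraD(5)[OF R] fun_algebra_power[OF R])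
  moreover have "(\<Sum>i\<le>n. (\<lambda>x. coeff (F x) i) * g ^ i) = (\<lambda>x. poly (F x) (g x))"
    by (auto simp: fun_eq_iff sum_fun_apply power_fun_apply poly_sum_degree_le[OF deg])
  ultimately show ?thesis by simp
qed

text \<open>
  Outside \<open>T\<close> the function \<open>\<delta> 0\<close> may be nonzero, and then \<open>diff_at\<close> is not given by the coefficients \<open>\<delta> (coeff H i)\<close>.
  The sum over the first \<open>degree H\<close> of these coefficients agrees with it on \<open>T\<close> and stays in \<open>R\<close> everywhere.
\<close>

lemma prolong_mem:
  assumes "s \<in> R" "u \<in> R" "H \<in> polys_over A"
  shows "\<exists>f\<in>R. \<forall>x\<in>T. f x = prolong s u H x"
proof -
  define D where "D x = (\<Sum>i\<le>degree H. monom (\<delta> (coeff H i) x) i)" for x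
  have cD: "coeff (D x) i = (if i \<le> degree H then \<delta> (coeff H i) x else 0)" for x i
    by (simp add: D_def coeff_sum)
  have D: "D x = diff_at \<delta> x H" if "x \<in> T" for x
    by (rule poly_eqI) (auto simp: cD coeff_diff_at[OF that] coeff_eq_0 derivation_onD(5)[OF d that])
  have cR: "coeff H i \<in> R" for i using polys_overD[OF assms(3)] AR by blast
  have 1: "(\<lambda>x. poly (D x) (g x)) \<in> R"
  proof (rule poly_fun_in_algebra)
    show "(\<lambda>x. coeff (D x) i) \<in> R" for i
      by (cases "i \<le> degree H")
        (auto simp: cD intro: derivation_onD(1)[OF d] polys_overD[OF assms(3)] fun_algebraD(1)[OF R])
    show "degree (D x) \<le> degree H" for x by (rule degree_le) (simp add: cD)
  qed
  have 2: "(\<lambda>x. poly (pderiv (at_point x H)) (g x)) \<in> R"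
  proof (rule poly_fun_in_algebra)
    have "(\<lambda>x. coeff (pderiv (at_point x H)) i) = (\<lambda>_. of_nat (Suc i)) * coeff H (Suc i)" for i
      by (auto simp: coeff_pderiv fun_eq_iff)
    then show "(\<lambda>x. coeff (pderiv (at_point x H)) i) \<in> R" for i
      using cR fun_algebraD[OF R] by presburger
    show "degree (pderiv (at_point x H)) \<le> degree H" for x
      using degree_at_point[of x H] by (simp add: degree_pderiv)
  qed
  have "s * (\<lambda>x. poly (D x) (g x)) + u * (\<lambda>x. poly (pderiv (at_point x H)) (g x)) \<in> R"
    using 1 2 assms by (intro fun_algebraD(4,5)[OF R])
  then show ?thesis
    by (rule bexI[rotated]) (auto simp: prolong_def D)
qed

text \<open>
  The values of \<open>prolong\<close> depend only on \<open>H(g)\<close> restricted to \<open>T\<close> as soon as every relation \<open>H(g) = 0\<close> on \<open>T\<close> is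
  sent to \<open>0\<close>, and then they define a derivation.
\<close>

lemma derivation_prolong:
  assumes s: "s \<in> R" and u: "u \<in> R"
    and compat: "\<And>H x. H \<in> polys_over A \<Longrightarrow> (\<And>y. y \<in> T \<Longrightarrow> poly H g y = 0) \<Longrightarrow> x \<in> T \<Longrightarrow>
      prolong s u H x = 0"
  shows "\<exists>\<delta>'. derivation_on (adjoin A g) R T \<delta>' \<and> (\<forall>a\<in>A. \<forall>x\<in>T. \<delta>' a x = s x * \<delta> a x) \<and>
    (\<forall>x\<in>T. \<delta>' g x = u x)"
proof -
  define rep where "rep f = (SOME H. H \<in> polys_over A \<and> poly H g = f)" for f
  define \<delta>' where "\<delta>' f = (SOME h. h \<in> R \<and> (\<forall>x\<in>T. h x = prolong s u (rep f) x))" for f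
  have rep: "rep f \<in> polys_over A" "poly (rep f) g = f" if "f \<in> adjoin A g" for f
  proof -
    have "\<exists>H. H \<in> polys_over A \<and> poly H g = f" using that by (auto simp: adjoin_def)
    then have "rep f \<in> polys_over A \<and> poly (rep f) g = f" unfolding rep_def by (rule someI_ex)
    then show "rep f \<in> polys_over A" "poly (rep f) g = f" by auto
  qed
  have \<delta>': "\<delta>' f \<in> R" "\<And>x. x \<in> T \<Longrightarrow> \<delta>' f x = prolong s u (rep f) x" if "f \<in> adjoin A g" for f
  proof -
    have "\<exists>h. h \<in> R \<and> (\<forall>x\<in>T. h x = prolong s u (rep f) x)"
      using prolong_mem[OF s u rep(1)[OF that]] by auto
    then have "\<delta>' f \<in> R \<and> (\<forall>x\<in>T. \<delta>' f x = prolong s u (rep f) x)"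
      unfolding \<delta>'_def by (rule someI_ex)
    then show "\<delta>' f \<in> R" "\<And>x. x \<in> T \<Longrightarrow> \<delta>' f x = prolong s u (rep f) x" by auto
  qed
  have eq: "prolong s u H x = prolong s u K x"
    if "H \<in> polys_over A" "K \<in> polys_over A" "\<And>y. y \<in> T \<Longrightarrow> poly H g y = poly K g y" "x \<in> T" for H K x
  proof -
    define M where "M = [:\<lambda>_. - 1:] * K"
    have M: "M \<in> polys_over A" unfolding M_def
      using that by (intro polys_over_closed[OF A] fun_algebraD(1)[OF A])
    have "prolong s u M x = - prolong s u K x"
      unfolding M_def prolong_mult[OF \<open>x \<in> T\<close> polys_over_closed(4)[OF A fun_algebraD(1)[OF A]] that(2)]
      using prolong_const[OF \<open>x \<in> T\<close>] by (simp add: derivation_onD(4)[OF d \<open>x \<in> T\<close>])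
    moreover have "prolong s u (H + M) x = 0"
      using that M by (intro compat polys_over_closed[OF A]) (auto simp: M_def)
    ultimately show ?thesis using prolong_add[OF \<open>x \<in> T\<close> that(1) M, of s u] by simp
  qed
  have val: "\<delta>' f x = prolong s u H x" if "H \<in> polys_over A" "poly H g = f" "x \<in> T" for H f x
  proof -
    have "f \<in> adjoin A g" using that by (auto simp: adjoin_def)
    then show ?thesis using that rep \<delta>' eq[OF rep(1) that(1)] by simp
  qed
  have "derivation_on (adjoin A g) R T \<delta>'"
    unfolding derivation_on_def
  proof (intro conjI ballI allI impI)
    show "\<delta>' ` adjoin A g \<subseteq> R" using \<delta>' by auto
    fix x assume x: "x \<in> T"
    show "\<delta>' (\<lambda>_. c) x = 0" for c
    proof -
      have "\<delta>' (\<lambda>_. c) x = prolong s u [:\<lambda>_. c:] x"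
        using x by (intro val polys_over_closed[OF A] fun_algebraD[OF A]) auto
      then show ?thesis by (simp add: prolong_const[OF x] derivation_onD(4)[OF d x])
    qed
    fix a assume a: "a \<in> adjoin A g"
    show "\<delta>' a x = 0" if "\<forall>x\<in>T. a x = 0"
      using \<delta>'[OF a] rep[OF a] compat[of "rep a" x] x that by simp
    fix b assume b: "b \<in> adjoin A g"
    have "\<delta>' (a + b) x = prolong s u (rep a + rep b) x"
      using x rep[OF a] rep[OF b] by (intro val polys_over_closed[OF A]) auto
    then show "\<delta>' (a + b) x = \<delta>' a x + \<delta>' b x"
      using \<delta>'(2)[OF a x] \<delta>'(2)[OF b x] prolong_add[OF x rep(1)[OF a] rep(1)[OF b]] by simp
    have "\<delta>' (a * b) x = prolong s u (rep a * rep b) x"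
      using x rep[OF a] rep[OF b] by (intro val polys_over_closed[OF A]) auto
    then show "\<delta>' (a * b) x = \<delta>' a x * b x + a x * \<delta>' b x"
      using \<delta>'(2)[OF a x] \<delta>'(2)[OF b x] prolong_mult[OF x rep(1)[OF a] rep(1)[OF b]] rep(2)[OF a] rep(2)[OF b]
      by simp
  qed
  moreover have "\<delta>' a x = s x * \<delta> a x" if "a \<in> A" "x \<in> T" for a x
    using val[OF polys_over_closed(4)[OF A that(1)] _ that(2), of a] prolong_const[OF that(2)] by simp
  moreover have "\<delta>' g x = u x" if "x \<in> T" for x
    using val[OF polys_over_closed(5)[OF A] _ that, of g] prolong_var[OF that] by simp
  ultimately show ?thesis by blast
qed

text \<open>
  A transcendental \<open>g\<close> satisfies no relation, so its derivative may be prescribed.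
\<close>

lemma derivation_extend_transcendental:
  assumes "transcendental_on T A g"
  shows "\<exists>\<delta>'. derivation_on (adjoin A g) R T \<delta>' \<and> (\<forall>a\<in>A. \<forall>x\<in>T. \<delta>' a x = \<delta> a x) \<and>
    (\<forall>x\<in>T. \<delta>' g x = c)"
proof -
  have "\<exists>\<delta>'. derivation_on (adjoin A g) R T \<delta>' \<and> (\<forall>a\<in>A. \<forall>x\<in>T. \<delta>' a x = (\<lambda>_. 1) x * \<delta> a x) \<and>
    (\<forall>x\<in>T. \<delta>' g x = (\<lambda>_. c) x)"
  proof (rule derivation_prolong)
    show "(\<lambda>_. 1) \<in> R" "(\<lambda>_. c) \<in> R" by (rule fun_algebraD(1)[OF R])+
    fix H x assume "H \<in> polys_over A" "\<And>y. y \<in> T \<Longrightarrow> poly H g y = 0" "x \<in> T"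
    then show "prolong (\<lambda>_. 1) (\<lambda>_. c) H x = 0"
      using assms by (intro prolong_zero) (auto simp: transcendental_on_def)
  qed
  then show ?thesis by simp
qed

text \<open>
  Let \<open>G\<close> be a relation of least degree for \<open>g\<close>. Differentiating \<open>G(g) = 0\<close> shows that the derivative of \<open>g\<close> has
  to be \<open>- (\<delta> G)(g) / G'(g)\<close>, where \<open>G'(g)\<close> does not vanish on \<open>T\<close> by minimality and because the characteristic
  is \<open>0\<close>. The factor \<open>s = G'(g)\<close> clears the denominator. Every other relation is a consequence of \<open>G\<close> up to a
  factor that does not vanish on \<open>T\<close>, by division by \<open>G\<close>.
\<close>

lemma derivation_extend_algebraic:
  assumes prime: "prime_on R T" and alg: "\<not> transcendental_on T A g"
  shows "\<exists>\<delta>' s. s \<in> R \<and> (\<exists>x\<in>T. s x \<noteq> 0) \<and> derivation_on (adjoin A g) R T \<delta>' \<and>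
    (\<forall>a\<in>A. \<forall>x\<in>T. \<delta>' a x = s x * \<delta> a x)"
proof -
  define P where "P G \<longleftrightarrow> G \<in> polys_over A \<and> (\<forall>x\<in>T. poly G g x = 0) \<and> (\<exists>i. \<exists>x\<in>T. coeff G i x \<noteq> 0)" for G
  have "\<exists>G. P G" using alg by (auto simp: transcendental_on_def P_def)
  then obtain G where PG: "P G" and min: "\<And>H. P H \<Longrightarrow> degree G \<le> degree H"
    using ex_has_least_nat[of P _ degree] by blast
  have G: "G \<in> polys_over A" and Gg: "\<And>x. x \<in> T \<Longrightarrow> poly G g x = 0" using PG by (auto simp: P_def)
  define n where "n = degree G"
  define a where "a = coeff G n"
  have aA: "a \<in> A" using G by (simp add: a_def polys_overD)
  have small: "coeff H i x = 0"
    if "H \<in> polys_over A" "\<And>x. x \<in> T \<Longrightarrow> poly H g x = 0" "degree H < n" "x \<in> T" for H i x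
    using min[of H] that by (auto simp: P_def n_def)
  have n0: "n \<noteq> 0"
  proof
    assume "n = 0"
    then obtain b where b: "G = [:b:]" by (auto simp: n_def elim: degree_eq_zeroE)
    obtain i x where "x \<in> T" "coeff G i x \<noteq> 0" using PG by (auto simp: P_def)
    then show False using Gg[of x] by (cases i) (simp_all add: b)
  qed
  have a0: "\<exists>x\<in>T. a x \<noteq> 0"
  proof (rule ccontr)
    assume "\<not> ?thesis"
    then have az: "\<And>x. x \<in> T \<Longrightarrow> a x = 0" by auto
    define H where "H = G + monom (- a) n"
    have H: "H \<in> polys_over A" unfolding H_def
      using G aA by (intro polys_over_closed[OF A] fun_algebraD[OF A])
    have "degree H \<le> n" unfolding H_def n_def
      by (intro degree_add_le degree_monom_le) simp
    moreover have "coeff H n = 0" by (simp add: H_def a_def)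
    ultimately have "degree H < n" using n0 by (metis degree_0 eq_zero_or_degree_less neq0_conv)
    moreover have "poly H g x = 0" if "x \<in> T" for x
      using Gg[OF that] az[OF that] by (simp add: H_def poly_monom)
    ultimately have Hz: "coeff H i x = 0" if "x \<in> T" for i x using small[OF H] that by blast
    have "coeff G i x = 0" if "x \<in> T" for i x
      using Hz[OF that, of i] az[OF that] by (auto simp: H_def a_def split: if_splits)
    then show False using PG by (auto simp: P_def)
  qed
  obtain u where u: "u \<in> R" "\<And>x. x \<in> T \<Longrightarrow> u x = - poly (diff_at \<delta> x G) (g x)"
  proof -
    obtain f where "f \<in> R" "\<forall>x\<in>T. f x = prolong (\<lambda>_. - 1) (\<lambda>_. 0) G x"
      using prolong_mem[OF fun_algebraD(1)[OF R] fun_algebraD(1)[OF R] G] by blast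
    then show thesis by (intro that[of f]) (auto simp: prolong_def)
  qed
  \<comment> \<open>The derivative of \<open>G\<close>, written out because its coefficients lie in a ring with zero divisors.\<close>
  define G' where "G' = (\<Sum>i<n. monom ((\<lambda>_. of_nat (Suc i)) * coeff G (Suc i)) i)"
  have cG': "coeff G' i = (if i < n then (\<lambda>_. of_nat (Suc i)) * coeff G (Suc i) else 0)" for i
    by (simp add: G'_def coeff_sum)
  have G'A: "G' \<in> polys_over A"
    unfolding polys_over_def mem_Collect_eq cG'
    using polys_overD[OF G] fun_algebraD(1,2,5)[OF A] by presburger
  have atG': "at_point x G' = pderiv (at_point x G)" for x
    by (rule poly_eqI) (auto simp: cG' coeff_pderiv coeff_eq_0 n_def)
  define s where "s = poly G' g"
  have sR: "s \<in> R" unfolding s_def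
    using G'A AR gR by (intro fun_algebra_poly[OF R]) (auto simp: polys_over_def)
  have sx: "s x = poly (pderiv (at_point x G)) (g x)" for x
    by (simp add: s_def poly_apply atG')
  have s0: "\<exists>x\<in>T. s x \<noteq> 0"
  proof (rule ccontr)
    assume "\<not> ?thesis"
    then have "\<And>x. x \<in> T \<Longrightarrow> poly G' g x = 0" by (auto simp: s_def)
    moreover have "degree G' < n"
      using n0 degree_le[of "n - 1" G'] by (fastforce simp: cG')
    ultimately have "coeff G' (n - 1) x = 0" if "x \<in> T" for x using small[OF G'A] that by blast
    then have "a x = 0" if "x \<in> T" for x using that n0 by (simp add: cG' a_def)
    then show False using a0 by auto
  qed
  have pG: "prolong s u G x = 0" if "x \<in> T" for x
    using that u(2) by (simp add: prolong_def sx)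
  have compat: "prolong s u H x = 0"
    if "H \<in> polys_over A" "\<And>y. y \<in> T \<Longrightarrow> poly H g y = 0" "x \<in> T" for H x
    using that
  proof (induction "degree H" arbitrary: H x rule: less_induct)
    case less
    show ?case
    proof (cases "\<exists>i. \<exists>x\<in>T. coeff H i x \<noteq> 0")
      case False
      then show ?thesis using less.prems by (intro prolong_zero) auto
    next
      case True
      then have "P H" using less.prems by (auto simp: P_def)
      then have nH: "n \<le> degree H" using min by (simp add: n_def)
      define h where "h = degree H"
      define c where "c = coeff H h"
      have cA: "c \<in> A" using less.prems by (simp add: c_def polys_overD)
      \<comment> \<open>One step of pseudo-division by \<open>G\<close>: the leading terms of \<open>a H\<close> and \<open>c X\<^bsup>h - n\<^esup> G\<close> cancel.\<close>
      define M where "M = monom (- c) (h - n)"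
      define H1 where "H1 = [:a:] * H + M * G"
      have M: "M \<in> polys_over A"
        unfolding M_def using cA by (intro polys_over_closed[OF A] fun_algebraD[OF A])
      have aP: "[:a:] \<in> polys_over A" using aA by (rule polys_over_closed(4)[OF A])
      have H1: "H1 \<in> polys_over A" unfolding H1_def
        using less.prems M aP G by (intro polys_over_closed(1,2)[OF A])
      have "degree (M * G) \<le> h"
      proof -
        have "degree (M * G) \<le> degree M + degree G" by (rule degree_mult_le)
        also have "degree M \<le> h - n" unfolding M_def by (rule degree_monom_le)
        finally show ?thesis using nH by (simp add: n_def h_def)
      qed
      then have "degree H1 \<le> h" unfolding H1_def
        using degree_mult_le[of "[:a:]" H] by (intro degree_add_le) (auto simp: h_def)
      moreover have "coeff H1 h = 0"
      proof -
        have "coeff (M * G) h = - c * a"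
          using nH by (simp add: M_def coeff_monom_mult a_def h_def)
        then show ?thesis by (simp add: H1_def c_def mult.commute)
      qed
      ultimately have "degree H1 < h"
        using nH n0 by (metis degree_0 eq_zero_or_degree_less h_def neq0_conv le_zero_eq)
      moreover have H1g: "poly H1 g y = 0" if "y \<in> T" for y
        using less.prems(2)[OF that] Gg[OF that] by (simp add: H1_def)
      ultimately have 1: "prolong s u H1 y = 0" if "y \<in> T" for y
        using less.hyps[of H1 y] H1 that by (simp add: h_def)
      have "a y * prolong s u H y = 0" if y: "y \<in> T" for y
      proof -
        have "prolong s u H1 y = prolong s u ([:a:] * H) y + prolong s u (M * G) y"
          unfolding H1_def using y less.prems(1) M aP G
          by (intro prolong_add polys_over_closed(1,2)[OF A])
        then show ?thesis
          using 1[OF y] prolong_mult[OF y aP less.prems(1), of s u] prolong_mult[OF y M G, of s u]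
            less.prems(2)[OF y] Gg[OF y] pG[OF y] by simp
      qed
      moreover obtain f where f: "f \<in> R" "\<forall>x\<in>T. f x = prolong s u H x"
        using prolong_mem[OF sR u(1) less.prems(1)] by blast
      ultimately have "\<forall>y\<in>T. a y * f y = 0" by simp
      moreover have "a \<in> R" using aA AR by blast
      ultimately have "\<forall>y\<in>T. f y = 0"
        using prime f(1) a0 unfolding prime_on_def by blast
      then show ?thesis using f less.prems(3) by simp
    qed
  qed
  obtain \<delta>' where "derivation_on (adjoin A g) R T \<delta>'" "\<forall>a\<in>A. \<forall>x\<in>T. \<delta>' a x = s x * \<delta> a x"
    using derivation_prolong[of s u, OF sR u(1) compat] by auto
  then show ?thesis using sR s0 by (intro exI[of _ \<delta>'] exI[of _ s]) simp
qed

lemma derivation_extend: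
  assumes "prime_on R T"
  shows "\<exists>\<delta>' s. s \<in> R \<and> (\<exists>x\<in>T. s x \<noteq> 0) \<and> derivation_on (adjoin A g) R T \<delta>' \<and>
    (\<forall>a\<in>A. \<forall>x\<in>T. \<delta>' a x = s x * \<delta> a x)"
proof (cases "transcendental_on T A g")
  case True
  then obtain \<delta>' where \<delta>': "derivation_on (adjoin A g) R T \<delta>'" "\<forall>a\<in>A. \<forall>x\<in>T. \<delta>' a x = \<delta> a x"
    using derivation_extend_transcendental[of 0] by blast
  moreover have "\<exists>x\<in>T. (\<lambda>_. 1 :: 'k) x \<noteq> 0" using assms by (auto simp: prime_on_def)
  ultimately show ?thesis using fun_algebraD(1)[OF R, of 1]
    by (intro exI[of _ \<delta>'] exI[of _ "\<lambda>_. 1"]) auto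
next
  case False then show ?thesis by (rule derivation_extend_algebraic[OF assms])
qed

end


text \<open>
  The list is read from its end: in an independent list every entry is transcendental over the algebra
  generated by the entries after it.
\<close>

primrec generated :: "('p \<Rightarrow> 'k::comm_ring_1) list \<Rightarrow> ('p \<Rightarrow> 'k) set" where
  "generated [] = range (\<lambda>c _. c)"
| "generated (g # gs) = adjoin (generated gs) g"

primrec alg_independent :: "'p set \<Rightarrow> ('p \<Rightarrow> 'k::comm_ring_1) list \<Rightarrow> bool" where
  "alg_independent T [] \<longleftrightarrow> True"
| "alg_independent T (g # gs) \<longleftrightarrow> transcendental_on T (generated gs) g \<and> alg_independent T gs"

lemma fun_algebra_generated: "fun_algebra (generated gs)"
proof (induction gs)
  case Nil
  have "(\<lambda>_. a) + (\<lambda>_. b) = (\<lambda>_::'a. a + b)" "(\<lambda>_. a) * (\<lambda>_. b) = (\<lambda>_::'a. a * b)" for a b :: 'b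
    by (simp_all add: fun_eq_iff)
  then show ?case by (auto simp: fun_algebra_def)
qed (simp add: fun_algebra_adjoin)

lemma generated_subset:
  assumes "fun_algebra R" "set gs \<subseteq> R"
  shows "generated gs \<subseteq> R"
  using assms(2)
proof (induction gs)
  case Nil
  then show ?case using fun_algebraD(1)[OF assms(1)] by auto
next
  case (Cons g gs)
  then show ?case by (simp add: adjoin_subset[OF assms(1)])
qed

lemma set_subset_generated: "set gs \<subseteq> generated gs"
proof (induction gs)
  case (Cons g gs)
  then show ?case using fun_algebra_adjoin(2,3)[OF fun_algebra_generated[of gs], of g] by auto
qed simp

text \<open>
  The algebra generated by independent functions is a polynomial ring, so that restriction to \<open>T\<close> is
  injective on it.
\<close>

lemma independent_vanish:
  assumes "alg_independent T gs" "T \<noteq> {}" "a \<in> generated gs" "\<And>x. x \<in> T \<Longrightarrow> a x = 0"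
  shows "a y = 0"
  using assms(1,3,4)
proof (induction gs arbitrary: a y)
  case Nil
  then show ?case using assms(2) by auto
next
  case (Cons g gs)
  obtain H where H: "H \<in> polys_over (generated gs)" "a = poly H g"
    using Cons.prems by (auto simp: adjoin_def)
  have "coeff H i x = 0" if "x \<in> T" for i x
    using Cons.prems H that by (auto simp: transcendental_on_def)
  then have "coeff H i y = 0" for i
    using Cons.IH[of "coeff H i" y] Cons.prems(1) polys_overD[OF H(1)] by simp
  then have "at_point y H = 0" by (intro poly_eqI) simp
  then show ?case by (simp add: H poly_apply)
qed

lemma alg_independent_mono:
  assumes "alg_independent T gs" "T \<noteq> {}" "T \<subseteq> T'"
  shows "alg_independent T' gs"
  using assms(1)
proof (induction gs)
  case (Cons g gs)
  have "transcendental_on T' (generated gs) g"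
    unfolding transcendental_on_def
  proof (intro ballI impI allI)
    fix H i x assume H: "H \<in> polys_over (generated gs)" "\<forall>x\<in>T'. poly H g x = 0"
    have "\<forall>x\<in>T. poly H g x = 0" using H(2) assms(3) by blast
    then have "coeff H i y = 0" if "y \<in> T" for y
      using Cons.prems H(1) that by (simp add: transcendental_on_def)
    then show "coeff H i x = 0"
      using Cons.prems assms(2) polys_overD[OF H(1)] by (auto intro: independent_vanish[of T gs "coeff H i"])
  qed
  then show ?case using Cons by simp
qed simp

text \<open>
  A relation for \<open>f\<close> on \<open>T'\<close> may be divided by powers of \<open>f\<close>, since \<open>f\<close> does not vanish on \<open>T'\<close>, until its constant
  term is not zero. As \<open>f\<close> vanishes on \<open>T\<close>, the relation then says that the constant term, an element of the
  algebra generated by the other functions, vanishes on \<open>T\<close>. These functions are independent on \<open>T\<close>, a contradiction.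
\<close>

lemma alg_independent_Cons:
  fixes f :: "'p \<Rightarrow> 'k::idom"
  assumes ind: "alg_independent T gs" and ne: "T \<noteq> {}" and sub: "T \<subseteq> T'"
    and R: "fun_algebra R" and prime: "prime_on R T'" and f: "f \<in> R" and gs: "set gs \<subseteq> R"
    and f0: "\<And>x. x \<in> T \<Longrightarrow> f x = 0" and f1: "\<exists>x\<in>T'. f x \<noteq> 0"
  shows "alg_independent T' (f # gs)"
proof -
  have "transcendental_on T' (generated gs) f"
    unfolding transcendental_on_def
  proof (intro ballI impI, rule ccontr)
    fix H assume H: "H \<in> polys_over (generated gs)" "\<forall>x\<in>T'. poly H f x = 0"
      and "\<not> (\<forall>i. \<forall>x\<in>T'. coeff H i x = 0)"
    then have ex: "\<exists>i. \<exists>x\<in>T'. coeff H i x \<noteq> 0" by auto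
    define i where "i = (LEAST i. \<exists>x\<in>T'. coeff H i x \<noteq> 0)"
    have i: "\<exists>x\<in>T'. coeff H i x \<noteq> 0" unfolding i_def by (rule LeastI_ex[OF ex])
    have lt: "coeff H j x = 0" if "j < i" "x \<in> T'" for j x
      using not_less_Least[of j "\<lambda>i. \<exists>x\<in>T'. coeff H i x \<noteq> 0"] that by (auto simp: i_def)
    define K where "K = poly_shift i H"
    have K: "K \<in> polys_over (generated gs)"
      using H(1) by (simp add: K_def polys_over_def coeff_poly_shift)
    have eq: "at_point x H = monom 1 i * at_point x K" if "x \<in> T'" for x
      by (rule poly_eqI) (auto simp: coeff_monom_mult K_def coeff_poly_shift lt that)
    have "(f ^ i) x * poly K f x = 0" if "x \<in> T'" for x
      using H(2) that eq[OF that] by (auto simp: poly_apply poly_monom power_fun_apply)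
    moreover have "poly K f \<in> R"
      using K generated_subset[OF R gs] f by (intro fun_algebra_poly[OF R]) (auto simp: polys_over_def)
    moreover have "f ^ i \<in> R" by (rule fun_algebra_power[OF R f])
    moreover have "\<not> (\<forall>x\<in>T'. (f ^ i) x = 0)" using f1 by (auto simp: power_fun_apply)
    ultimately have "\<forall>x\<in>T'. poly K f x = 0" using prime unfolding prime_on_def by blast
    then have "coeff H i x = 0" if "x \<in> T" for x
    proof -
      have "x \<in> T'" using sub that by blast
      then have "poly (at_point x K) (f x) = 0"
        using \<open>\<forall>x\<in>T'. poly K f x = 0\<close> by (simp add: poly_apply)
      then have "poly (at_point x K) 0 = 0" by (simp only: f0[OF that])
      then show ?thesis by (simp add: poly_0_coeff_0 K_def coeff_poly_shift)
    qed
    then have "coeff H i x = 0" for x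
      using ind ne polys_overD[OF H(1)] by (auto intro: independent_vanish[of T gs "coeff H i"])
    then show False using i by auto
  qed
  then show ?thesis using alg_independent_mono[OF ind ne sub] by simp
qed

lemma independent_of_chain:
  fixes R :: "('p \<Rightarrow> 'k::idom) set"
  assumes R: "fun_algebra R" and prime: "\<And>i. i \<le> k \<Longrightarrow> prime_on R (T i)"
    and sub: "\<And>i. i < k \<Longrightarrow> T i \<subseteq> T (Suc i)"
    and sep: "\<And>i. i < k \<Longrightarrow> \<exists>f\<in>R. (\<forall>x\<in>T i. f x = 0) \<and> (\<exists>x\<in>T (Suc i). f x \<noteq> 0)"
  shows "\<exists>gs. length gs = k \<and> set gs \<subseteq> R \<and> alg_independent (T k) gs"
  using prime sub sep
proof (induction k)
  case 0
  then show ?case by simp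
next
  case (Suc k)
  have "\<exists>gs. length gs = k \<and> set gs \<subseteq> R \<and> alg_independent (T k) gs"
    by (rule Suc.IH) (use Suc.prems in simp_all)
  then obtain gs where gs: "length gs = k" "set gs \<subseteq> R" "alg_independent (T k) gs" by blast
  obtain f where f: "f \<in> R" "\<forall>x\<in>T k. f x = 0" "\<exists>x\<in>T (Suc k). f x \<noteq> 0"
    using Suc.prems(3)[of k] by auto
  have "T k \<noteq> {}" using Suc.prems(1)[of k] by (simp add: prime_on_def)
  then have "alg_independent (T (Suc k)) (f # gs)"
    using gs f Suc.prems(1)[of "Suc k"] Suc.prems(2)[of k] by (intro alg_independent_Cons[OF _ _ _ R]) auto
  then show ?case using gs f by (intro exI[of _ "f # gs"]) auto
qed

lemma prime_on_prod:
  fixes R :: "('p \<Rightarrow> 'k::idom) set"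
  assumes R: "fun_algebra R" and prime: "prime_on R T" and "finite I"
    and "\<And>i. i \<in> I \<Longrightarrow> f i \<in> R" "\<And>i. i \<in> I \<Longrightarrow> \<exists>x\<in>T. f i x \<noteq> 0"
  shows "\<exists>x\<in>T. \<forall>i\<in>I. f i x \<noteq> 0"
proof -
  have "(\<Prod>i\<in>I. f i) \<in> R \<and> (\<exists>x\<in>T. (\<Prod>i\<in>I. f i) x \<noteq> 0)"
    using assms(3-)
  proof (induction I rule: finite_induct)
    case empty
    then show ?case using fun_algebraD(3)[OF R] prime by (auto simp: prime_on_def one_fun_def)
  next
    case (insert i I)
    then have "f i \<in> R" "(\<Prod>i\<in>I. f i) \<in> R" "\<exists>x\<in>T. f i x \<noteq> 0" "\<exists>x\<in>T. (\<Prod>i\<in>I. f i) x \<noteq> 0" by auto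
    then have "f i * (\<Prod>i\<in>I. f i) \<in> R" "\<exists>x\<in>T. f i x * (\<Prod>i\<in>I. f i) x \<noteq> 0"
      using fun_algebraD(5)[OF R] prime unfolding prime_on_def by blast+
    then show ?case unfolding prod.insert[OF insert.hyps(1,2)] times_fun_apply by (rule conjI)
  qed
  then obtain x where "x \<in> T" "(\<Prod>i\<in>I. f i) x \<noteq> 0" by auto
  moreover have "(\<Prod>i\<in>I. f i) x = (\<Prod>i\<in>I. f i x)"
    using \<open>finite I\<close> by (induction I rule: finite_induct) auto
  ultimately show ?thesis using \<open>finite I\<close> by (intro bexI[of _ x]) auto
qed

lemma derivation_extend_list:
  fixes R :: "('p \<Rightarrow> 'k::field_char_0) set"
  assumes R: "fun_algebra R" and prime: "prime_on R T"
    and "fun_algebra A" "A \<subseteq> R" "derivation_on A R T \<delta>" "set hs \<subseteq> R"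
  shows "\<exists>A' \<delta>' s. fun_algebra A' \<and> A \<subseteq> A' \<and> A' \<subseteq> R \<and> set hs \<subseteq> A' \<and> derivation_on A' R T \<delta>' \<and>
    s \<in> R \<and> (\<exists>x\<in>T. s x \<noteq> 0) \<and> (\<forall>a\<in>A. \<forall>x\<in>T. \<delta>' a x = s x * \<delta> a x)"
  using assms(6)
proof (induction hs)
  case Nil
  have "(\<lambda>_. 1) \<in> R" "\<exists>x\<in>T. (\<lambda>_. 1 :: 'k) x \<noteq> 0"
    using fun_algebraD(1)[OF R] prime by (auto simp: prime_on_def)
  then show ?case using assms(3-5) by (intro exI[of _ A] exI[of _ \<delta>] exI[of _ "\<lambda>_. 1"]) auto
next
  case (Cons h hs)
  then obtain A' \<delta>' s where 1: "fun_algebra A'" "A \<subseteq> A'" "A' \<subseteq> R" "set hs \<subseteq> A'" "derivation_on A' R T \<delta>'"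
    "s \<in> R" "\<exists>x\<in>T. s x \<noteq> 0" "\<forall>a\<in>A. \<forall>x\<in>T. \<delta>' a x = s x * \<delta> a x" by auto
  have hR: "h \<in> R" using Cons.prems by simp
  obtain \<delta>'' s' where 2: "s' \<in> R" "\<exists>x\<in>T. s' x \<noteq> 0" "derivation_on (adjoin A' h) R T \<delta>''"
    "\<forall>a\<in>A'. \<forall>x\<in>T. \<delta>'' a x = s' x * \<delta>' a x"
    using derivation_extend[OF 1(1) R 1(3) hR 1(5) prime] by blast
  have "adjoin A' h \<subseteq> R"
    using hR 1(3) by (intro adjoin_subset[OF R])
  moreover have "\<exists>x\<in>T. (s' * s) x \<noteq> 0"
    using prime 1(6,7) 2(1,2) unfolding prime_on_def times_fun_apply by blast
  moreover have "\<forall>a\<in>A. \<forall>x\<in>T. \<delta>'' a x = (s' * s) x * \<delta> a x"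
    using 1(2,8) 2(4) by (auto simp: mult.assoc)
  moreover have "set (h # hs) \<subseteq> adjoin A' h" "A \<subseteq> adjoin A' h"
    using 1(2,4) fun_algebra_adjoin(2,3)[OF 1(1), of h] by auto
  ultimately show ?case
    using fun_algebra_adjoin(1)[OF 1(1)] fun_algebraD(5)[OF R 2(1) 1(6)] 2(3) by blast
qed

text \<open>
  This is the partial derivative with respect to \<open>g\<close>: it exists on the polynomial ring generated by \<open>g\<close> and
  \<open>vs\<close>, and it is extended to \<open>R\<close> by adjoining the generators \<open>hs\<close> of \<open>R\<close> one after the other.
\<close>

lemma derivation_dual:
  fixes R :: "('p \<Rightarrow> 'k::field_char_0) set"
  assumes R: "fun_algebra R" and prime: "prime_on R T"
    and hs: "set hs \<subseteq> R" "\<And>A. fun_algebra A \<Longrightarrow> set hs \<subseteq> A \<Longrightarrow> R \<subseteq> A"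
    and ind: "alg_independent T (g # vs)" and gv: "set (g # vs) \<subseteq> R"
  shows "\<exists>\<delta>. derivation_on R R T \<delta> \<and> (\<forall>v\<in>set vs. \<forall>x\<in>T. \<delta> v x = 0) \<and> (\<exists>x\<in>T. \<delta> g x \<noteq> 0)"
proof -
  define A where "A = generated vs"
  have A: "fun_algebra A" "A \<subseteq> R" "set vs \<subseteq> A"
    using gv by (auto simp: A_def fun_algebra_generated generated_subset[OF R] subsetD[OF generated_subset[OF R]]
        subsetD[OF set_subset_generated])
  have gR: "g \<in> R" using gv by simp
  have d0: "derivation_on A R T (\<lambda>_. 0)"
    using fun_algebraD(2)[OF R] by (auto simp: derivation_on_def)
  obtain \<delta> where \<delta>: "derivation_on (adjoin A g) R T \<delta>" "\<forall>a\<in>A. \<forall>x\<in>T. \<delta> a x = 0" "\<forall>x\<in>T. \<delta> g x = 1"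
    using derivation_extend_transcendental[OF A(1) R A(2) gR d0, of 1] ind by (auto simp: A_def)
  have sub: "adjoin A g \<subseteq> R"
    using gR A(2) by (intro adjoin_subset[OF R])
  obtain A' \<delta>' s where 1: "fun_algebra A'" "adjoin A g \<subseteq> A'" "A' \<subseteq> R" "set hs \<subseteq> A'"
    "derivation_on A' R T \<delta>'" "\<exists>x\<in>T. s x \<noteq> 0" "\<forall>a\<in>adjoin A g. \<forall>x\<in>T. \<delta>' a x = s x * \<delta> a x"
    using derivation_extend_list[OF R prime fun_algebra_adjoin(1)[OF A(1)] sub \<delta>(1) hs(1)] by blast
  have "A' = R" using 1(3) hs(2)[OF 1(1,4)] by auto
  have sg: "A \<subseteq> adjoin A g" "g \<in> adjoin A g" by (rule fun_algebra_adjoin[OF A(1)])+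
  have "\<delta>' v x = 0" if "v \<in> set vs" "x \<in> T" for v x
  proof -
    have "v \<in> A" "v \<in> adjoin A g" using that A(3) sg by blast+
    then show ?thesis using 1(7) \<delta>(2) that by simp
  qed
  moreover have "\<exists>x\<in>T. \<delta>' g x \<noteq> 0" using 1(6,7) \<delta>(3) sg(2) by simp
  ultimately show ?thesis
    using 1(5) \<open>A' = R\<close> by (intro exI[of _ \<delta>']) auto
qed

text \<open>
  For the ring of polynomial functions these are the tangent vectors at \<open>z\<close> of the Zariski closure of \<open>T\<close>.
\<close>

definition point_derivation ::
    "('p \<Rightarrow> 'k::comm_ring_1) set \<Rightarrow> 'p set \<Rightarrow> 'p \<Rightarrow> (('p \<Rightarrow> 'k) \<Rightarrow> 'k) \<Rightarrow> bool"
  where "point_derivation R T z D \<longleftrightarrow>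
    (\<forall>a\<in>R. \<forall>b\<in>R. D (a + b) = D a + D b) \<and> (\<forall>a\<in>R. \<forall>b\<in>R. D (a * b) = D a * b z + a z * D b) \<and>
    (\<forall>c. D (\<lambda>_. c) = 0) \<and> (\<forall>a\<in>R. (\<forall>x\<in>T. a x = 0) \<longrightarrow> D a = 0)"

lemma point_derivation_of_derivation:
  "derivation_on R R T \<delta> \<Longrightarrow> z \<in> T \<Longrightarrow> point_derivation R T z (\<lambda>f. \<delta> f z)"
  by (auto simp: point_derivation_def derivation_on_def)

lemma point_derivationD:
  assumes "point_derivation R T z D"
  shows "a \<in> R \<Longrightarrow> b \<in> R \<Longrightarrow> D (a + b) = D a + D b"
    "a \<in> R \<Longrightarrow> b \<in> R \<Longrightarrow> D (a * b) = D a * b z + a z * D b"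
    "D (\<lambda>_. c) = 0" "a \<in> R \<Longrightarrow> (\<And>x. x \<in> T \<Longrightarrow> a x = 0) \<Longrightarrow> D a = 0"
  using assms unfolding point_derivation_def by auto

lemma point_derivation_sum:
  assumes "finite I" "\<And>i. i \<in> I \<Longrightarrow> point_derivation R T z (D i)"
  shows "point_derivation R T z (\<lambda>f. \<Sum>i\<in>I. \<alpha> i * D i f)"
  unfolding point_derivation_def
  by (intro conjI ballI allI impI)
    (use assms in \<open>auto simp: point_derivation_def algebra_simps sum.distrib sum_distrib_left sum_distrib_right\<close>)

lemma point_derivation_zero:
  assumes R: "fun_algebra R" and hs: "\<And>A. fun_algebra A \<Longrightarrow> set hs \<subseteq> A \<Longrightarrow> R \<subseteq> A" "set hs \<subseteq> R"
    and D: "point_derivation R T z D" and 0: "\<And>h. h \<in> set hs \<Longrightarrow> D h = 0" and f: "f \<in> R"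
  shows "D f = 0"
proof -
  have "fun_algebra {f\<in>R. D f = 0}"
    using point_derivationD[OF D] fun_algebraD[OF R] by (auto simp: fun_algebra_def)
  moreover have "set hs \<subseteq> {f\<in>R. D f = 0}" using hs(2) 0 by auto
  ultimately show ?thesis using hs(1) f by blast
qed

text \<open>
  The derivations dual to independent functions \<open>g\<^sub>0, \<dots>, g\<^bsub>k - 1\<^esub>\<close> have triangular values on them. At a point
  where none of the diagonal values vanishes, which exists since \<open>T k\<close> is irreducible, they are linearly
  independent, and a point derivation is determined by its values on the generators \<open>hs\<close>.
\<close>

theorem chain_point_derivations:
  fixes R :: "('p \<Rightarrow> 'k::field_char_0) set"
  assumes R: "fun_algebra R" and hs: "set hs \<subseteq> R" "\<And>A. fun_algebra A \<Longrightarrow> set hs \<subseteq> A \<Longrightarrow> R \<subseteq> A"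
    and prime: "\<And>i. i \<le> k \<Longrightarrow> prime_on R (T i)"
    and sub: "\<And>i. i < k \<Longrightarrow> T i \<subseteq> T (Suc i)"
    and sep: "\<And>i. i < k \<Longrightarrow> \<exists>f\<in>R. (\<forall>x\<in>T i. f x = 0) \<and> (\<exists>x\<in>T (Suc i). f x \<noteq> 0)"
  shows "\<exists>z\<in>T k. \<exists>D. (\<forall>l<k. point_derivation R (T k) z (D l)) \<and>
    (\<forall>\<alpha>. (\<forall>h\<in>set hs. (\<Sum>l<k. \<alpha> l * D l h) = 0) \<longrightarrow> (\<forall>l<k. \<alpha> l = 0))"
proof -
  obtain gs where gs: "length gs = k" "set gs \<subseteq> R" "alg_independent (T k) gs"
    using independent_of_chain[where T = T and k = k, OF R prime sub sep] by blast
  have prk: "prime_on R (T k)" by (rule prime) simp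
  have "\<forall>l. \<exists>\<delta>. l < k \<longrightarrow> derivation_on R R (T k) \<delta> \<and> (\<forall>j. l < j \<and> j < k \<longrightarrow> (\<forall>x\<in>T k. \<delta> (gs ! j) x = 0)) \<and>
    (\<exists>x\<in>T k. \<delta> (gs ! l) x \<noteq> 0)"
  proof (rule allI)
    fix l
    show "\<exists>\<delta>. l < k \<longrightarrow> derivation_on R R (T k) \<delta> \<and> (\<forall>j. l < j \<and> j < k \<longrightarrow> (\<forall>x\<in>T k. \<delta> (gs ! j) x = 0)) \<and>
      (\<exists>x\<in>T k. \<delta> (gs ! l) x \<noteq> 0)"
    proof (cases "l < k")
    case l: True
    have dr: "drop l gs = gs ! l # drop (Suc l) gs" using l gs(1) by (simp add: Cons_nth_drop_Suc)
    have "alg_independent (T k) (drop i gs)" for i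
      using gs(3) by (induction gs arbitrary: i) (auto simp: drop_Cons' )
    then have ind: "alg_independent (T k) (gs ! l # drop (Suc l) gs)" using dr by metis
    have "set (gs ! l # drop (Suc l) gs) \<subseteq> R" using gs(2) dr by (metis set_drop_subset subset_trans)
    then obtain \<delta> where \<delta>: "derivation_on R R (T k) \<delta>"
      "\<forall>v\<in>set (drop (Suc l) gs). \<forall>x\<in>T k. \<delta> v x = 0" "\<exists>x\<in>T k. \<delta> (gs ! l) x \<noteq> 0"
      using derivation_dual[OF R prk hs ind] by blast
    have "gs ! j \<in> set (drop (Suc l) gs)" if "l < j" "j < k" for j
    proof -
      have "drop (Suc l) gs ! (j - Suc l) = gs ! j" "j - Suc l < length (drop (Suc l) gs)"
        using that gs(1) by auto
      then show ?thesis by (metis nth_mem)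
    qed
    then show ?thesis using \<delta> by blast
    qed simp
  qed
  from choice[OF this] obtain \<delta> where ch: "\<forall>l. l < k \<longrightarrow> derivation_on R R (T k) (\<delta> l) \<and>
    (\<forall>j. l < j \<and> j < k \<longrightarrow> (\<forall>x\<in>T k. \<delta> l (gs ! j) x = 0)) \<and> (\<exists>x\<in>T k. \<delta> l (gs ! l) x \<noteq> 0)" ..
  then have \<delta>: "\<And>l. l < k \<Longrightarrow> derivation_on R R (T k) (\<delta> l)"
    "\<And>l j x. l < j \<Longrightarrow> j < k \<Longrightarrow> x \<in> T k \<Longrightarrow> \<delta> l (gs ! j) x = 0"
    "\<And>l. l < k \<Longrightarrow> \<exists>x\<in>T k. \<delta> l (gs ! l) x \<noteq> 0"
    by simp_all
  have gR: "gs ! l \<in> R" if "l < k" for l using gs(1,2) that by auto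
  have "\<exists>x\<in>T k. \<forall>l\<in>{..<k}. \<delta> l (gs ! l) x \<noteq> 0"
    using \<delta>(3) by (intro prime_on_prod[OF R prk]) (simp_all add: derivation_onD(1)[OF \<delta>(1)] gR)
  then obtain z where z: "z \<in> T k" "\<And>l. l < k \<Longrightarrow> \<delta> l (gs ! l) z \<noteq> 0" by auto
  define D where "D l f = \<delta> l f z" for l f
  have D: "point_derivation R (T k) z (D l)" if "l < k" for l
    unfolding D_def[abs_def] using point_derivation_of_derivation[OF \<delta>(1)[OF that] z(1)] .
  have "\<alpha> l = 0" if \<alpha>: "\<forall>h\<in>set hs. (\<Sum>l<k. \<alpha> l * D l h) = 0" and l: "l < k" for \<alpha> l
  proof (rule ccontr)
    assume "\<alpha> l \<noteq> 0"
    define S where "S = {l. l < k \<and> \<alpha> l \<noteq> 0}"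
    have S: "finite S" "S \<noteq> {}" using l \<open>\<alpha> l \<noteq> 0\<close> by (auto simp: S_def)
    define j where "j = Max S"
    have j: "j < k" "\<alpha> j \<noteq> 0" using Max_in[OF S] by (auto simp: S_def j_def)
    have big: "\<alpha> i = 0" if "i < k" "j < i" for i
    proof (rule ccontr)
      assume "\<alpha> i \<noteq> 0"
      then have "i \<in> S" using that by (simp add: S_def)
      then show False using Max_ge[OF S(1), of i] that by (simp add: j_def)
    qed
    have "point_derivation R (T k) z (\<lambda>f. \<Sum>l<k. \<alpha> l * D l f)"
      using D by (intro point_derivation_sum) auto
    then have "(\<Sum>l<k. \<alpha> l * D l (gs ! j)) = 0"
      using \<alpha> gR[OF j(1)] hs
      by (intro point_derivation_zero[where D = "\<lambda>f. \<Sum>l<k. \<alpha> l * D l f" and f = "gs ! j" and hs = hs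
            and R = R and T = "T k" and z = z]) (simp_all add: R)
    moreover have "(\<Sum>l<k. \<alpha> l * D l (gs ! j)) = (\<Sum>l\<in>{j}. \<alpha> l * D l (gs ! j))"
    proof (intro sum.mono_neutral_right ballI)
      fix i assume "i \<in> {..<k} - {j}"
      then consider "i < j" | "j < i" "i < k" by fastforce
      then show "\<alpha> i * D i (gs ! j) = 0"
        using \<delta>(2)[of i j z] j(1) z(1) big by cases (auto simp: D_def)
    qed (use j in auto)
    ultimately show False using j z(2)[OF j(1)] by (simp add: D_def)
  qed
  then show ?thesis using z(1) D by (intro bexI[of _ z] exI[of _ D]) auto
qed


section \<open>Polynomials over algebraically closed fields\<close>

lemma proots_alg_closed:
  fixes p :: "'k::alg_closed_field poly"
  assumes p: "p \<noteq> 0"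
  shows "size (proots p) = degree p"
    and "p = smult (lead_coeff p) (\<Prod>x\<in>#proots p. [:-x, 1:])"
proof -
  obtain M where M: "size M = degree p" "p = smult (lead_coeff p) (\<Prod>x\<in>#M. [:-x, 1:])"
    using alg_closed_imp_factorization[OF p] by blast
  have "proots (\<Prod>x\<in>#M. [:-x, 1:]) = M"
  proof (induction M)
    case (add x M)
    have "(\<Prod>x\<in>#M. [:-x, 1:]) \<noteq> 0" by (auto simp: prod_mset_zero_iff)
    then show ?case using add by (simp add: proots_mult del: mult_pCons_left)
  qed simp
  then have *: "proots p = M" using p by (subst M(2)) simp
  show "size (proots p) = degree p" using M(1) by (simp add: *)
  show "p = smult (lead_coeff p) (\<Prod>x\<in>#proots p. [:-x, 1:])" unfolding * by (rule M(2))
qed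

lemma sum_order_le_degree:
  assumes "p \<noteq> 0" "finite S"
  shows "(\<Sum>x\<in>S. order x p) \<le> degree p"
proof -
  have "(\<Sum>x\<in>S. order x p) = (\<Sum>x\<in>S \<inter> {x. poly p x = 0}. order x p)"
    using assms by (intro sum.mono_neutral_right) (auto simp: order_eq_0_iff)
  also have "\<dots> \<le> (\<Sum>x\<in>{x. poly p x = 0}. order x p)"
    using poly_roots_finite[OF assms(1)] by (intro sum_mono2) auto
  also have "\<dots> = size (proots p)" using assms by (simp add: size_multiset_overloaded_eq)
  finally show ?thesis using size_proots_le[of p] by simp
qed

lemma sum_order_eq_degree:
  fixes p :: "'k::alg_closed_field poly"
  assumes "p \<noteq> 0"
  shows "(\<Sum>x | poly p x = 0. order x p) = degree p"
  using proots_alg_closed(1)[OF assms] assms by (simp add: size_multiset_overloaded_eq)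

lemma poly_eq_prod_roots:
  fixes p :: "'k::alg_closed_field poly"
  assumes "p \<noteq> 0"
  shows "p = smult (lead_coeff p) (\<Prod>x | poly p x = 0. [:-x, 1:] ^ order x p)"
  by (subst proots_alg_closed(2)[OF assms]) (use assms in \<open>simp add: image_prod_mset_multiplicity\<close>)

lemma finite_preimage_poly:
  fixes P :: "'k::idom poly"
  assumes "degree P > 0" "finite B"
  shows "finite (poly P -` B)"
proof -
  have "finite {x. poly P x = b}" for b
  proof -
    have "P - [:b:] \<noteq> 0" using assms(1) by (metis degree_pCons_0 eq_iff_diff_eq_0 less_irrefl)
    then show ?thesis using poly_roots_finite[of "P - [:b:]"] by simp
  qed
  moreover have "poly P -` B = (\<Union>b\<in>B. {x. poly P x = b})" by auto
  ultimately show ?thesis using assms(2) by simp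
qed

lemma preimage_poly_sum:
  fixes P :: "'k::idom poly"
  assumes "degree P > 0" "finite B"
  shows "(\<Sum>x\<in>poly P -` B. f x) = (\<Sum>b\<in>B. \<Sum>x | poly P x = b. f x)"
proof -
  have "(\<Sum>x\<in>poly P -` B. f x) = (\<Sum>b\<in>B. \<Sum>x | x \<in> poly P -` B \<and> poly P x = b. f x)"
    using finite_preimage_poly[OF assms] assms(2) by (intro sum.group[symmetric]) auto
  also have "\<dots> = (\<Sum>b\<in>B. \<Sum>x | poly P x = b. f x)"
    by (intro sum.cong refl arg_cong[where f = "sum f"]) auto
  finally show ?thesis .
qed

text \<open>
  Counted with multiplicity, \<open>P\<close> takes the values in \<open>B\<close> exactly \<open>card B * degree P\<close> times. A root of \<open>P - b\<close> of
  multiplicity \<open>\<mu>\<close> is a root of \<open>P'\<close> of multiplicity \<open>\<mu> - 1\<close>, so at most \<open>degree P - 1\<close> of these are lost.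
\<close>

lemma card_preimage_poly_lower:
  fixes P :: "'k::{alg_closed_field, field_char_0} poly"
  assumes P: "degree P > 0" and B: "finite B"
  shows "card B * degree P < card (poly P -` B) + degree P"
proof -
  define A where "A = poly P -` B"
  have A: "finite A" unfolding A_def by (rule finite_preimage_poly[OF assms])
  have nz: "P - [:b:] \<noteq> 0" and deg: "degree (P - [:b:]) = degree P" for b
  proof -
    show "P - [:b:] \<noteq> 0" using P by (metis degree_pCons_0 eq_iff_diff_eq_0 less_irrefl)
    show "degree (P - [:b:]) = degree P"
      using P degree_add_eq_left[of "[:- b:]" P] by (simp only: diff_conv_add_uminus) simp
  qed
  have P': "pderiv P \<noteq> 0" using P by (simp add: pderiv_eq_0_iff)
  have "order x (P - [:b:]) = Suc (order x (pderiv P))" if "poly P x = b" for x b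
    using order_pderiv[OF nz, of b x] that by (simp add: pderiv_diff pderiv_pCons)
  then have "(\<Sum>x | poly P x = b. Suc (order x (pderiv P))) = (\<Sum>x | poly (P - [:b:]) x = 0. order x (P - [:b:]))" for b
    by (intro sum.cong) auto
  then have "(\<Sum>x | poly P x = b. Suc (order x (pderiv P))) = degree P" for b
    using sum_order_eq_degree[OF nz[of b]] deg by simp
  then have "(\<Sum>x\<in>A. Suc (order x (pderiv P))) = card B * degree P"
    unfolding A_def by (simp only: preimage_poly_sum[OF assms]) simp
  then have "card A + (\<Sum>x\<in>A. order x (pderiv P)) = card B * degree P"
    using A by (simp add: sum.distrib sum_Suc)
  moreover have "(\<Sum>x\<in>A. order x (pderiv P)) \<le> degree (pderiv P)"
    by (rule sum_order_le_degree[OF P' A])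
  ultimately show ?thesis using P by (simp add: degree_pderiv A_def)
qed

text \<open>
  By the preceding count, a reducing polynomial between sets of the same size \<open>n \<ge> 2\<close> has degree \<open>1\<close>.
\<close>

lemma affine_of_poly_red:
  fixes A B :: "'k::{alg_closed_field, field_char_0} set"
  assumes A: "A \<in> n_sets n" and B: "B \<in> n_sets n" and n: "n \<ge> 2" and red: "A \<le>\<^sub>p B"
  shows "\<exists>\<alpha> \<beta>. \<alpha> \<noteq> 0 \<and> B = (\<lambda>x. \<alpha> * x + \<beta>) ` A"
proof -
  obtain P where P: "A = poly P -` B" using red by (auto simp: poly_red_def)
  have fin: "finite A" "card A = n" "finite B" "card B = n" using A B by (auto simp: n_sets_def)
  have d0: "degree P > 0"
  proof (rule ccontr)
    assume "\<not> ?thesis"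
    then obtain c where "P = [:c:]" by (auto elim: degree_eq_zeroE)
    then have "A = {} \<or> A = UNIV" using P by auto
    then show False using fin n infinite_UNIV_char_0[where 'a = 'k] by auto
  qed
  have "n * degree P < n + degree P" using card_preimage_poly_lower[OF d0 fin(3)] fin P by simp
  moreover have "n * degree P \<ge> n + degree P" if "degree P \<ge> 2"
  proof -
    have "(n - 1) * (degree P - 1) \<ge> 1 * 1" using n that by (intro mult_mono) auto
    then show ?thesis using n that by (cases n; cases "degree P") (auto simp: algebra_simps)
  qed
  ultimately have "degree P = 1" using d0 by linarith
  define \<alpha> \<beta> where "\<alpha> = coeff P 1" and "\<beta> = coeff P 0"
  have "P = [:\<beta>, \<alpha>:]" using \<open>degree P = 1\<close>
    by (intro poly_eqI) (auto simp: coeff_pCons coeff_eq_0 \<alpha>_def \<beta>_def split: nat.split)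
  moreover from this have "\<alpha> \<noteq> 0" using \<open>degree P = 1\<close> by auto
  ultimately have P': "P = [:\<beta>, \<alpha>:]" "\<alpha> \<noteq> 0" .
  have surj: "y \<in> (\<lambda>x. \<alpha> * x + \<beta>) ` A" if "y \<in> B" for y
  proof (rule image_eqI[of _ _ "(y - \<beta>) / \<alpha>"])
    show "y = \<alpha> * ((y - \<beta>) / \<alpha>) + \<beta>" using P'(2) by simp
    then show "(y - \<beta>) / \<alpha> \<in> A" using that P P' by (simp add: algebra_simps)
  qed
  have "(\<lambda>x. \<alpha> * x + \<beta>) ` A \<subseteq> B" using P P' by (auto simp: algebra_simps)
  then show ?thesis using surj P'(2) by blast
qed

lemma poly_equiv_affine:
  fixes A :: "'k::field set"
  assumes "\<alpha> \<noteq> 0"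
  shows "(\<lambda>x. \<alpha> * x + \<beta>) ` A \<equiv>\<^sub>p A"
proof -
  have "(\<lambda>x. \<alpha> * x + \<beta>) ` A = poly [:- \<beta> / \<alpha>, 1 / \<alpha>:] -` A"
  proof (intro equalityI subsetI)
    fix y assume "y \<in> poly [:- \<beta> / \<alpha>, 1 / \<alpha>:] -` A"
    then have "(y - \<beta>) / \<alpha> \<in> A" by (simp add: diff_divide_distrib)
    then show "y \<in> (\<lambda>x. \<alpha> * x + \<beta>) ` A"
      using assms by (intro image_eqI[of _ _ "(y - \<beta>) / \<alpha>"]) auto
  next
    fix y assume "y \<in> (\<lambda>x. \<alpha> * x + \<beta>) ` A"
    then obtain x where "x \<in> A" "y = \<alpha> * x + \<beta>" by auto
    then show "y \<in> poly [:- \<beta> / \<alpha>, 1 / \<alpha>:] -` A" using assms by (simp add: add_divide_distrib)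
  qed
  moreover have "A = poly [:\<beta>, \<alpha>:] -` ((\<lambda>x. \<alpha> * x + \<beta>) ` A)"
  proof (intro equalityI subsetI)
    fix x assume "x \<in> poly [:\<beta>, \<alpha>:] -` ((\<lambda>x. \<alpha> * x + \<beta>) ` A)"
    then obtain y where "y \<in> A" "\<beta> + x * \<alpha> = \<alpha> * y + \<beta>" by auto
    then show "x \<in> A" using assms by (simp add: mult.commute)
  next
    fix x assume "x \<in> A"
    then have "\<alpha> * x + \<beta> \<in> (\<lambda>x. \<alpha> * x + \<beta>) ` A" by (rule imageI)
    then show "x \<in> poly [:\<beta>, \<alpha>:] -` ((\<lambda>x. \<alpha> * x + \<beta>) ` A)" by (simp add: ac_simps)
  qed
  ultimately show ?thesis unfolding poly_equiv_def poly_red_def by blast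
qed

lemma poly_class_affine:
  fixes A :: "'k::field set"
  shows "\<alpha> \<noteq> 0 \<Longrightarrow> poly_class ((\<lambda>x. \<alpha> * x + \<beta>) ` A) = poly_class A"
  unfolding poly_class_eq_iff by (rule poly_equiv_affine)


section \<open>Polynomial functions and the Zariski topology\<close>

text \<open>
  Polynomial functions rather than polynomials: the arguments about rings of functions apply to them
  directly, and proofs go by induction on their construction.
\<close>

inductive_set polyfuns :: "nat \<Rightarrow> ((nat \<Rightarrow> 'k) \<Rightarrow> 'k::comm_ring_1) set" for m where
  const: "(\<lambda>_. c) \<in> polyfuns m"
| coord: "i < m \<Longrightarrow> (\<lambda>x. x i) \<in> polyfuns m"
| add: "f \<in> polyfuns m \<Longrightarrow> g \<in> polyfuns m \<Longrightarrow> f + g \<in> polyfuns m"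
| mult: "f \<in> polyfuns m \<Longrightarrow> g \<in> polyfuns m \<Longrightarrow> f * g \<in> polyfuns m"

lemma fun_algebra_polyfuns: "fun_algebra (polyfuns m)"
  by (auto simp: fun_algebra_def intro: polyfuns.intros)

definition coords :: "nat \<Rightarrow> ((nat \<Rightarrow> 'k) \<Rightarrow> 'k) list"
  where "coords m = map (\<lambda>i x. x i) [0..<m]"

lemma coords_subset: "set (coords m) \<subseteq> polyfuns m"
  by (auto simp: coords_def intro: polyfuns.coord)

lemma polyfuns_least:
  fixes A :: "((nat \<Rightarrow> 'k) \<Rightarrow> 'k::comm_ring_1) set"
  assumes "fun_algebra A" "set (coords m) \<subseteq> A"
  shows "polyfuns m \<subseteq> A"
proof
  fix f :: "(nat \<Rightarrow> 'k) \<Rightarrow> 'k" assume "f \<in> polyfuns m"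
  then show "f \<in> A"
  proof induction
    case (coord i)
    then have "(\<lambda>x. x i) \<in> set (coords m)" by (auto simp: coords_def)
    then show ?case using assms(2) by blast
  qed (intro fun_algebraD[OF assms(1)] | assumption)+
qed

lemma fun_algebra_prod:
  assumes "fun_algebra A" "\<And>i. i \<in> I \<Longrightarrow> f i \<in> A"
  shows "prod f I \<in> A"
  using assms(2) by (induction I rule: infinite_finite_induct) (auto intro: fun_algebraD[OF assms(1)])

lemma prod_fun_apply: "(\<Prod>i\<in>I. f i) x = (\<Prod>i\<in>I. f i x)"
  by (induction I rule: infinite_finite_induct) auto

lemmas polyfuns_closed = fun_algebraD[OF fun_algebra_polyfuns] fun_algebra_sum[OF fun_algebra_polyfuns]
  fun_algebra_prod[OF fun_algebra_polyfuns] fun_algebra_power[OF fun_algebra_polyfuns]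

lemma polyfunsI:
  shows "f \<in> polyfuns m \<Longrightarrow> g \<in> polyfuns m \<Longrightarrow> (\<lambda>x. f x + g x) \<in> polyfuns m"
    and "f \<in> polyfuns m \<Longrightarrow> g \<in> polyfuns m \<Longrightarrow> (\<lambda>x. f x - g x) \<in> polyfuns m"
    and "f \<in> polyfuns m \<Longrightarrow> g \<in> polyfuns m \<Longrightarrow> (\<lambda>x. f x * g x) \<in> polyfuns m"
    and "f \<in> polyfuns m \<Longrightarrow> (\<lambda>x. - f x) \<in> polyfuns m"
    and "f \<in> polyfuns m \<Longrightarrow> (\<lambda>x. f x ^ j) \<in> polyfuns m"
    and "(\<And>i. i \<in> I \<Longrightarrow> h i \<in> polyfuns m) \<Longrightarrow> (\<lambda>x. \<Sum>i\<in>I. h i x) \<in> polyfuns m"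
    and "(\<And>i. i \<in> I \<Longrightarrow> h i \<in> polyfuns m) \<Longrightarrow> (\<lambda>x. \<Prod>i\<in>I. h i x) \<in> polyfuns m"
proof -
  have eqs: "(\<lambda>x. f x + g x) = f + g" "(\<lambda>x. f x - g x) = f - g" "(\<lambda>x. f x * g x) = f * g" "(\<lambda>x. - f x) = - f"
    "(\<lambda>x. f x ^ j) = f ^ j" "(\<lambda>x. \<Sum>i\<in>I. h i x) = sum h I" "(\<lambda>x. \<Prod>i\<in>I. h i x) = prod h I"
    by (simp_all add: fun_eq_iff power_fun_apply sum_fun_apply prod_fun_apply)
  have diff: "f - g \<in> polyfuns m" if "f \<in> polyfuns m" "g \<in> polyfuns m"
    using polyfuns_closed(4)[OF that(1) polyfuns_closed(6)[OF that(2)]] by (simp only: diff_conv_add_uminus)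
  show "f \<in> polyfuns m \<Longrightarrow> g \<in> polyfuns m \<Longrightarrow> (\<lambda>x. f x + g x) \<in> polyfuns m"
    "f \<in> polyfuns m \<Longrightarrow> g \<in> polyfuns m \<Longrightarrow> (\<lambda>x. f x - g x) \<in> polyfuns m"
    "f \<in> polyfuns m \<Longrightarrow> g \<in> polyfuns m \<Longrightarrow> (\<lambda>x. f x * g x) \<in> polyfuns m"
    "f \<in> polyfuns m \<Longrightarrow> (\<lambda>x. - f x) \<in> polyfuns m"
    "f \<in> polyfuns m \<Longrightarrow> (\<lambda>x. f x ^ j) \<in> polyfuns m"
    "(\<And>i. i \<in> I \<Longrightarrow> h i \<in> polyfuns m) \<Longrightarrow> (\<lambda>x. \<Sum>i\<in>I. h i x) \<in> polyfuns m"
    "(\<And>i. i \<in> I \<Longrightarrow> h i \<in> polyfuns m) \<Longrightarrow> (\<lambda>x. \<Prod>i\<in>I. h i x) \<in> polyfuns m"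
    unfolding eqs by (auto intro: polyfuns_closed diff)
qed

lemma mpoly_eval_polyfun:
  assumes "p \<in> mpolys m"
  shows "mpoly_eval p \<in> polyfuns m"
  unfolding mpoly_eval_def mono_eval_def
  by (intro polyfunsI polyfuns.const polyfuns.coord) (use assms in \<open>auto simp: mpolys_def\<close>)

lemma polyfun_mpoly_eval:
  assumes "f \<in> polyfuns m"
  shows "\<exists>p\<in>mpolys m. mpoly_eval p = f"
  using assms
proof induction
  case (const c)
  have "mpoly_eval (Poly_Mapping.single 0 c) = (\<lambda>_. c)"
    by (simp add: fun_eq_iff mpoly_eval_single mono_eval_def)
  moreover have "Poly_Mapping.single 0 c \<in> mpolys m" by (auto simp: mpolys_def)
  ultimately show ?case by blast
next
  case (coord i)
  have "mpoly_eval (Poly_Mapping.single (Poly_Mapping.single i 1) 1) = (\<lambda>x. x i)"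
    by (simp add: fun_eq_iff mpoly_eval_single mono_eval_def)
  moreover have "Poly_Mapping.single (Poly_Mapping.single i 1) 1 \<in> mpolys m"
    using coord by (auto simp: mpolys_def)
  ultimately show ?case by blast
next
  case (add f g)
  then obtain p q where "p \<in> mpolys m" "mpoly_eval p = f" "q \<in> mpolys m" "mpoly_eval q = g" by blast
  moreover from this have "p + q \<in> mpolys m"
    using Poly_Mapping.keys_add[of p q] unfolding mpolys_def by blast
  ultimately show ?case by (intro bexI[of _ "p + q"]) (auto simp: fun_eq_iff mpoly_eval_add)
next
  case (mult f g)
  then obtain p q where "p \<in> mpolys m" "mpoly_eval p = f" "q \<in> mpolys m" "mpoly_eval q = g" by blast
  then show ?case by (intro bexI[of _ "p * q"]) (auto simp: fun_eq_iff mpoly_eval_mult mpolys_mult)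
qed

lemma closedin_zariski_iff:
  "closedin (zariski m) Z \<longleftrightarrow> (\<exists>F\<subseteq>polyfuns m. Z = {x \<in> affine_space m. \<forall>f\<in>F. f x = 0})"
proof
  assume "closedin (zariski m) Z"
  then obtain F where F: "F \<subseteq> mpolys m" "Z = zero_locus m F" by (auto simp: closedin_zariski)
  then show "\<exists>F\<subseteq>polyfuns m. Z = {x \<in> affine_space m. \<forall>f\<in>F. f x = 0}"
    using mpoly_eval_polyfun by (intro exI[of _ "mpoly_eval ` F"]) (auto simp: zero_locus_def)
next
  assume "\<exists>F\<subseteq>polyfuns m. Z = {x \<in> affine_space m. \<forall>f\<in>F. f x = 0}"
  then obtain F where F: "F \<subseteq> polyfuns m" "Z = {x \<in> affine_space m. \<forall>f\<in>F. f x = 0}" by blast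
  define G where "G = {p \<in> mpolys m. mpoly_eval p \<in> F}"
  have "Z = zero_locus m G"
  proof (intro equalityI subsetI)
    fix x assume x: "x \<in> zero_locus m G"
    have "f x = 0" if f: "f \<in> F" for f
    proof -
      obtain p where "p \<in> mpolys m" "mpoly_eval p = f" using polyfun_mpoly_eval F(1) f by blast
      then show ?thesis using x f by (auto simp: zero_locus_def G_def)
    qed
    then show "x \<in> Z" using x F(2) by (auto simp: zero_locus_def)
  qed (auto simp: F(2) zero_locus_def G_def)
  then show "closedin (zariski m) Z" unfolding closedin_zariski
    by (intro exI[of _ G]) (simp add: G_def)
qed

lemma closedin_subtopology_zariski:
  assumes "S \<subseteq> affine_space m"
  shows "closedin (subtopology (zariski m) S) Z \<longleftrightarrow> (\<exists>F\<subseteq>polyfuns m. Z = {x \<in> S. \<forall>f\<in>F. f x = 0})"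
proof -
  have "{x \<in> S. \<forall>f\<in>F. f x = 0} = {x \<in> affine_space m. \<forall>f\<in>F. f x = 0} \<inter> S" for F :: "((nat \<Rightarrow> 'a) \<Rightarrow> 'a) set"
    using assms by auto
  then show ?thesis unfolding closedin_subtopology closedin_zariski_iff by (auto; blast)
qed

lemma prime_on_irreducible:
  fixes S :: "(nat \<Rightarrow> 'k::idom) set"
  assumes S: "S \<subseteq> affine_space m" and C: "irreducible_closed (subtopology (zariski m) S) C"
  shows "prime_on (polyfuns m) C"
  unfolding prime_on_def
proof (intro conjI ballI impI)
  show "C \<noteq> {}" using C by (simp add: irreducible_closed_def)
  fix f g :: "(nat \<Rightarrow> 'k) \<Rightarrow> 'k"
  assume fg: "f \<in> polyfuns m" "g \<in> polyfuns m" "\<forall>x\<in>C. f x * g x = 0"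
  have cl: "closedin (subtopology (zariski m) S) {x \<in> S. h x = 0}" if "h \<in> polyfuns m" for h
    unfolding closedin_subtopology_zariski[OF S] using that by (intro exI[of _ "{h}"]) auto
  have "C \<subseteq> S" using C closedin_subset by (fastforce simp: irreducible_closed_def)
  then have "C \<subseteq> {x \<in> S. f x = 0} \<union> {x \<in> S. g x = 0}" using fg(3) by auto
  then have "C \<subseteq> {x \<in> S. f x = 0} \<or> C \<subseteq> {x \<in> S. g x = 0}"
    by (rule irreducible_closed_subset_cover[OF C cl[OF fg(1)] cl[OF fg(2)]])
  then show "(\<forall>x\<in>C. f x = 0) \<or> (\<forall>x\<in>C. g x = 0)" by auto
qed

lemma separating_polyfun:
  assumes S: "S \<subseteq> affine_space m" and C: "closedin (subtopology (zariski m) S) C"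
    and sub: "C \<subset> C'" "C' \<subseteq> S"
  shows "\<exists>f\<in>polyfuns m. (\<forall>x\<in>C. f x = 0) \<and> (\<exists>x\<in>C'. f x \<noteq> 0)"
proof -
  obtain F where F: "F \<subseteq> polyfuns m" "C = {x \<in> S. \<forall>f\<in>F. f x = 0}"
    using C unfolding closedin_subtopology_zariski[OF S] by blast
  obtain x where x: "x \<in> C'" "x \<notin> C" using sub by blast
  then obtain f where "f \<in> F" "f x \<noteq> 0" using F sub by blast
  then show ?thesis using F x by (intro bexI[of _ f]) auto
qed

section \<open>The slice of normalised tuples\<close>

lemma distinct_tuples_subset: "distinct_tuples m \<subseteq> affine_space m"
  by (auto simp: distinct_tuples_def)

lemma topspace_distinct_tuples: "topspace (subtopology (zariski m) (distinct_tuples m)) = distinct_tuples m"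
  using distinct_tuples_subset by auto

lemma distinct_tuple_n_set: "x \<in> distinct_tuples m \<Longrightarrow> x ` {..<m} \<in> n_sets m"
  by (auto simp: distinct_tuples_def n_sets_def card_image)

lemma n_set_distinct_tuple:
  assumes "A \<in> n_sets m"
  obtains x where "x \<in> distinct_tuples m" "x ` {..<m} = A"
proof -
  obtain x where x: "bij_betw x {..<m} A"
    using assms unfolding n_sets_def using ex_bij_betw_nat_finite[of A] by (auto simp: atLeast0LessThan)
  have "bij_betw (restrict x {..<m}) {..<m} A"
    using x bij_betw_cong[of "{..<m}" "restrict x {..<m}" x A] by simp
  moreover have "restrict x {..<m} \<in> affine_space m" by (auto simp: affine_space_def)
  ultimately show thesis by (intro that[of "restrict x {..<m}"]) (auto simp: distinct_tuples_def bij_betw_def)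
qed

definition tuple_class :: "nat \<Rightarrow> (nat \<Rightarrow> 'k::comm_ring_1) \<Rightarrow> 'k set set"
  where "tuple_class m x = poly_class (x ` {..<m})"

lemma closedin_n_classes_top:
  fixes K :: "'k::idom set set set"
  shows "closedin (n_classes_top m) K \<longleftrightarrow> K \<subseteq> n_classes m \<and>
    (\<exists>F\<subseteq>polyfuns m. {x \<in> distinct_tuples m. tuple_class m x \<in> K} = {x \<in> distinct_tuples m. \<forall>f\<in>F. f x = 0})"
proof -
  have *: "closedin (n_classes_top m) K \<longleftrightarrow>
    closedin (subtopology (zariski m) (distinct_tuples m)) {x \<in> distinct_tuples m. tuple_class m x \<in> K}"
    if "K \<subseteq> n_classes m"
    using quotient_map_n_classes_top[of m, where 'a = 'k] that
    unfolding quotient_map_closedin topspace_distinct_tuples tuple_class_def by auto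
  show ?thesis
  proof
    assume K: "closedin (n_classes_top m) K"
    then have "K \<subseteq> n_classes m" using closedin_subset by fastforce
    then show "K \<subseteq> n_classes m \<and>
      (\<exists>F\<subseteq>polyfuns m. {x \<in> distinct_tuples m. tuple_class m x \<in> K} = {x \<in> distinct_tuples m. \<forall>f\<in>F. f x = 0})"
      using * K closedin_subtopology_zariski[OF distinct_tuples_subset] by blast
  next
    assume "K \<subseteq> n_classes m \<and>
      (\<exists>F\<subseteq>polyfuns m. {x \<in> distinct_tuples m. tuple_class m x \<in> K} = {x \<in> distinct_tuples m. \<forall>f\<in>F. f x = 0})"
    then show "closedin (n_classes_top m) K"
      using * closedin_subtopology_zariski[OF distinct_tuples_subset] by blast
  qed
qed

definition slice :: "nat \<Rightarrow> (nat \<Rightarrow> 'k::comm_ring_1) set"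
  where "slice m = {y \<in> distinct_tuples m. y 0 = 0 \<and> y 1 = 1}"

text \<open>
  The tuple \<open>x\<close>, permuted by \<open>\<sigma>\<close> and moved into the slice by the affine map that this determines.
\<close>

definition normalise :: "nat \<Rightarrow> (nat \<Rightarrow> nat) \<Rightarrow> (nat \<Rightarrow> 'k::field) \<Rightarrow> nat \<Rightarrow> 'k"
  where "normalise m \<sigma> x = (\<lambda>i\<in>{..<m}. (x (\<sigma> i) - x (\<sigma> 0)) / (x (\<sigma> 1) - x (\<sigma> 0)))"

context
  fixes m :: nat
  assumes m: "m \<ge> 2"
begin

lemma normalise_class:
  fixes x :: "nat \<Rightarrow> 'k::field"
  assumes x: "x \<in> distinct_tuples m" and \<sigma>: "\<sigma> permutes {..<m}"
  shows "normalise m \<sigma> x \<in> slice m" "tuple_class m (normalise m \<sigma> x) = tuple_class m x"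
proof -
  have inj: "inj_on x {..<m}" using x by (simp add: distinct_tuples_def)
  have \<sigma>m: "\<sigma> i < m" if "i < m" for i using permutes_in_image[OF \<sigma>, of i] that by simp
  have \<sigma>i: "\<sigma> i = \<sigma> j \<longleftrightarrow> i = j" for i j using permutes_inj[OF \<sigma>] by (auto dest: injD)
  define c where "c = x (\<sigma> 1) - x (\<sigma> 0)"
  have xe: "x (\<sigma> i) = x (\<sigma> j) \<longleftrightarrow> i = j" if "i < m" "j < m" for i j
    using inj_on_eq_iff[OF inj] \<sigma>m that \<sigma>i by simp
  have c: "c \<noteq> 0" using xe[of 1 0] m by (simp add: c_def)
  have n: "normalise m \<sigma> x i = (x (\<sigma> i) - x (\<sigma> 0)) / c" if "i < m" for i
    using that by (simp add: normalise_def c_def)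
  show "normalise m \<sigma> x \<in> slice m"
    unfolding slice_def distinct_tuples_def
  proof (intro CollectI conjI inj_onI)
    show "normalise m \<sigma> x \<in> affine_space m" by (auto simp: normalise_def affine_space_def)
    show "normalise m \<sigma> x 0 = 0" "normalise m \<sigma> x 1 = 1" using m c by (simp_all add: n, simp add: c_def)
    fix i j assume "i \<in> {..<m}" "j \<in> {..<m}" "normalise m \<sigma> x i = normalise m \<sigma> x j"
    then show "i = j" using n c xe by simp
  qed
  have "normalise m \<sigma> x ` {..<m} = (\<lambda>z. (1 / c) * z + (- x (\<sigma> 0) / c)) ` x ` \<sigma> ` {..<m}"
    unfolding image_image by (rule image_cong) (auto simp: n diff_divide_distrib)
  also have "\<sigma> ` {..<m} = {..<m}" by (rule permutes_image[OF \<sigma>])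
  finally have e: "normalise m \<sigma> x ` {..<m} = (\<lambda>z. (1 / c) * z + (- x (\<sigma> 0) / c)) ` x ` {..<m}" .
  show "tuple_class m (normalise m \<sigma> x) = tuple_class m x"
    unfolding tuple_class_def e by (rule poly_class_affine) (use c in simp)
qed

lemma slice_class_eq_normalise:
  fixes x y :: "nat \<Rightarrow> 'k::{alg_closed_field, field_char_0}"
  assumes x: "x \<in> distinct_tuples m" and y: "y \<in> slice m" and eq: "tuple_class m y = tuple_class m x"
  shows "\<exists>\<sigma>. \<sigma> permutes {..<m} \<and> y = normalise m \<sigma> x"
proof -
  have yd: "y \<in> distinct_tuples m" "y 0 = 0" "y 1 = 1" using y by (auto simp: slice_def)
  have "x ` {..<m} \<le>\<^sub>p y ` {..<m}"
    using eq by (simp add: tuple_class_def poly_class_eq_iff poly_equiv_def)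
  then obtain \<alpha> \<beta> where ab: "\<alpha> \<noteq> 0" "y ` {..<m} = (\<lambda>z. \<alpha> * z + \<beta>) ` x ` {..<m}"
    using affine_of_poly_red[OF distinct_tuple_n_set[OF x] distinct_tuple_n_set[OF yd(1)] m] by blast
  have injx: "inj_on x {..<m}" and injy: "inj_on y {..<m}" using x yd by (auto simp: distinct_tuples_def)
  have "\<forall>i\<in>{..<m}. \<exists>j\<in>{..<m}. y i = \<alpha> * x j + \<beta>" using ab(2) by blast
  then obtain s where s: "\<And>i. i < m \<Longrightarrow> s i < m \<and> y i = \<alpha> * x (s i) + \<beta>" by (metis lessThan_iff)
  define \<sigma> where "\<sigma> i = (if i < m then s i else i)" for i
  have "inj_on \<sigma> {..<m}"
  proof (rule inj_onI)
    fix i j assume ij: "i \<in> {..<m}" "j \<in> {..<m}" "\<sigma> i = \<sigma> j"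
    then have "y i = y j" using s by (simp add: \<sigma>_def)
    then show "i = j" using inj_onD[OF injy] ij by blast
  qed
  moreover have "\<sigma> ` {..<m} \<subseteq> {..<m}" using s by (auto simp: \<sigma>_def)
  ultimately have "bij_betw \<sigma> {..<m} {..<m}"
    by (simp add: bij_betw_def endo_inj_surj)
  then have \<sigma>: "\<sigma> permutes {..<m}" by (rule bij_imp_permutes) (simp add: \<sigma>_def)
  have 0: "\<beta> = - \<alpha> * x (s 0)" using s[of 0] yd(2) m by (simp add: eq_neg_iff_add_eq_0 add.commute)
  have 1: "\<alpha> * (x (s 1) - x (s 0)) = 1" using s[of 1] yd(3) m by (simp add: 0 algebra_simps)
  then have c: "x (s 1) - x (s 0) \<noteq> 0" by auto
  then have c': "\<alpha> = 1 / (x (s 1) - x (s 0))" using 1 by (simp only: nonzero_eq_divide_eq not_False_eq_True)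
  have "y i = normalise m \<sigma> x i" for i
  proof (cases "i < m")
    case True
    then have "y i = \<alpha> * (x (s i) - x (s 0))" using s 0 by (simp add: algebra_simps)
    then show ?thesis using True m c' by (simp add: normalise_def \<sigma>_def)
  next
    case False
    then show ?thesis using yd(1) by (auto simp: normalise_def distinct_tuples_def affine_space_def)
  qed
  then show ?thesis using \<sigma> by (intro exI[of _ \<sigma>]) (simp add: fun_eq_iff)
qed

text \<open>
  Composed with \<open>normalise\<close>, a polynomial function becomes rational; its denominator is a power of a
  difference of two entries, which has no zero on tuples of distinct entries.
\<close>

lemma polyfun_normalise:
  fixes f :: "(nat \<Rightarrow> 'k::field) \<Rightarrow> 'k"
  assumes "f \<in> polyfuns m" and \<sigma>: "\<sigma> permutes {..<m}"
  shows "\<exists>g\<in>polyfuns m. \<exists>e. \<forall>x\<in>distinct_tuples m. g x = (x (\<sigma> 1) - x (\<sigma> 0)) ^ e * f (normalise m \<sigma> x)"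
  using assms(1)
proof induction
  case (const c)
  show ?case by (rule bexI[OF _ polyfuns.const[of c]], rule exI[of _ 0]) simp
next
  case (coord i)
  have \<sigma>m: "\<sigma> i < m" if "i < m" for i using permutes_in_image[OF \<sigma>, of i] that by simp
  have nz: "x (\<sigma> 1) - x (\<sigma> 0) \<noteq> 0" if "x \<in> distinct_tuples m" for x :: "nat \<Rightarrow> 'k"
  proof -
    have "x (\<sigma> 1) = x (\<sigma> 0) \<longleftrightarrow> \<sigma> 1 = \<sigma> 0"
      using that \<sigma>m m by (intro inj_on_eq_iff[of x "{..<m}"]) (auto simp: distinct_tuples_def)
    moreover have "\<sigma> 1 \<noteq> \<sigma> 0" using permutes_inj[OF \<sigma>] by (auto dest: injD)
    ultimately show ?thesis by simp
  qed
  show ?case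
    by (rule bexI[of _ "\<lambda>x. x (\<sigma> i) - x (\<sigma> 0)"], rule exI[of _ 1])
      (use coord m \<sigma>m nz in \<open>auto simp: normalise_def intro!: polyfunsI polyfuns.coord\<close>)
next
  case (add f g)
  then obtain f' e g' e' where "f' \<in> polyfuns m" "g' \<in> polyfuns m"
    "\<forall>x\<in>distinct_tuples m. f' x = (x (\<sigma> 1) - x (\<sigma> 0)) ^ e * f (normalise m \<sigma> x)"
    "\<forall>x\<in>distinct_tuples m. g' x = (x (\<sigma> 1) - x (\<sigma> 0)) ^ e' * g (normalise m \<sigma> x)" by blast
  moreover have "\<sigma> 1 < m" "\<sigma> 0 < m" using permutes_in_image[OF \<sigma>] m by (simp_all)
  ultimately show ?case
    by (intro bexI[of _ "\<lambda>x. (x (\<sigma> 1) - x (\<sigma> 0)) ^ e' * f' x + (x (\<sigma> 1) - x (\<sigma> 0)) ^ e * g' x"] exI[of _ "e + e'"])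
      (auto simp: power_add algebra_simps intro!: polyfunsI polyfuns.coord)
next
  case (mult f g)
  then obtain f' e g' e' where "f' \<in> polyfuns m" "g' \<in> polyfuns m"
    "\<forall>x\<in>distinct_tuples m. f' x = (x (\<sigma> 1) - x (\<sigma> 0)) ^ e * f (normalise m \<sigma> x)"
    "\<forall>x\<in>distinct_tuples m. g' x = (x (\<sigma> 1) - x (\<sigma> 0)) ^ e' * g (normalise m \<sigma> x)" by blast
  then show ?case
    by (intro bexI[of _ "\<lambda>x. f' x * g' x"] exI[of _ "e + e'"])
      (auto simp: power_add algebra_simps intro!: polyfunsI)
qed

lemma polyfuns_zero_finite_union:
  assumes "finite I" "\<And>i. i \<in> I \<Longrightarrow> F i \<subseteq> polyfuns m" "S \<subseteq> affine_space m"
  shows "\<exists>F'\<subseteq>polyfuns m. (\<Union>i\<in>I. {x \<in> S. \<forall>f\<in>F i. f x = (0::'k::idom)}) = {x \<in> S. \<forall>f\<in>F'. f x = 0}"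
proof -
  have "closedin (subtopology (zariski m) S) (\<Union>i\<in>I. {x \<in> S. \<forall>f\<in>F i. f x = 0})"
    using assms(1,2) closedin_subtopology_zariski[OF assms(3)] by (intro closedin_Union) auto
  then show ?thesis unfolding closedin_subtopology_zariski[OF assms(3)] .
qed

text \<open>
  The tuples equivalent to a point of a subset of the slice are those that one of the finitely many maps
  \<open>normalise m \<sigma>\<close> sends into the subset. A finite union of closed sets is closed, so the slice maps to the
  classes by a closed map.
\<close>

lemma closed_slice_image:
  fixes F :: "((nat \<Rightarrow> 'k::{alg_closed_field, field_char_0}) \<Rightarrow> 'k) set"
  assumes F: "F \<subseteq> polyfuns m"
  shows "closedin (n_classes_top m) (tuple_class m ` {y \<in> slice m. \<forall>f\<in>F. f y = 0})"
  unfolding closedin_n_classes_top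
proof (intro conjI)
  define Z where "Z = {y \<in> slice m. \<forall>f\<in>F. f y = 0}"
  show "tuple_class m ` {y \<in> slice m. \<forall>f\<in>F. f y = 0} \<subseteq> n_classes m"
    using distinct_tuple_n_set by (auto simp: slice_def tuple_class_def n_classes_def)
  define G where "G f \<sigma> = (SOME g. g \<in> polyfuns m \<and>
    (\<exists>e. \<forall>x\<in>distinct_tuples m. g x = (x (\<sigma> 1) - x (\<sigma> 0)) ^ e * f (normalise m \<sigma> x)))" for f :: "(nat \<Rightarrow> 'k) \<Rightarrow> 'k" and \<sigma>
  have G: "G f \<sigma> \<in> polyfuns m"
    "\<exists>e. \<forall>x\<in>distinct_tuples m. G f \<sigma> x = (x (\<sigma> 1) - x (\<sigma> 0)) ^ e * f (normalise m \<sigma> x)"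
    if "f \<in> F" "\<sigma> permutes {..<m}" for f \<sigma>
  proof -
    have "\<exists>g. g \<in> polyfuns m \<and>
      (\<exists>e. \<forall>x\<in>distinct_tuples m. g x = (x (\<sigma> 1) - x (\<sigma> 0)) ^ e * f (normalise m \<sigma> x))"
      using polyfun_normalise[of f \<sigma>] F that by blast
    from someI_ex[OF this] show "G f \<sigma> \<in> polyfuns m"
      "\<exists>e. \<forall>x\<in>distinct_tuples m. G f \<sigma> x = (x (\<sigma> 1) - x (\<sigma> 0)) ^ e * f (normalise m \<sigma> x)"
      unfolding G_def by blast+
  qed
  have G0: "G f \<sigma> x = 0 \<longleftrightarrow> f (normalise m \<sigma> x) = 0"
    if "f \<in> F" and \<sigma>: "\<sigma> permutes {..<m}" and x: "x \<in> distinct_tuples m" for f \<sigma> x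
  proof -
    have "\<sigma> 1 < m" "\<sigma> 0 < m" using permutes_in_image[OF \<sigma>] m by simp_all
    then have "x (\<sigma> 1) = x (\<sigma> 0) \<longleftrightarrow> \<sigma> 1 = \<sigma> 0"
      using x by (intro inj_on_eq_iff[of x "{..<m}"]) (auto simp: distinct_tuples_def)
    moreover have "\<sigma> 1 \<noteq> \<sigma> 0" using permutes_inj[OF \<sigma>] by (auto dest: injD)
    ultimately have "x (\<sigma> 1) - x (\<sigma> 0) \<noteq> 0" by simp
    then show ?thesis using G(2)[OF that(1,2)] x by auto
  qed
  have "{x \<in> distinct_tuples m. tuple_class m x \<in> tuple_class m ` Z} =
    (\<Union>\<sigma>\<in>{\<sigma>. \<sigma> permutes {..<m}}. {x \<in> distinct_tuples m. \<forall>f\<in>(\<lambda>f. G f \<sigma>) ` F. f x = 0})" (is "?L = ?R")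
  proof (intro equalityI subsetI)
    fix x assume "x \<in> ?L"
    then obtain y where x: "x \<in> distinct_tuples m" and y: "y \<in> Z" "tuple_class m y = tuple_class m x" by auto
    then obtain \<sigma> where \<sigma>: "\<sigma> permutes {..<m}" "y = normalise m \<sigma> x"
      using slice_class_eq_normalise[OF x, of y] by (auto simp: Z_def)
    then have "\<forall>f\<in>F. G f \<sigma> x = 0" using G0 x y by (auto simp: Z_def)
    then show "x \<in> ?R" using \<sigma> x by blast
  next
    fix x assume "x \<in> ?R"
    then obtain \<sigma> where \<sigma>: "\<sigma> permutes {..<m}" and x: "x \<in> distinct_tuples m" "\<forall>f\<in>F. G f \<sigma> x = 0" by auto
    have "normalise m \<sigma> x \<in> Z" using normalise_class(1)[OF x(1) \<sigma>] G0[OF _ \<sigma> x(1)] x(2) by (auto simp: Z_def)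
    then show "x \<in> ?L" using normalise_class(2)[OF x(1) \<sigma>] x(1) by (auto simp: image_iff intro!: bexI[of _ "normalise m \<sigma> x"])
  qed
  moreover have "\<exists>F'\<subseteq>polyfuns m. ?R = {x \<in> distinct_tuples m. \<forall>f\<in>F'. f x = 0}"
    using G(1) by (intro polyfuns_zero_finite_union finite_permutations distinct_tuples_subset) auto
  ultimately show "\<exists>F'\<subseteq>polyfuns m. {x \<in> distinct_tuples m. tuple_class m x \<in> tuple_class m ` {y \<in> slice m. \<forall>f\<in>F. f y = 0}} =
      {x \<in> distinct_tuples m. \<forall>f\<in>F'. f x = 0}"
    by (simp only: Z_def)
qed

lemma slice_class_surj:
  fixes \<Xi> :: "'k::field set set"
  assumes "\<Xi> \<in> n_classes m"
  shows "\<exists>y\<in>slice m. tuple_class m y = \<Xi>"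
proof -
  obtain A where A: "A \<in> n_sets m" "\<Xi> = poly_class A" using assms by (auto simp: n_classes_def)
  obtain x where x: "x \<in> distinct_tuples m" "x ` {..<m} = A" using n_set_distinct_tuple[OF A(1)] .
  show ?thesis using normalise_class[OF x(1) permutes_id] x A(2)
    by (intro bexI[of _ "normalise m id x"]) (auto simp: tuple_class_def)
qed

text \<open>
  The slice maps onto the classes by a continuous closed map, and the points over a class are among the
  finitely many \<open>normalise m \<sigma> x\<close> for one representative \<open>x\<close>.
\<close>

lemma slice_chain_lift:
  fixes S :: "'k::{alg_closed_field, field_char_0} set set set"
  assumes S: "S \<subseteq> n_classes m"
    and C: "\<And>i. i \<le> k \<Longrightarrow> irreducible_closed (subtopology (n_classes_top m) S) (C i)"
      "\<And>i. i < k \<Longrightarrow> C i \<subset> C (Suc i)"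
  defines "Y \<equiv> {y \<in> slice m. tuple_class m y \<in> S}"
  shows "\<exists>K. (\<forall>i\<le>k. irreducible_closed (subtopology (zariski m) Y) (K i)) \<and> (\<forall>i<k. K i \<subset> K (Suc i))"
proof -
  have YA: "Y \<subseteq> affine_space m" by (auto simp: Y_def slice_def distinct_tuples_def)
  have Yd: "Y \<subseteq> distinct_tuples m" by (auto simp: Y_def slice_def)
  have topY: "topspace (subtopology (zariski m) Y) = Y" using YA by auto
  have topS: "topspace (subtopology (n_classes_top m) S) = S" using S by auto
  have "continuous_map (subtopology (zariski m) (distinct_tuples m)) (n_classes_top m) (tuple_class m)"
    using quotient_imp_continuous_map[OF quotient_map_n_classes_top[of m]] by (simp add: tuple_class_def[abs_def])
  then have "continuous_map (subtopology (zariski m) Y) (n_classes_top m) (tuple_class m)"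
    using Yd by (metis continuous_map_from_subtopology inf.absorb2 subtopology_subtopology)
  then have cont: "continuous_map (subtopology (zariski m) Y) (subtopology (n_classes_top m) S) (tuple_class m)"
    using topY by (auto simp: continuous_map_in_subtopology Y_def)
  have closed: "closed_map (subtopology (zariski m) Y) (subtopology (n_classes_top m) S) (tuple_class m)"
    unfolding closed_map_def
  proof (intro allI impI)
    fix Z assume "closedin (subtopology (zariski m) Y) Z"
    then obtain F where F: "F \<subseteq> polyfuns m" "Z = {y \<in> Y. \<forall>f\<in>F. f y = 0}"
      using closedin_subtopology_zariski[OF YA] by blast
    have "tuple_class m ` Z = tuple_class m ` {y \<in> slice m. \<forall>f\<in>F. f y = 0} \<inter> S"
      by (auto simp: F(2) Y_def)
    then show "closedin (subtopology (n_classes_top m) S) (tuple_class m ` Z)"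
      unfolding closedin_subtopology using closed_slice_image[OF F(1)]
      by (intro exI[of _ "tuple_class m ` {y \<in> slice m. \<forall>f\<in>F. f y = 0}"] conjI)
  qed
  have fin: "finite {y \<in> topspace (subtopology (zariski m) Y). tuple_class m y = \<Xi>}" for \<Xi>
  proof (cases "\<exists>x\<in>Y. tuple_class m x = \<Xi>")
    case True
    then obtain x where x: "x \<in> Y" "tuple_class m x = \<Xi>" by blast
    have "{y \<in> Y. tuple_class m y = \<Xi>} \<subseteq> (\<lambda>\<sigma>. normalise m \<sigma> x) ` {\<sigma>. \<sigma> permutes {..<m}}"
      using slice_class_eq_normalise[of x] x Yd by (auto simp: Y_def image_iff)
    moreover have "finite {\<sigma>. \<sigma> permutes {..<m}}" by (rule finite_permutations) simp
    ultimately show ?thesis unfolding topY by (meson finite_imageI finite_subset)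
  next
    case False
    then have "{y \<in> Y. tuple_class m y = \<Xi>} = {}" by blast
    then show ?thesis unfolding topY by (simp only: finite.emptyI)
  qed
  have surj: "C k \<subseteq> tuple_class m ` Y"
  proof
    fix \<Xi> assume "\<Xi> \<in> C k"
    then have "\<Xi> \<in> S" using C(1)[of k] closedin_subset[of "subtopology (n_classes_top m) S" "C k"] topS
      by (auto simp: irreducible_closed_def)
    then obtain y where "y \<in> slice m" "tuple_class m y = \<Xi>" using slice_class_surj S by blast
    then show "\<Xi> \<in> tuple_class m ` Y" using \<open>\<Xi> \<in> S\<close> by (auto simp: Y_def)
  qed
  have "closedin (subtopology (zariski m) Y) Y" using closedin_topspace[of "subtopology (zariski m) Y"] topY by simp
  from irreducible_chain_lift[OF cont closed fin C this surj] show ?thesis by blast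
qed

end


section \<open>Tangent vectors of a stratum\<close>

lemma polys_linearly_dependent:
  fixes v :: "'i \<Rightarrow> 'k::field poly"
  assumes "finite I" "card I > p" "\<And>l i. l \<in> I \<Longrightarrow> i \<ge> p \<Longrightarrow> coeff (v l) i = 0"
  shows "\<exists>\<alpha>. (\<exists>l\<in>I. \<alpha> l \<noteq> 0) \<and> (\<Sum>l\<in>I. smult (\<alpha> l) (v l)) = 0"
  using assms
proof (induction p arbitrary: I v)
  case 0
  then obtain l where "l \<in> I" by fastforce
  moreover have "v l = 0" if "l \<in> I" for l using 0 that by (intro poly_eqI) simp
  ultimately show ?case by (intro exI[of _ "\<lambda>_. 1"]) auto
next
  case (Suc p)
  show ?case
  proof (cases "\<exists>l\<in>I. coeff (v l) p \<noteq> 0")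
    case False
    have "coeff (v l) i = 0" if "l \<in> I" "i \<ge> p" for l i
      using Suc.prems(3)[of l i] False that by (cases "i = p") auto
    then show ?thesis using Suc.IH[of I v] Suc.prems by auto
  next
    case True
    then obtain l0 where l0: "l0 \<in> I" "coeff (v l0) p \<noteq> 0" by blast
    define c where "c = coeff (v l0) p"
    define w where "w l = v l - smult (coeff (v l) p / c) (v l0)" for l
    have "coeff (w l) i = 0" if "l \<in> I - {l0}" "i \<ge> p" for l i
    proof (cases "i = p")
      case True then show ?thesis using l0 by (simp add: w_def c_def)
    next
      case False
      then show ?thesis using Suc.prems(3)[of l i] Suc.prems(3)[of l0 i] l0 that by (simp add: w_def)
    qed
    moreover have "card (I - {l0}) > p" using Suc.prems l0 by simp
    ultimately obtain \<alpha> where \<alpha>: "\<exists>l\<in>I - {l0}. \<alpha> l \<noteq> 0" "(\<Sum>l\<in>I - {l0}. smult (\<alpha> l) (w l)) = 0"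
      using Suc.IH[of "I - {l0}" w] Suc.prems(1) by blast
    define \<beta> where "\<beta> l = (if l = l0 then - (\<Sum>l\<in>I - {l0}. \<alpha> l * (coeff (v l) p / c)) else \<alpha> l)" for l
    have "(\<Sum>l\<in>I. smult (\<beta> l) (v l)) = smult (\<beta> l0) (v l0) + (\<Sum>l\<in>I - {l0}. smult (\<alpha> l) (v l))"
      using l0 Suc.prems(1) by (subst sum.remove[of I l0]) (auto simp: \<beta>_def intro!: sum.cong)
    also have "\<dots> = (\<Sum>l\<in>I - {l0}. smult (\<alpha> l) (w l))"
      by (simp add: w_def \<beta>_def smult_diff_right sum_subtractf smult_sum)
    finally show ?thesis using \<alpha> by (intro exI[of _ \<beta>]) (auto simp: \<beta>_def)
  qed
qed

lemma prod_linear_powers_dvd: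
  fixes z :: "'i \<Rightarrow> 'k::field"
  assumes "finite I" "inj_on z I" "\<And>i. i \<in> I \<Longrightarrow> [:- z i, 1:] ^ \<nu> i dvd p"
  shows "(\<Prod>i\<in>I. [:- z i, 1:] ^ \<nu> i) dvd p"
proof (cases "p = 0")
  case False
  show ?thesis
    using assms
  proof (induction I rule: finite_induct)
    case (insert i I)
    define W where "W = (\<Prod>i\<in>I. [:- z i, 1:] ^ \<nu> i)"
    have "W dvd p" using insert by (auto simp: W_def)
    then obtain q where q: "p = W * q" by (elim dvdE)
    have "poly W (z i) \<noteq> 0"
      using insert.hyps insert.prems(1) by (auto simp: W_def poly_prod inj_on_def)
    then have "order (z i) p = order (z i) q" using False q by (simp add: order_mult order_0I)
    moreover have "\<nu> i \<le> order (z i) p" using insert.prems(2)[of i] False by (simp add: order_divides)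
    ultimately have "[:- z i, 1:] ^ \<nu> i dvd q" by (simp add: order_divides)
    then have "[:- z i, 1:] ^ \<nu> i * W dvd p" unfolding q by (subst mult.commute) (intro mult_dvd_mono dvd_refl)
    then show ?case using insert.hyps by (simp add: W_def)
  qed simp
qed simp

lemma smult_sum_right: "smult c (\<Sum>i\<in>I. f i) = (\<Sum>i\<in>I. smult c (f i))"
  by (induction I rule: infinite_finite_induct) (auto simp: smult_add_right)

lemma prod_power_split:
  fixes f :: "'i \<Rightarrow> 'a::comm_monoid_mult"
  assumes "\<And>i. i \<in> I \<Longrightarrow> \<mu> i \<ge> (1::nat)"
  shows "(\<Prod>i\<in>I. f i ^ \<mu> i) = (\<Prod>i\<in>I. f i ^ (\<mu> i - 1)) * (\<Prod>i\<in>I. f i)"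
  unfolding prod.distrib[symmetric]
proof (rule prod.cong)
  fix j assume "j \<in> I"
  then have "\<mu> j = Suc (\<mu> j - 1)" using assms[of j] by simp
  then show "f j ^ \<mu> j = f j ^ (\<mu> j - 1) * f j" by (metis power_Suc2)
qed simp

text \<open>
  For weights \<open>c\<close>, \<open>lagrange_sum y c I\<close> is the sum of the \<open>c\<^sub>i / (X - y\<^sub>i)\<close> multiplied by the
  common denominator.
\<close>

definition lagrange_sum :: "(nat \<Rightarrow> 'k::field) \<Rightarrow> (nat \<Rightarrow> 'k) \<Rightarrow> nat set \<Rightarrow> 'k poly"
  where "lagrange_sum y c I = (\<Sum>i\<in>I. smult (c i) (\<Prod>j\<in>I - {i}. [:- y j, 1:]))"

lemma lagrange_sum_insert:
  assumes "finite I" "i \<notin> I"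
  shows "lagrange_sum y c (insert i I) = smult (c i) (\<Prod>j\<in>I. [:- y j, 1:]) + [:- y i, 1:] * lagrange_sum y c I"
proof -
  have "(\<Sum>j\<in>I. smult (c j) (\<Prod>l\<in>insert i I - {j}. [:- y l, 1:])) = (\<Sum>j\<in>I. [:- y i, 1:] * smult (c j) (\<Prod>l\<in>I - {j}. [:- y l, 1:]))"
  proof (rule sum.cong)
    fix j assume "j \<in> I"
    then have "insert i I - {j} = insert i (I - {j})" using assms by auto
    then show "smult (c j) (\<Prod>l\<in>insert i I - {j}. [:- y l, 1:]) = [:- y i, 1:] * smult (c j) (\<Prod>l\<in>I - {j}. [:- y l, 1:])"
      using assms by (simp only: prod.insert finite_Diff Diff_iff simp_thms mult_smult_right)
  qed simp
  moreover have "insert i I - {i} = I" using assms by auto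
  ultimately show ?thesis
    unfolding lagrange_sum_def sum.insert[OF assms] by (simp only: sum_distrib_left)
qed

lemma poly_lagrange_sum:
  assumes "finite I" "i \<in> I"
  shows "poly (lagrange_sum y c I) (y i) = c i * (\<Prod>j\<in>I - {i}. y i - y j)"
proof -
  have "poly (lagrange_sum y c I) (y i) = (\<Sum>l\<in>I. c l * (\<Prod>j\<in>I - {l}. y i - y j))"
    by (simp add: lagrange_sum_def poly_sum poly_prod)
  also have "\<dots> = (\<Sum>l\<in>{i}. c l * (\<Prod>j\<in>I - {l}. y i - y j))"
    using assms by (intro sum.mono_neutral_right) auto
  finally show ?thesis by simp
qed

lemma lagrange_sum_linear:
  "lagrange_sum y (\<lambda>i. \<Sum>l\<in>L. \<alpha> l * c l i) I = (\<Sum>l\<in>L. smult (\<alpha> l) (lagrange_sum y (c l) I))"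
  unfolding lagrange_sum_def smult_sum_right smult_sum smult_smult by (rule sum.swap)

text \<open>
  The logarithmic derivative of the product is \<open>\<Sum>\<^sub>i \<mu>\<^sub>i / (X - y\<^sub>i)\<close>.
\<close>

lemma lagrange_sum_pderiv:
  fixes y :: "nat \<Rightarrow> 'k::field_char_0"
  assumes "finite I" "\<And>i. i \<in> I \<Longrightarrow> \<mu> i \<ge> 1"
  shows "pderiv (\<Prod>i\<in>I. [:- y i, 1:] ^ \<mu> i) =
    (\<Prod>i\<in>I. [:- y i, 1:] ^ (\<mu> i - 1)) * lagrange_sum y (\<lambda>i. of_nat (\<mu> i)) I"
  using assms
proof (induction I rule: finite_induct)
  case empty
  then show ?case by (simp add: lagrange_sum_def)
next
  case (insert i I)
  define L where "L = [:- y i, 1:]"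
  define W where "W = (\<Prod>i\<in>I. [:- y i, 1:] ^ (\<mu> i - 1))"
  define R where "R = (\<Prod>i\<in>I. [:- y i, 1:])"
  define K where "K = lagrange_sum y (\<lambda>i. of_nat (\<mu> i)) I"
  have WR: "(\<Prod>i\<in>I. [:- y i, 1:] ^ \<mu> i) = W * R"
    unfolding W_def R_def by (rule prod_power_split) (rule insert.prems, erule insertI2)
  have IH: "pderiv (\<Prod>i\<in>I. [:- y i, 1:] ^ \<mu> i) = W * K" using insert by (simp add: W_def K_def)
  obtain e where e: "\<mu> i = Suc e" using insert.prems[of i] by (cases "\<mu> i") auto
  have "pderiv (L ^ \<mu> i) = smult (of_nat (\<mu> i)) (L ^ e)"
    unfolding e pderiv_power_Suc by (simp add: L_def pderiv_pCons)
  then have "pderiv (L ^ \<mu> i * (\<Prod>i\<in>I. [:- y i, 1:] ^ \<mu> i)) = L ^ Suc e * (W * K) + W * R * smult (of_nat (\<mu> i)) (L ^ e)"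
    unfolding pderiv_mult IH by (simp only: WR e)
  also have "\<dots> = (L ^ e * W) * (smult (of_nat (\<mu> i)) R + L * K)"
    by (simp add: algebra_simps)
  finally show ?case
    unfolding prod.insert[OF insert.hyps(1,2)] lagrange_sum_insert[OF insert.hyps(1,2)]
    by (simp only: L_def W_def R_def K_def e diff_Suc_1)
qed

text \<open>
  \<open>V\<close> arises from the polynomial-valued function \<open>F\<close> by applying the point derivation \<open>D\<close> to each
  coefficient.
\<close>

definition coeffwise ::
    "('p \<Rightarrow> 'k::comm_ring_1) set \<Rightarrow> (('p \<Rightarrow> 'k) \<Rightarrow> 'k) \<Rightarrow> ('p \<Rightarrow> 'k poly) \<Rightarrow> 'k poly \<Rightarrow> bool"
  where "coeffwise R D F V \<longleftrightarrow> (\<forall>i. (\<lambda>x. coeff (F x) i) \<in> R \<and> coeff V i = D (\<lambda>x. coeff (F x) i))"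

lemma point_derivation_fun_sum:
  assumes R: "fun_algebra R" and D: "point_derivation R T z D" and "\<And>i. i \<in> I \<Longrightarrow> f i \<in> R"
  shows "D (\<lambda>x. \<Sum>i\<in>I. f i x) = (\<Sum>i\<in>I. D (f i))"
  using assms(3)
proof (induction I rule: infinite_finite_induct)
  case (insert i I)
  have eq: "(\<lambda>x. \<Sum>i\<in>insert i I. f i x) = f i + (\<lambda>x. \<Sum>i\<in>I. f i x)"
    using insert by (simp add: fun_eq_iff)
  have "(\<lambda>x. \<Sum>i\<in>I. f i x) = sum f I" by (simp add: fun_eq_iff sum_fun_apply)
  then have "(\<lambda>x. \<Sum>i\<in>I. f i x) \<in> R" using insert.prems by (simp add: fun_algebra_sum[OF R])
  then have "D (\<lambda>x. \<Sum>i\<in>insert i I. f i x) = D (f i) + D (\<lambda>x. \<Sum>i\<in>I. f i x)"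
    unfolding eq using insert.prems by (intro point_derivationD(1)[OF D]) auto
  moreover have "D (\<lambda>x. \<Sum>i\<in>I. f i x) = (\<Sum>i\<in>I. D (f i))" by (intro insert.IH insert.prems) simp
  ultimately show ?case unfolding sum.insert[OF insert.hyps(1,2)] by (simp only:)
qed (simp_all add: point_derivationD(3)[OF D])

lemma coeffwise_mult:
  assumes R: "fun_algebra R" and D: "point_derivation R T z D"
    and F: "coeffwise R D F V" and G: "coeffwise R D G W"
  shows "coeffwise R D (\<lambda>x. F x * G x) (V * G z + F z * W)"
  unfolding coeffwise_def
proof (intro allI conjI)
  fix i
  have mem: "(\<lambda>x. coeff (F x) j) \<in> R" "(\<lambda>x. coeff (G x) j) \<in> R" for j using F G by (auto simp: coeffwise_def)
  have mem2: "(\<lambda>x. coeff (F x) j) * (\<lambda>x. coeff (G x) l) \<in> R" for j l by (intro fun_algebraD(5)[OF R] mem)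
  have eq: "(\<lambda>x. coeff (F x * G x) i) = (\<lambda>x. \<Sum>j\<le>i. ((\<lambda>x. coeff (F x) j) * (\<lambda>x. coeff (G x) (i - j))) x)"
    by (simp add: fun_eq_iff coeff_mult)
  have "(\<lambda>x. \<Sum>j\<le>i. ((\<lambda>x. coeff (F x) j) * (\<lambda>x. coeff (G x) (i - j))) x) =
      (\<Sum>j\<le>i. (\<lambda>x. coeff (F x) j) * (\<lambda>x. coeff (G x) (i - j)))"
    by (simp add: fun_eq_iff sum_fun_apply)
  then show "(\<lambda>x. coeff (F x * G x) i) \<in> R" unfolding eq using mem2 by (simp only: fun_algebra_sum[OF R])
  have "D (\<lambda>x. coeff (F x * G x) i) = (\<Sum>j\<le>i. D ((\<lambda>x. coeff (F x) j) * (\<lambda>x. coeff (G x) (i - j))))"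
    unfolding eq by (intro point_derivation_fun_sum[OF R D] mem2)
  also have "\<dots> = (\<Sum>j\<le>i. D (\<lambda>x. coeff (F x) j) * coeff (G z) (i - j) + coeff (F z) j * D (\<lambda>x. coeff (G x) (i - j)))"
    by (intro sum.cong refl point_derivationD(2)[OF D] mem)
  also have "\<dots> = coeff (V * G z + F z * W) i"
    using F G by (simp add: coeffwise_def coeff_mult sum.distrib)
  finally show "coeff (V * G z + F z * W) i = D (\<lambda>x. coeff (F x * G x) i)" by simp
qed

lemma coeffwise_const:
  assumes R: "fun_algebra R" and D: "point_derivation R T z D"
  shows "coeffwise R D (\<lambda>_. p) 0"
  by (simp add: coeffwise_def fun_algebraD(1)[OF R] point_derivationD(3)[OF D])

lemma coeffwise_linear_factor:
  fixes R :: "((nat \<Rightarrow> 'k) \<Rightarrow> 'k::comm_ring_1) set"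
  assumes R: "fun_algebra R" and D: "point_derivation R T z D" and i: "(\<lambda>x. x i) \<in> R"
  shows "coeffwise R D (\<lambda>x. [:- x i, 1:]) [:- D (\<lambda>x. x i):]"
  unfolding coeffwise_def
proof
  fix j
  have m: "(\<lambda>x::nat \<Rightarrow> 'k. - x i) = (\<lambda>_. - 1) * (\<lambda>x. x i)" by (simp add: fun_eq_iff)
  have "(\<lambda>x. - x i) \<in> R" unfolding m by (intro fun_algebraD[OF R] i)
  moreover have "D (\<lambda>x. - x i) = - D (\<lambda>x. x i)"
    unfolding m point_derivationD(2)[OF D fun_algebraD(1)[OF R] i] by (simp add: point_derivationD(3)[OF D])
  ultimately show "(\<lambda>x. coeff [:- x i, 1:] j) \<in> R \<and> coeff [:- D (\<lambda>x. x i):] j = D (\<lambda>x. coeff [:- x i, 1:] j)"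
    by (cases j rule: nat.exhaust; cases "j - 1")
      (auto simp: fun_algebraD(1)[OF R] point_derivationD(3)[OF D] coeff_pCons split: nat.splits)
qed

lemma coeffwise_power_linear_factor:
  fixes R :: "((nat \<Rightarrow> 'k) \<Rightarrow> 'k::comm_ring_1) set"
  assumes R: "fun_algebra R" and D: "point_derivation R T z D" and i: "(\<lambda>x. x i) \<in> R"
  shows "coeffwise R D (\<lambda>x. [:- x i, 1:] ^ Suc e)
    (smult (- of_nat (Suc e) * D (\<lambda>x. x i)) ([:- z i, 1:] ^ e))"
proof (induction e)
  case 0
  then show ?case using coeffwise_linear_factor[OF assms] by simp
next
  case (Suc e)
  have "coeffwise R D (\<lambda>x. [:- x i, 1:] * [:- x i, 1:] ^ Suc e)
    ([:- D (\<lambda>x. x i):] * [:- z i, 1:] ^ Suc e + [:- z i, 1:] * (smult (- of_nat (Suc e) * D (\<lambda>x. x i)) ([:- z i, 1:] ^ e)))"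
    by (rule coeffwise_mult[OF R D coeffwise_linear_factor[OF assms] Suc])
  moreover have "[:- D (\<lambda>x. x i):] * [:- z i, 1:] ^ Suc e + [:- z i, 1:] * (smult (- of_nat (Suc e) * D (\<lambda>x. x i)) ([:- z i, 1:] ^ e))
    = smult (- of_nat (Suc (Suc e)) * D (\<lambda>x. x i)) ([:- z i, 1:] ^ Suc e)"
  proof -
    have "[:- D (\<lambda>x. x i):] * q = smult (- D (\<lambda>x. x i)) q" for q by simp
    moreover have "[:- z i, 1:] * smult c ([:- z i, 1:] ^ e) = smult c ([:- z i, 1:] ^ Suc e)" for c
      by (simp only: mult_smult_right power_Suc)
    moreover have "- D (\<lambda>x. x i) + - of_nat (Suc e) * D (\<lambda>x. x i) = - of_nat (Suc (Suc e)) * D (\<lambda>x. x i)"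
      by (simp add: algebra_simps)
    ultimately show ?thesis by (simp only: smult_add_left[symmetric])
  qed
  ultimately show ?case by (simp only: power_Suc)
qed

text \<open>
  The logarithmic derivative again, now along \<open>D\<close>: the factor \<open>X - x\<^sub>i\<close> changes by \<open>- D x\<^sub>i\<close>.
\<close>

lemma coeffwise_prod_powers:
  fixes D :: "((nat \<Rightarrow> 'k::field) \<Rightarrow> 'k) \<Rightarrow> 'k"
  assumes R: "fun_algebra R" and D: "point_derivation R T z D"
    and "finite I" "\<And>i. i \<in> I \<Longrightarrow> (\<lambda>x. x i) \<in> R" "\<And>i. i \<in> I \<Longrightarrow> \<mu> i \<ge> 1"
  shows "coeffwise R D (\<lambda>x. \<Prod>i\<in>I. [:- x i, 1:] ^ \<mu> i)
    ((\<Prod>i\<in>I. [:- z i, 1:] ^ (\<mu> i - 1)) * lagrange_sum z (\<lambda>i. - of_nat (\<mu> i) * D (\<lambda>x. x i)) I)"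
  using assms(3-)
proof (induction I rule: finite_induct)
  case empty
  then show ?case using coeffwise_const[OF R D, of 1] by (simp add: lagrange_sum_def)
next
  case (insert i I)
  define L where "L = [:- z i, 1:]"
  define W where "W = (\<Prod>i\<in>I. [:- z i, 1:] ^ (\<mu> i - 1))"
  define Q where "Q = (\<Prod>i\<in>I. [:- z i, 1:])"
  define c where "c i = - of_nat (\<mu> i) * D (\<lambda>x. x i)" for i
  define K where "K = lagrange_sum z c I"
  have WR: "(\<Prod>i\<in>I. [:- z i, 1:] ^ \<mu> i) = W * Q"
    unfolding W_def Q_def by (rule prod_power_split) (rule insert.prems(2), erule insertI2)
  obtain e where e: "\<mu> i = Suc e" using insert.prems(2)[of i] by (cases "\<mu> i") auto
  have IH: "coeffwise R D (\<lambda>x. \<Prod>i\<in>I. [:- x i, 1:] ^ \<mu> i) (W * K)"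
    using insert unfolding W_def K_def c_def[abs_def] by simp
  have p: "coeffwise R D (\<lambda>x. [:- x i, 1:] ^ \<mu> i) (smult (c i) (L ^ e))"
    using coeffwise_power_linear_factor[OF R D, of i e] insert.prems(1)[of i] by (simp only: c_def e L_def insertI1)
  have "coeffwise R D (\<lambda>x. [:- x i, 1:] ^ \<mu> i * (\<Prod>i\<in>I. [:- x i, 1:] ^ \<mu> i))
    (smult (c i) (L ^ e) * (W * Q) + L ^ \<mu> i * (W * K))"
    using coeffwise_mult[OF R D p IH] by (simp only: WR L_def)
  moreover have "smult (c i) (L ^ e) * (W * Q) + L ^ \<mu> i * (W * K) = (L ^ e * W) * (smult (c i) Q + L * K)"
    unfolding e by (simp add: algebra_simps)
  ultimately show ?case
    unfolding prod.insert[OF insert.hyps(1,2)] lagrange_sum_insert[OF insert.hyps(1,2)] c_def[symmetric]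
    by (simp only: L_def W_def Q_def K_def e diff_Suc_1)
qed

text \<open>
  If \<open>P\<close> takes the value \<open>J i\<close> at \<open>y\<^sub>i\<close> with multiplicity \<open>\<mu> i\<close>, and if these are all the points where it takes a
  value in \<open>B\<close>, then for \<open>b \<in> B\<close> this is \<open>P - b\<close> divided by the leading coefficient of \<open>P\<close>.
\<close>

definition fibre_poly :: "nat \<Rightarrow> (nat \<Rightarrow> 'k) \<Rightarrow> (nat \<Rightarrow> nat) \<Rightarrow> 'k \<Rightarrow> (nat \<Rightarrow> 'k::field) \<Rightarrow> 'k poly"
  where "fibre_poly m J \<mu> b y = (\<Prod>i | i < m \<and> J i = b. [:- y i, 1:] ^ \<mu> i)"

lemma degree_fibre_poly: "degree (fibre_poly m J \<mu> b y) = (\<Sum>i | i < m \<and> J i = b. \<mu> i)"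
proof -
  have "degree (fibre_poly m J \<mu> b y) = (\<Sum>i | i < m \<and> J i = b. degree ([:- y i, 1:] ^ \<mu> i))"
    unfolding fibre_poly_def by (rule degree_prod_sum_eq) auto
  then show ?thesis by (simp add: degree_power_eq)
qed

lemma fibre_poly_coeff_polyfun:
  fixes J :: "nat \<Rightarrow> 'k::field"
  assumes "\<And>i. i < m \<Longrightarrow> \<mu> i \<ge> 1"
  shows "(\<lambda>y. coeff (fibre_poly m J \<mu> b y) i) \<in> polyfuns m"
proof -
  \<comment> \<open>For the zero derivation, \<open>coeffwise\<close> says only that the coefficients are polynomial functions.\<close>
  have D: "point_derivation (polyfuns m) {} undefined (\<lambda>_. 0 :: 'k)" by (simp add: point_derivation_def)
  have "coeffwise (polyfuns m) (\<lambda>_. 0 :: 'k) (\<lambda>y. \<Prod>i | i < m \<and> J i = b. [:- y i, 1:] ^ \<mu> i)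
    ((\<Prod>i | i < m \<and> J i = b. [:- undefined i, 1:] ^ (\<mu> i - 1)) *
      lagrange_sum undefined (\<lambda>i. - of_nat (\<mu> i) * 0) {i. i < m \<and> J i = b})"
    by (rule coeffwise_prod_powers[OF fun_algebra_polyfuns D]) (use assms in \<open>auto intro: polyfuns.coord\<close>)
  then show ?thesis by (simp add: coeffwise_def fibre_poly_def)
qed

text \<open>
  The fibre polynomials \<open>F\<^sub>b\<close> satisfy \<open>F\<^sub>b - F\<^bsub>b'\<^esub> = u (b' - b)\<close> on \<open>T\<close>, with \<open>u\<close> the inverse of the leading coefficient of
  \<open>P = F\<^sub>b / u + b\<close>. For a point derivation \<open>D\<close> this makes \<open>V = D F\<^sub>b - (D u / u) F\<^sub>b\<close>, which is \<open>u\<close> times the first order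
  change of \<open>P\<close>, independent of \<open>b\<close>. Every \<open>D F\<^sub>b\<close> is divisible by the product of the \<open>(X - z\<^sub>i)\<^bsup>\<mu>\<^sub>i - 1\<^esup>\<close> over the fibre,
  so \<open>V\<close> is divisible by the product \<open>W\<close> of these powers over all \<open>i < m\<close>, which has degree \<open>r = card B * d - m\<close>. So
  are the derivative of \<open>F\<^sub>b\<close>, which does not depend on \<open>b\<close> either, and its product with \<open>X\<close>. All quotients by \<open>W\<close> have degree at most \<open>d - r\<close>, so \<open>k + 2 > d - r + 1\<close> of them would be
  linearly dependent. A relation says that a combination of the \<open>D\<^sub>l\<close> moves the \<open>z\<^sub>i\<close> as an affine vector field
  does; this field vanishes at \<open>z\<^sub>0 = 0\<close> and \<open>z\<^sub>1 = 1\<close>, hence everywhere, and the combination is trivial.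
\<close>

theorem stratum_tangent_bound:
  fixes B :: "'k::field_char_0 set" and T :: "(nat \<Rightarrow> 'k) set"
  assumes m: "m \<ge> 2" and B: "finite B" "card B \<ge> 2"
    and J: "\<And>i. i < m \<Longrightarrow> J i \<in> B" and \<mu>: "\<And>i. i < m \<Longrightarrow> \<mu> i \<ge> 1"
    and deg: "\<And>b. b \<in> B \<Longrightarrow> (\<Sum>i | i < m \<and> J i = b. \<mu> i) = d" and d: "d > 0"
    and T: "\<And>y. y \<in> T \<Longrightarrow> inj_on y {..<m}" "\<And>y. y \<in> T \<Longrightarrow> y 0 = 0" "\<And>y. y \<in> T \<Longrightarrow> y 1 = 1"
    and stratum: "\<And>y. y \<in> T \<Longrightarrow> \<exists>u. \<forall>b\<in>B. \<forall>b'\<in>B. fibre_poly m J \<mu> b y - fibre_poly m J \<mu> b' y = [:u * (b' - b):]"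
    and z: "z \<in> T" and D: "\<And>l. l < k \<Longrightarrow> point_derivation (polyfuns m) T z (D l)"
    and ind: "\<And>\<alpha>. (\<And>h. h \<in> set (coords m) \<Longrightarrow> (\<Sum>l<k. \<alpha> l * D l h) = 0) \<Longrightarrow> (\<And>l. l < k \<Longrightarrow> \<alpha> l = 0)"
  shows "k + 1 + card B * d \<le> m + d" "m \<le> card B * d"
proof -
  define R :: "((nat \<Rightarrow> 'k) \<Rightarrow> 'k) set" where "R = polyfuns m"
  have R: "fun_algebra R" unfolding R_def by (rule fun_algebra_polyfuns)
  have xR: "(\<lambda>x. x i) \<in> R" if "i < m" for i unfolding R_def by (rule polyfuns.coord[OF that])
  have D': "point_derivation R T z (D l)" if "l < k" for l using D[OF that] by (simp add: R_def)
  define I where "I b = {i. i < m \<and> J i = b}" for b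
  have I: "finite (I b)" "I b \<subseteq> {..<m}" for b by (auto simp: I_def)
  have degI: "(\<Sum>i\<in>I b. \<mu> i) = d" if "b \<in> B" for b using deg[OF that] by (simp add: I_def)
  have \<mu>I: "\<mu> i \<ge> 1" "i < m" if "i \<in> I b" for i b using \<mu> that by (auto simp: I_def)
  define F where "F b y = (\<Prod>i\<in>I b. [:- y i, 1:] ^ \<mu> i)" for b and y :: "nat \<Rightarrow> 'k"
  have F: "fibre_poly m J \<mu> b y = F b y" for b y by (simp add: fibre_poly_def F_def I_def)
  have degF: "degree (F b y) = d" if "b \<in> B" for b y
    using degree_fibre_poly[of m J \<mu> b y] deg[OF that] by (simp add: F)
  define W where "W b = (\<Prod>i\<in>I b. [:- z i, 1:] ^ (\<mu> i - 1))" for b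
  define Q where "Q b = (\<Prod>i\<in>I b. [:- z i, 1:])" for b
  define K where "K b c = lagrange_sum z c (I b)" for b c
  have FW: "F b z = W b * Q b" for b
    unfolding F_def W_def Q_def by (rule prod_power_split) (rule \<mu>I(1))
  have W0: "W b \<noteq> 0" for b using I by (simp add: W_def)
  obtain b0 b1 where b: "b0 \<in> B" "b1 \<in> B" "b0 \<noteq> b1"
  proof -
    obtain b0 where "b0 \<in> B" using B by fastforce
    moreover have "B \<noteq> {b0}" using B(2) by auto
    ultimately show thesis using that by blast
  qed
  \<comment> \<open>The factor \<open>u\<close> as a polynomial function of \<open>y\<close>, so that it can be differentiated.\<close>
  define u where "u y = (coeff (F b0 y) 0 - coeff (F b1 y) 0) * (1 / (b1 - b0))" for y
  have Fu: "F b y - F b' y = [:u y * (b' - b):]" if "y \<in> T" "b \<in> B" "b' \<in> B" for y b b'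
  proof -
    obtain v where v: "\<forall>b\<in>B. \<forall>b'\<in>B. F b y - F b' y = [:v * (b' - b):]" using stratum[OF \<open>y \<in> T\<close>] by (auto simp: F)
    have "coeff (F b0 y - F b1 y) 0 = v * (b1 - b0)" using v b by simp
    then have "u y = v" using b by (simp add: u_def)
    then show ?thesis using v that by simp
  qed
  have u0: "u z \<noteq> 0"
  proof
    assume "u z = 0"
    then have eq: "F b0 z = F b1 z" using Fu[OF z b(1,2)] by simp
    have "I b0 \<noteq> {}" using degI[OF b(1)] d by auto
    then obtain i where i: "i \<in> I b0" by blast
    then have "poly (F b0 z) (z i) = 0" using I(1)[of b0] \<mu>I(1)[OF i] by (auto simp: F_def poly_prod)
    moreover have "poly (F b1 z) (z i) \<noteq> 0"
    proof -
      have "z i \<noteq> z j" if "j \<in> I b1" for j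
        using that i b(3) T(1)[OF z] by (auto simp: I_def inj_on_def)
      then show ?thesis using I(1)[of b1] by (auto simp: F_def poly_prod)
    qed
    ultimately show False using eq by simp
  qed
  define \<xi> where "\<xi> l i = D l (\<lambda>x. x i)" for l i
  define V0 where "V0 l b = W b * K b (\<lambda>i. - of_nat (\<mu> i) * \<xi> l i)" for l b
  have cw: "coeffwise R (D l) (F b) (V0 l b)" if "l < k" for l b
    unfolding F_def[abs_def] V0_def W_def K_def \<xi>_def
    by (rule coeffwise_prod_powers[OF R D'[OF that] I(1)]) (use xR \<mu>I in auto)
  have FR: "(\<lambda>y. coeff (F b y) i) \<in> R" for b i
    unfolding F[symmetric] R_def by (rule fibre_poly_coeff_polyfun[OF \<mu>])
  have uR: "u \<in> R"
    unfolding u_def[abs_def] R_def by (intro polyfunsI polyfuns.const FR[unfolded R_def])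
  define V where "V l b = V0 l b - smult (D l u / u z) (F b z)" for l b
  have Vconst: "V l b = V l b0" if l: "l < k" and bB: "b \<in> B" for l b
  proof -
    have "V0 l b - V0 l b0 = [:D l u * (b0 - b):]"
    proof (rule poly_eqI)
      fix i
      \<comment> \<open>The relation between \<open>F b\<close> and \<open>F b0\<close> in degree \<open>i\<close>, as a function vanishing on \<open>T\<close>.\<close>
      define h where "h = (\<lambda>y. coeff (F b y) i) + (\<lambda>y. - coeff (F b0 y) i) + (\<lambda>y. u y * (if i = 0 then b - b0 else 0))"
      have mem: "(\<lambda>y. - coeff (F b0 y) i) \<in> R" "(\<lambda>y. u y * (if i = 0 then b - b0 else 0)) \<in> R"
        using FR uR unfolding R_def by (intro polyfunsI polyfuns.const; simp)+
      have hR: "h \<in> R" unfolding h_def by (intro fun_algebraD(4)[OF R] FR mem)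
      have "h y = 0" if "y \<in> T" for y
      proof -
        have "coeff (F b y - F b0 y) i = coeff [:u y * (b0 - b):] i" using Fu[OF that bB b(1)] by simp
        then show ?thesis by (cases i) (auto simp: h_def algebra_simps)
      qed
      then have "D l h = 0" using point_derivationD(4)[OF D'[OF l] hR] by blast
      moreover have "D l h = D l (\<lambda>y. coeff (F b y) i) + D l (\<lambda>y. - coeff (F b0 y) i) + D l (\<lambda>y. u y * (if i = 0 then b - b0 else 0))"
        unfolding h_def using FR mem point_derivationD(1)[OF D'[OF l]] fun_algebraD(4)[OF R] by metis
      moreover have "D l (\<lambda>y. - coeff (F b0 y) i) = - D l (\<lambda>y. coeff (F b0 y) i)"
      proof -
        have "(\<lambda>y. - coeff (F b0 y) i) = (\<lambda>_. - 1) * (\<lambda>y. coeff (F b0 y) i)" by (simp add: fun_eq_iff)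
        then show ?thesis
          using point_derivationD(2)[OF D'[OF l] fun_algebraD(1)[OF R, of "- 1"] FR[of b0 i]]
          by (simp only: point_derivationD(3)[OF D'[OF l]]) simp
      qed
      moreover have "D l (\<lambda>y. u y * (if i = 0 then b - b0 else 0)) = D l u * (if i = 0 then b - b0 else 0)"
      proof -
        define e where "e = (if i = 0 then b - b0 else 0)"
        have "(\<lambda>y. u y * e) = u * (\<lambda>_. e)" by (simp add: fun_eq_iff)
        then show ?thesis
          using point_derivationD(2)[OF D'[OF l] uR fun_algebraD(1)[OF R, of e]]
          by (simp only: point_derivationD(3)[OF D'[OF l]] e_def[symmetric]) simp
      qed
      ultimately have "D l (\<lambda>y. coeff (F b y) i) - D l (\<lambda>y. coeff (F b0 y) i) = - (D l u * (if i = 0 then b - b0 else 0))"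
        by (simp add: eq_neg_iff_add_eq_0)
      then show "coeff (V0 l b - V0 l b0) i = coeff [:D l u * (b0 - b):] i"
        using cw[OF l, of b] cw[OF l, of b0] by (cases i) (auto simp: coeffwise_def algebra_simps)
    qed
    moreover have "smult (D l u / u z) (F b z) - smult (D l u / u z) (F b0 z) = [:D l u * (b0 - b):]"
      unfolding smult_diff_right[symmetric] Fu[OF z bB b(1)] using u0 by simp
    moreover have "a - c = b - d" if "a - b = e" "c - d = e" for a b c d e :: "'k poly"
      using that by (auto simp: algebra_simps)
    ultimately show ?thesis unfolding V_def by blast
  qed
  have pd: "pderiv (F b z) = W b * K b (\<lambda>i. of_nat (\<mu> i))" for b
    unfolding F_def W_def K_def by (rule lagrange_sum_pderiv[OF I(1)]) (use \<mu>I in auto)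
  have pdconst: "pderiv (F b z) = pderiv (F b0 z)" if "b \<in> B" for b
  proof -
    have "F b z = F b0 z + [:u z * (b0 - b):]" using Fu[OF z that b(1)] by (simp add: algebra_simps)
    then show ?thesis by (simp add: pderiv_add pderiv_pCons)
  qed
  define v where "v l = (if l < k then V l b0 else if l = k then pderiv (F b0 z) else [:0, 1:] * pderiv (F b0 z))" for l
  define WW where "WW = (\<Prod>i<m. [:- z i, 1:] ^ (\<mu> i - 1))"
  have dvdb: "W b dvd v l" if "b \<in> B" for b l
  proof -
    have "W b dvd V l b" by (simp add: V_def V0_def FW smult_dvd_iff dvd_diff dvd_smult)
    moreover have "W b dvd pderiv (F b0 z)" using pd[of b] pdconst[OF that] by (metis dvd_triv_left)
    moreover from this have "W b dvd [:0, 1:] * pderiv (F b0 z)" by (intro dvd_mult)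
    ultimately show ?thesis
    proof (cases "l < k")
      case True
      then show ?thesis using \<open>W b dvd V l b\<close> Vconst[OF True that] by (simp add: v_def)
    next
      case False
      then show ?thesis
        using \<open>W b dvd pderiv (F b0 z)\<close> \<open>W b dvd [:0, 1:] * pderiv (F b0 z)\<close> unfolding v_def by (simp only: if_False split: if_split) simp
    qed
  qed
  have WWdvd: "WW dvd v l" for l
    unfolding WW_def
  proof (rule prod_linear_powers_dvd)
    show "inj_on z {..<m}" by (rule T(1)[OF z])
    fix i assume i: "i \<in> {..<m}"
    then have "i \<in> I (J i)" by (simp add: I_def)
    then have "[:- z i, 1:] ^ (\<mu> i - 1) dvd W (J i)" unfolding W_def using I(1) by (intro dvd_prodI)
    then show "[:- z i, 1:] ^ (\<mu> i - 1) dvd v l" using dvdb[OF J, of i l] i dvd_trans by auto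
  qed simp
  define U where "U l = v l div WW" for l
  have vU: "v l = WW * U l" for l using WWdvd[of l] by (simp add: U_def)
  have sum\<mu>: "(\<Sum>i<m. \<mu> i) = card B * d"
  proof -
    have "(\<Sum>i<m. \<mu> i) = (\<Sum>b\<in>B. \<Sum>i | i \<in> {..<m} \<and> J i = b. \<mu> i)"
      using B J by (intro sum.group[symmetric]) auto
    also have "\<dots> = card B * d" using deg by simp
    finally show ?thesis .
  qed
  define r where "r = (\<Sum>i<m. \<mu> i - 1)"
  have r: "r + m = card B * d"
  proof -
    have "r + m = (\<Sum>i<m. (\<mu> i - 1) + 1)" unfolding r_def sum.distrib by simp
    also have "\<dots> = (\<Sum>i<m. \<mu> i)"
    proof (rule sum.cong)
      fix i assume "i \<in> {..<m}"
      then show "\<mu> i - 1 + 1 = \<mu> i" using \<mu>[of i] by simp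
    qed simp
    finally show ?thesis using sum\<mu> by simp
  qed
  have WW0: "WW \<noteq> 0" by (simp add: WW_def)
  have degWW: "degree WW = r"
  proof -
    have "degree WW = (\<Sum>i<m. degree ([:- z i, 1:] ^ (\<mu> i - 1)))"
      unfolding WW_def by (rule degree_prod_sum_eq) auto
    then show ?thesis by (simp add: degree_power_eq r_def)
  qed
  have degv: "degree (v l) \<le> d" for l
  proof -
    have "degree (V l b0) \<le> d" if l: "l < k"
    proof (rule degree_le, intro allI impI)
      fix i assume i: "i > d"
      have "(\<lambda>y. coeff (F b0 y) i) = (\<lambda>_. 0)" using degF[OF b(1)] i by (auto simp: fun_eq_iff coeff_eq_0)
      then have "coeff (V0 l b0) i = 0" using cw[OF l, of b0] point_derivationD(3)[OF D'[OF l]] by (simp add: coeffwise_def)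
      then show "coeff (V l b0) i = 0" using degF[OF b(1), of z] i by (simp add: V_def coeff_eq_0)
    qed
    moreover have "degree ([:0, 1:] * pderiv (F b0 z)) \<le> d"
    proof -
      have "degree ([:0, 1:] * pderiv (F b0 z)) \<le> 1 + degree (pderiv (F b0 z))"
        by (rule order_trans[OF degree_mult_le]) simp
      then show ?thesis using degF[OF b(1), of z] d by (simp add: degree_pderiv)
    qed
    ultimately show ?thesis using degF[OF b(1), of z] by (auto simp: v_def degree_pderiv)
  qed
  have coeffU: "coeff (U l) i = 0" if "i \<ge> d + 1 - r" for l i
  proof (cases "U l = 0")
    case False
    then have "degree (v l) = r + degree (U l)" using vU[of l] WW0 degWW by (simp add: degree_mult_eq)
    then show ?thesis using degv[of l] that by (intro coeff_eq_0) simp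
  qed simp
  have "\<not> d + 1 - r < k + 2"
  proof
    assume "d + 1 - r < k + 2"
    then obtain \<alpha> where \<alpha>: "\<exists>l\<in>{..<k+2}. \<alpha> l \<noteq> 0" "(\<Sum>l<k+2. smult (\<alpha> l) (U l)) = 0"
      using polys_linearly_dependent[of "{..<k+2}" "d + 1 - r" U] coeffU by auto
    have "(\<Sum>l<k+2. smult (\<alpha> l) (v l)) = WW * (\<Sum>l<k+2. smult (\<alpha> l) (U l))"
      by (simp only: vU sum_distrib_left mult_smult_right)
    then have sv: "(\<Sum>l<k+2. smult (\<alpha> l) (v l)) = 0" using \<alpha>(2) by simp
    have split: "(\<Sum>l<k+2. smult (\<alpha> l) (v l)) = (\<Sum>l<k. smult (\<alpha> l) (V l b0)) + [:\<alpha> k, \<alpha> (Suc k):] * pderiv (F b0 z)"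
      by (simp add: v_def add.assoc)
    define \<Xi> where "\<Xi> i = (\<Sum>l<k. \<alpha> l * \<xi> l i)" for i
    define \<kappa> where "\<kappa> = (\<Sum>l<k. \<alpha> l * (D l u / u z))"
    have \<Xi>: "\<Xi> i = \<alpha> k + \<alpha> (Suc k) * z i" if i: "i < m" for i
    proof -
      define b where "b = J i"
      have bB: "b \<in> B" and iI: "i \<in> I b" using J i by (auto simp: b_def I_def)
      define p where "p = (\<Prod>j\<in>I b - {i}. z i - z j)"
      have "0 = (\<Sum>l<k. smult (\<alpha> l) (V l b)) + [:\<alpha> k, \<alpha> (Suc k):] * pderiv (F b z)"
        using sv split Vconst[OF _ bB] pdconst[OF bB] by simp
      also have "(\<Sum>l<k. smult (\<alpha> l) (V l b)) = W b * ((\<Sum>l<k. smult (\<alpha> l) (K b (\<lambda>i. - of_nat (\<mu> i) * \<xi> l i))) - smult \<kappa> (Q b))"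
        unfolding V_def V0_def FW \<kappa>_def
        by (simp add: smult_diff_right sum_subtractf smult_sum sum_distrib_left right_diff_distrib mult_smult_right)
      also have "(\<Sum>l<k. smult (\<alpha> l) (K b (\<lambda>i. - of_nat (\<mu> i) * \<xi> l i))) = K b (\<lambda>i. \<Sum>l<k. \<alpha> l * (- of_nat (\<mu> i) * \<xi> l i))"
        unfolding K_def lagrange_sum_linear ..
      finally have "W b * (K b (\<lambda>i. \<Sum>l<k. \<alpha> l * (- of_nat (\<mu> i) * \<xi> l i)) - smult \<kappa> (Q b) +
          [:\<alpha> k, \<alpha> (Suc k):] * K b (\<lambda>i. of_nat (\<mu> i))) = 0"
        unfolding pd by (simp add: algebra_simps)
      then have "K b (\<lambda>i. \<Sum>l<k. \<alpha> l * (- of_nat (\<mu> i) * \<xi> l i)) - smult \<kappa> (Q b) +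
          [:\<alpha> k, \<alpha> (Suc k):] * K b (\<lambda>i. of_nat (\<mu> i)) = 0" using W0[of b] by (simp only: mult_eq_0_iff simp_thms)
      \<comment> \<open>At \<open>z\<^sub>i\<close> all terms of a \<open>lagrange_sum\<close> but the \<open>i\<close>-th vanish.\<close>
      then have ev0: "poly (K b (\<lambda>i. \<Sum>l<k. \<alpha> l * (- of_nat (\<mu> i) * \<xi> l i)) - smult \<kappa> (Q b) +
          [:\<alpha> k, \<alpha> (Suc k):] * K b (\<lambda>i. of_nat (\<mu> i))) (z i) = 0" by (simp only: poly_0)
      have "poly (Q b) (z i) = 0" using I(1) iI by (auto simp: Q_def poly_prod)
      moreover have "poly (K b c) (z i) = c i * p" for c
        by (simp add: K_def poly_lagrange_sum[OF I(1) iI] p_def)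
      ultimately have ev: "poly (K b c - smult \<kappa> (Q b) + [:\<alpha> k, \<alpha> (Suc k):] * K b c') (z i) =
          c i * p + (\<alpha> k + z i * \<alpha> (Suc k)) * (c' i * p)" for c c'
        by (simp add: algebra_simps)
      have "p \<noteq> 0"
        using T(1)[OF z] I iI \<mu>I(2)[OF iI] by (auto simp: p_def inj_on_def I_def)
      have "(\<Sum>l<k. \<alpha> l * (- of_nat (\<mu> i) * \<xi> l i)) = - of_nat (\<mu> i) * \<Xi> i"
        by (simp add: \<Xi>_def sum_distrib_left algebra_simps sum_negf)
      then have "- of_nat (\<mu> i) * \<Xi> i * p + (\<alpha> k + z i * \<alpha> (Suc k)) * (of_nat (\<mu> i) * p) = 0"
        using ev0 unfolding ev by (simp only:)
      moreover have "- of_nat (\<mu> i) * \<Xi> i * p + (\<alpha> k + z i * \<alpha> (Suc k)) * (of_nat (\<mu> i) * p) =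
          (of_nat (\<mu> i) * p) * ((\<alpha> k + z i * \<alpha> (Suc k)) - \<Xi> i)" by (simp add: algebra_simps)
      ultimately have "(of_nat (\<mu> i) * p) * ((\<alpha> k + z i * \<alpha> (Suc k)) - \<Xi> i) = 0" by (simp only:)
      moreover have "of_nat (\<mu> i) * p \<noteq> 0" using \<open>p \<noteq> 0\<close> \<mu>[OF i] by simp
      ultimately have "(\<alpha> k + z i * \<alpha> (Suc k)) - \<Xi> i = 0" by (simp only: mult_eq_0_iff simp_thms)
      then show ?thesis by (simp add: mult.commute)
    qed
    have \<xi>01: "\<xi> l 0 = 0" "\<xi> l 1 = 0" if l: "l < k" for l
    proof -
      show "\<xi> l 0 = 0" unfolding \<xi>_def
        by (rule point_derivationD(4)[OF D'[OF l] xR]) (use m T(2) in auto)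
      have "(\<lambda>x. x 1) + (\<lambda>_. - 1) \<in> R"
        using m by (intro fun_algebraD(4)[OF R] fun_algebraD(1)[OF R] xR) simp
      then have "D l ((\<lambda>x. x 1) + (\<lambda>_. - 1)) = 0"
        by (rule point_derivationD(4)[OF D'[OF l]]) (simp add: T(3)[unfolded One_nat_def])
      moreover have "D l ((\<lambda>x. x 1) + (\<lambda>_. - 1)) = D l (\<lambda>x. x 1) + D l (\<lambda>_. - 1)"
        using m by (intro point_derivationD(1)[OF D'[OF l]] xR fun_algebraD(1)[OF R]) simp
      ultimately show "\<xi> l 1 = 0" by (simp add: \<xi>_def point_derivationD(3)[OF D'[OF l]])
    qed
    have "\<alpha> k = 0" using \<Xi>[of 0] m T(2)[OF z] \<xi>01 by (simp add: \<Xi>_def)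
    moreover from this have "\<alpha> (Suc k) = 0" using \<Xi>[of 1] m T(3)[OF z] \<xi>01 by (simp add: \<Xi>_def)
    ultimately have \<Xi>0: "\<Xi> i = 0" if "i < m" for i using \<Xi>[OF that] by simp
    have "\<alpha> l = 0" if "l < k" for l
      by (rule ind[where \<alpha> = \<alpha> and l = l, OF _ that]) (use \<Xi>0 in \<open>auto simp: coords_def \<Xi>_def \<xi>_def\<close>)
    then show False using \<alpha>(1) \<open>\<alpha> k = 0\<close> \<open>\<alpha> (Suc k) = 0\<close> by (auto simp: less_Suc_eq)
  qed
  then show "k + 1 + card B * d \<le> m + d" "m \<le> card B * d" using r by linarith+
qed


text \<open>
  Comparison of constant terms for two fixed points \<open>b0\<close>, \<open>b1\<close> expresses \<open>u\<close> by the tuple; the remaining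
  comparisons are equations in the tuple alone.
\<close>

lemma stratum_equations:
  fixes B :: "'k::field set"
  assumes b: "b0 \<in> B" "b1 \<in> B" "b0 \<noteq> b1" and \<mu>: "\<And>i. i < m \<Longrightarrow> \<mu> i \<ge> 1"
  shows "\<exists>G\<subseteq>polyfuns m. \<forall>y. (\<forall>g\<in>G. g y = 0) \<longleftrightarrow>
    (\<exists>u. \<forall>b\<in>B. \<forall>b'\<in>B. fibre_poly m J \<mu> b y - fibre_poly m J \<mu> b' y = [:u * (b' - b):])"
proof -
  define c where "c b i y = coeff (fibre_poly m J \<mu> b y) i" for b i y
  have cp: "c b i \<in> polyfuns m" for b i
    unfolding c_def[abs_def] by (rule fibre_poly_coeff_polyfun[OF \<mu>])
  define G1 where "G1 = {\<lambda>y. c b (Suc i) y - c b' (Suc i) y | b b' i. b \<in> B \<and> b' \<in> B}"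
  define G2 where "G2 = {\<lambda>y. (c b 0 y - c b' 0 y) * (b1 - b0) - (c b0 0 y - c b1 0 y) * (b' - b) | b b'. b \<in> B \<and> b' \<in> B}"
  have "G1 \<union> G2 \<subseteq> polyfuns m"
    unfolding G1_def G2_def by (auto intro!: polyfunsI polyfuns.const cp)
  moreover have "(\<forall>g\<in>G1 \<union> G2. g y = 0) \<longleftrightarrow>
    (\<exists>u. \<forall>b\<in>B. \<forall>b'\<in>B. fibre_poly m J \<mu> b y - fibre_poly m J \<mu> b' y = [:u * (b' - b):])" for y
  proof
    assume g: "\<forall>g\<in>G1 \<union> G2. g y = 0"
    define u where "u = (c b0 0 y - c b1 0 y) / (b1 - b0)"
    have "fibre_poly m J \<mu> b y - fibre_poly m J \<mu> b' y = [:u * (b' - b):]" if "b \<in> B" "b' \<in> B" for b b'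
    proof (rule poly_eqI)
      fix i
      show "coeff (fibre_poly m J \<mu> b y - fibre_poly m J \<mu> b' y) i = coeff [:u * (b' - b):] i"
      proof (cases i)
        case 0
        have "(\<lambda>y. (c b 0 y - c b' 0 y) * (b1 - b0) - (c b0 0 y - c b1 0 y) * (b' - b)) \<in> G2"
          using that by (auto simp: G2_def)
        from bspec[OF g UnI2[OF this]]
        have "(c b 0 y - c b' 0 y) * (b1 - b0) - (c b0 0 y - c b1 0 y) * (b' - b) = 0" .
        then have "c b 0 y - c b' 0 y = (c b0 0 y - c b1 0 y) * (b' - b) / (b1 - b0)"
          using b(3) by (simp add: eq_divide_eq)
        then show ?thesis using 0 by (simp add: u_def c_def)
      next
        case (Suc j)
        have "(\<lambda>y. c b (Suc j) y - c b' (Suc j) y) \<in> G1" using that by (auto simp: G1_def)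
        from bspec[OF g UnI1[OF this]] have "c b (Suc j) y - c b' (Suc j) y = 0" .
        then show ?thesis using Suc by (simp add: c_def)
      qed
    qed
    then show "\<exists>u. \<forall>b\<in>B. \<forall>b'\<in>B. fibre_poly m J \<mu> b y - fibre_poly m J \<mu> b' y = [:u * (b' - b):]" by blast
  next
    assume "\<exists>u. \<forall>b\<in>B. \<forall>b'\<in>B. fibre_poly m J \<mu> b y - fibre_poly m J \<mu> b' y = [:u * (b' - b):]"
    then obtain u where u: "\<And>b b'. b \<in> B \<Longrightarrow> b' \<in> B \<Longrightarrow> fibre_poly m J \<mu> b y - fibre_poly m J \<mu> b' y = [:u * (b' - b):]" by blast
    have d: "c b i y - c b' i y = coeff [:u * (b' - b):] i" if "b \<in> B" "b' \<in> B" for b b' i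
      unfolding c_def coeff_diff[symmetric] u[OF that] ..
    show "\<forall>g\<in>G1 \<union> G2. g y = 0"
    proof
      fix g assume "g \<in> G1 \<union> G2"
      then show "g y = 0"
        unfolding G1_def G2_def using d b by auto
    qed
  qed
  ultimately show ?thesis by (intro exI[of _ "G1 \<union> G2"] conjI allI)
qed

lemma slice_in_stratum:
  fixes B :: "'k::{alg_closed_field, field_char_0} set"
  assumes m: "m \<ge> 2" and B: "finite B" "card B \<ge> 2"
    and y: "y \<in> slice m" and red: "y ` {..<m} \<le>\<^sub>p B"
  shows "\<exists>d J \<mu>. d > 0 \<and> J \<in> {..<m} \<rightarrow>\<^sub>E B \<and> \<mu> \<in> {..<m} \<rightarrow>\<^sub>E {1..m} \<and>
    (\<forall>b\<in>B. (\<Sum>i | i < m \<and> J i = b. \<mu> i) = d) \<and>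
    (\<exists>u. \<forall>b\<in>B. \<forall>b'\<in>B. fibre_poly m J \<mu> b y - fibre_poly m J \<mu> b' y = [:u * (b' - b):])"
proof -
  obtain P where P: "y ` {..<m} = poly P -` B" using red by (auto simp: poly_red_def)
  have inj: "inj_on y {..<m}" using y by (simp add: slice_def distinct_tuples_def)
  have cardA: "card (poly P -` B) = m" unfolding P[symmetric] using inj by (simp add: card_image)
  define d where "d = degree P"
  have d0: "d > 0"
  proof (rule ccontr)
    assume "\<not> ?thesis"
    then obtain c where "P = [:c:]" by (auto simp: d_def elim: degree_eq_zeroE)
    then have "poly P -` B = {} \<or> poly P -` B = UNIV" by auto
    then show False using cardA m infinite_UNIV_char_0[where 'a = 'k] by auto
  qed
  have "card B * d < m + d" using card_preimage_poly_lower[of P B] d0 B(1) cardA by (simp add: d_def)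
  moreover have "2 * d \<le> card B * d" using B(2) by simp
  ultimately have dm: "d < m" by linarith
  define J where "J = (\<lambda>i\<in>{..<m}. poly P (y i))"
  define \<mu> where "\<mu> = (\<lambda>i\<in>{..<m}. order (y i) (P - [:poly P (y i):]))"
  have nz: "P - [:b:] \<noteq> 0" for b using d0 by (metis d_def degree_pCons_0 eq_iff_diff_eq_0 less_irrefl)
  have deg: "degree (P - [:b:]) = d" for b
    using d0 degree_add_eq_left[of "[:- b:]" P] by (simp only: diff_conv_add_uminus d_def) simp
  have lead: "lead_coeff (P - [:b:]) = lead_coeff P" for b
    unfolding deg using d0 by (simp add: d_def coeff_pCons split: nat.split)
  have fibre: "{x. poly P x = b} = y ` {i. i < m \<and> J i = b}" if "b \<in> B" for b
  proof -
    have "x \<in> y ` {..<m}" if "poly P x = b" for x using P that \<open>b \<in> B\<close> by auto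
    then show ?thesis by (auto simp: J_def)
  qed
  have injb: "inj_on y {i. i < m \<and> J i = b}" for b by (rule inj_on_subset[OF inj]) auto
  have J: "J i \<in> B" if "i < m" for i using P that by (auto simp: J_def)
  have \<mu>1: "1 \<le> \<mu> i" "\<mu> i \<le> m" if "i < m" for i
  proof -
    have "order (y i) (P - [:poly P (y i):]) \<noteq> 0" using nz by (simp add: order_eq_0_iff)
    then show "1 \<le> \<mu> i" using that by (simp add: \<mu>_def)
    show "\<mu> i \<le> m" using order_degree[OF nz, of "y i" "poly P (y i)"] dm deg that by (simp add: \<mu>_def)
  qed
  have sum: "(\<Sum>i | i < m \<and> J i = b. \<mu> i) = d" if "b \<in> B" for b
  proof -
    have "d = (\<Sum>x | poly (P - [:b:]) x = 0. order x (P - [:b:]))"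
      using sum_order_eq_degree[OF nz[of b]] deg by simp
    also have "{x. poly (P - [:b:]) x = 0} = y ` {i. i < m \<and> J i = b}" using fibre[OF that] by simp
    also have "(\<Sum>x\<in>y ` {i. i < m \<and> J i = b}. order x (P - [:b:])) = (\<Sum>i | i < m \<and> J i = b. order (y i) (P - [:b:]))"
      by (rule sum.reindex[OF injb, unfolded comp_def])
    also have "\<dots> = (\<Sum>i | i < m \<and> J i = b. \<mu> i)" by (intro sum.cong) (auto simp: \<mu>_def J_def)
    finally show ?thesis by simp
  qed
  have fp: "P - [:b:] = smult (lead_coeff P) (fibre_poly m J \<mu> b y)" if "b \<in> B" for b
  proof -
    have "P - [:b:] = smult (lead_coeff P) (\<Prod>x | poly (P - [:b:]) x = 0. [:- x, 1:] ^ order x (P - [:b:]))"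
      using poly_eq_prod_roots[OF nz[of b]] unfolding lead .
    also have "{x. poly (P - [:b:]) x = 0} = y ` {i. i < m \<and> J i = b}" using fibre[OF that] by simp
    also have "(\<Prod>x\<in>y ` {i. i < m \<and> J i = b}. [:- x, 1:] ^ order x (P - [:b:])) =
        (\<Prod>i | i < m \<and> J i = b. [:- y i, 1:] ^ order (y i) (P - [:b:]))"
      by (rule prod.reindex[OF injb, unfolded comp_def])
    also have "\<dots> = fibre_poly m J \<mu> b y"
      unfolding fibre_poly_def by (intro prod.cong) (auto simp: \<mu>_def J_def)
    finally show ?thesis .
  qed
  have lc: "lead_coeff P \<noteq> 0" using d0 by (auto simp: d_def)
  have "fibre_poly m J \<mu> b y - fibre_poly m J \<mu> b' y = [:(1 / lead_coeff P) * (b' - b):]" if "b \<in> B" "b' \<in> B" for b b'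
  proof -
    have f: "fibre_poly m J \<mu> b y = smult (1 / lead_coeff P) (P - [:b:])" if "b \<in> B" for b
      unfolding fp[OF that] using lc by simp
    show ?thesis unfolding f[OF that(1)] f[OF that(2)] smult_diff_right[symmetric] by simp
  qed
  then have "\<exists>u. \<forall>b\<in>B. \<forall>b'\<in>B. fibre_poly m J \<mu> b y - fibre_poly m J \<mu> b' y = [:u * (b' - b):]" by blast
  moreover have "J \<in> {..<m} \<rightarrow>\<^sub>E B" using J by (auto simp: J_def)
  moreover have "\<mu> \<in> {..<m} \<rightarrow>\<^sub>E {1..m}" using \<mu>1 by (auto simp: PiE_iff extensional_def \<mu>_def)
  ultimately show ?thesis using d0 sum by blast
qed

text \<open>
  There are finitely many choices of values and multiplicities, and each stratum is given by polynomial
  equations on the slice; the largest member of a lifted chain is irreducible and so lies in one stratum.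
\<close>

theorem chain_length_bound:
  fixes B :: "'k::{alg_closed_field, field_char_0} set"
  assumes m: "m \<ge> 2" and B: "finite B" "card B \<ge> 2"
    and C: "\<And>i. i \<le> k \<Longrightarrow> irreducible_closed (subtopology (n_classes_top m) (classes_below m (poly_class B))) (C i)"
      "\<And>i. i < k \<Longrightarrow> C i \<subset> C (Suc i)"
  shows "\<exists>d. m \<le> card B * d \<and> k + 1 + card B * d \<le> m + d"
proof -
  define S where "S = classes_below m (poly_class B)"
  define Y where "Y = {y \<in> slice m. tuple_class m y \<in> S}"
  have "S \<subseteq> n_classes m" by (auto simp: S_def classes_below_def)
  from slice_chain_lift[OF m this, of k C] C obtain K
    where K: "\<forall>i\<le>k. irreducible_closed (subtopology (zariski m) Y) (K i)" "\<forall>i<k. K i \<subset> K (Suc i)"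
    unfolding Y_def S_def by blast
  have YA: "Y \<subseteq> affine_space m" by (auto simp: Y_def slice_def distinct_tuples_def)
  have KY: "K i \<subseteq> Y" if "i \<le> k" for i
    using K(1) that closedin_subset[of "subtopology (zariski m) Y" "K i"] by (auto simp: irreducible_closed_def)
  have prime: "prime_on (polyfuns m) (K i)" if "i \<le> k" for i
    using prime_on_irreducible[OF YA] K(1) that by blast
  have sep: "\<exists>f\<in>polyfuns m. (\<forall>x\<in>K i. f x = 0) \<and> (\<exists>x\<in>K (Suc i). f x \<noteq> 0)" if "i < k" for i
    using K that KY[of "Suc i"] by (intro separating_polyfun[OF YA]) (auto simp: irreducible_closed_def)
  have sub: "K i \<subseteq> K (Suc i)" if "i < k" for i using K(2) that by blast
  obtain z D where z: "z \<in> K k" and D: "\<forall>l<k. point_derivation (polyfuns m) (K k) z (D l)"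
    and ind: "\<forall>\<alpha>. (\<forall>h\<in>set (coords m). (\<Sum>l<k. \<alpha> l * D l h) = 0) \<longrightarrow> (\<forall>l<k. \<alpha> l = 0)"
    using chain_point_derivations[where T = K and k = k and R = "polyfuns m" and hs = "coords m",
        OF fun_algebra_polyfuns coords_subset polyfuns_least prime sub sep] by blast
  obtain b0 b1 where b: "b0 \<in> B" "b1 \<in> B" "b0 \<noteq> b1"
  proof -
    obtain b0 where "b0 \<in> B" using B by fastforce
    moreover have "B \<noteq> {b0}" using B(2) by auto
    ultimately show thesis using that by blast
  qed
  define str where "str \<tau> y \<longleftrightarrow> (\<exists>u. \<forall>b\<in>B. \<forall>b'\<in>B.
    fibre_poly m (fst \<tau>) (snd \<tau>) b y - fibre_poly m (fst \<tau>) (snd \<tau>) b' y = [:u * (b' - b):])" for \<tau> y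
  define types where "types = {\<tau> \<in> ({..<m} \<rightarrow>\<^sub>E B) \<times> ({..<m} \<rightarrow>\<^sub>E {1..m}). \<exists>d>0. \<forall>b\<in>B. (\<Sum>i | i < m \<and> fst \<tau> i = b. snd \<tau> i) = d}"
  have "finite (({..<m} \<rightarrow>\<^sub>E B) \<times> ({..<m} \<rightarrow>\<^sub>E {1..m}))"
    using B(1) by (intro finite_cartesian_product finite_PiE) auto
  then have fin: "finite types" by (rule finite_subset[rotated]) (auto simp: types_def)
  have \<mu>1: "snd \<tau> i \<ge> 1" if "\<tau> \<in> types" "i < m" for \<tau> i
    using that by (auto simp: types_def PiE_iff)
  have cover: "\<exists>\<tau>\<in>types. str \<tau> y" if "y \<in> K k" for y
  proof -
    have y: "y \<in> slice m" "tuple_class m y \<in> S" using that KY[of k] by (auto simp: Y_def)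
    have "y ` {..<m} \<le>\<^sub>p B"
      using y(2) by (simp add: S_def classes_below_def tuple_class_def class_red_poly_class)
    from slice_in_stratum[OF m B y(1) this] obtain d J \<mu> where
      *: "d > 0" "J \<in> {..<m} \<rightarrow>\<^sub>E B" "\<mu> \<in> {..<m} \<rightarrow>\<^sub>E {1..m}" "\<forall>b\<in>B. (\<Sum>i | i < m \<and> J i = b. \<mu> i) = d"
      "\<exists>u. \<forall>b\<in>B. \<forall>b'\<in>B. fibre_poly m J \<mu> b y - fibre_poly m J \<mu> b' y = [:u * (b' - b):]" by blast
    have "(J, \<mu>) \<in> types" unfolding types_def using *(1-4) by auto
    moreover have "str (J, \<mu>) y" using *(5) by (simp add: str_def)
    ultimately show ?thesis by blast
  qed
  have "\<exists>\<tau>\<in>types. \<forall>y\<in>K k. str \<tau> y"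
  proof (rule ccontr)
    assume neg: "\<not> ?thesis"
    \<comment> \<open>Otherwise each stratum has an equation that fails somewhere on the largest member, and by
      irreducibility all of them fail at a common point.\<close>
    have ex: "\<exists>g\<in>polyfuns m. (\<exists>y\<in>K k. g y \<noteq> 0) \<and> (\<forall>y. str \<tau> y \<longrightarrow> g y = 0)" if \<tau>: "\<tau> \<in> types" for \<tau>
    proof -
      obtain y where y: "y \<in> K k" "\<not> str \<tau> y" using neg \<tau> by blast
      have "\<exists>G\<subseteq>polyfuns m. \<forall>y. (\<forall>g\<in>G. g y = 0) \<longleftrightarrow> str \<tau> y"
        unfolding str_def by (rule stratum_equations[OF b]) (rule \<mu>1[OF \<tau>])
      then obtain G where G: "G \<subseteq> polyfuns m" "\<And>y. (\<forall>g\<in>G. g y = 0) \<longleftrightarrow> str \<tau> y" by auto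
      obtain h where h: "h \<in> G" "h y \<noteq> 0" using y(2) G(2)[of y] by auto
      have "h x = 0" if "str \<tau> x" for x using G(2)[of x] that h(1) by simp
      then show ?thesis using G(1) h y(1) by (intro bexI[of _ h] conjI bexI[of _ y]) auto
    qed
    have "\<forall>\<tau>\<in>types. \<exists>g. g \<in> polyfuns m \<and> (\<exists>y\<in>K k. g y \<noteq> 0) \<and> (\<forall>y. str \<tau> y \<longrightarrow> g y = 0)"
    proof
      fix \<tau> assume "\<tau> \<in> types"
      from ex[OF this] show "\<exists>g. g \<in> polyfuns m \<and> (\<exists>y\<in>K k. g y \<noteq> 0) \<and> (\<forall>y. str \<tau> y \<longrightarrow> g y = 0)"
        by (simp only: Bex_def)
    qed
    from bchoice[OF this] obtain g where
      gt: "\<forall>\<tau>\<in>types. g \<tau> \<in> polyfuns m \<and> (\<exists>y\<in>K k. g \<tau> y \<noteq> 0) \<and> (\<forall>y. str \<tau> y \<longrightarrow> g \<tau> y = 0)" ..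
    have g: "g \<tau> \<in> polyfuns m" "\<exists>y\<in>K k. g \<tau> y \<noteq> 0" if "\<tau> \<in> types" for \<tau>
      using bspec[OF gt that] by (auto simp only:)
    have g0: "g \<tau> y = 0" if "\<tau> \<in> types" "str \<tau> y" for \<tau> y
      using bspec[OF gt that(1)] that(2) by (auto simp only:)
    obtain y where "y \<in> K k" "\<forall>\<tau>\<in>types. g \<tau> y \<noteq> 0"
      using prime_on_prod[where f = g and I = types, OF fun_algebra_polyfuns prime[OF order_refl] fin g(1,2)] by blast
    then show False using cover g0 by blast
  qed
  then obtain J \<mu> where t: "(J, \<mu>) \<in> types" and str: "\<And>y. y \<in> K k \<Longrightarrow> str (J, \<mu>) y" by force
  obtain d where d: "d > 0" "\<And>b. b \<in> B \<Longrightarrow> (\<Sum>i | i < m \<and> J i = b. \<mu> i) = d" using t by (auto simp: types_def)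
  have J: "J i \<in> B" if "i < m" for i using t that by (auto simp: types_def PiE_iff)
  have \<mu>: "\<mu> i \<ge> 1" if "i < m" for i using \<mu>1[OF t that] by simp
  have T: "inj_on y {..<m}" "y 0 = 0" "y 1 = 1" if "y \<in> K k" for y
    using that KY[of k] by (auto simp: Y_def slice_def distinct_tuples_def)
  have str': "\<exists>u. \<forall>b\<in>B. \<forall>b'\<in>B. fibre_poly m J \<mu> b y - fibre_poly m J \<mu> b' y = [:u * (b' - b):]" if "y \<in> K k" for y
    using str[OF that] by (simp add: str_def)
  have D': "point_derivation (polyfuns m) (K k) z (D l)" if "l < k" for l using D that by blast
  have ind': "\<alpha> l = 0" if "\<And>h. h \<in> set (coords m) \<Longrightarrow> (\<Sum>l<k. \<alpha> l * D l h) = 0" "l < k" for \<alpha> l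
    using ind that by blast
  have "k + 1 + card B * d \<le> m + d"
    by (rule stratum_tangent_bound(1)[where T = "K k" and J = J and \<mu> = \<mu> and D = D and z = z and k = k and
      m = m and B = B and d = d]) (fact m B J \<mu> d T str' z D' ind')+
  moreover have "m \<le> card B * d"
    by (rule stratum_tangent_bound(2)[where T = "K k" and J = J and \<mu> = \<mu> and D = D and z = z and k = k and
      m = m and B = B and d = d]) (fact m B J \<mu> d T str' z D' ind')+
  ultimately show ?thesis by blast
qed


section \<open>Symmetric functions of the roots of a family of polynomials\<close>

definition coeffs_in :: "('p \<Rightarrow> 'k::comm_ring_1) set \<Rightarrow> ('p \<Rightarrow> 'k poly) \<Rightarrow> bool"
  where "coeffs_in R F \<longleftrightarrow> (\<forall>i. (\<lambda>x. coeff (F x) i) \<in> R)"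

lemma coeffs_in_mult:
  assumes R: "fun_algebra R" and "coeffs_in R F" "coeffs_in R G"
  shows "coeffs_in R (\<lambda>x. F x * G x)"
  unfolding coeffs_in_def
proof
  fix i
  have "(\<Sum>j\<le>i. (\<lambda>x. coeff (F x) j) * (\<lambda>x. coeff (G x) (i - j))) \<in> R"
    using assms(2,3) by (intro fun_algebra_sum[OF R] fun_algebraD(5)[OF R]) (auto simp: coeffs_in_def)
  moreover have "(\<lambda>x. coeff (F x * G x) i) = (\<Sum>j\<le>i. (\<lambda>x. coeff (F x) j) * (\<lambda>x. coeff (G x) (i - j)))"
    by (simp add: fun_eq_iff coeff_mult sum_fun_apply)
  ultimately show "(\<lambda>x. coeff (F x * G x) i) \<in> R" by simp
qed

lemma coeffs_in_const: "fun_algebra R \<Longrightarrow> coeffs_in R (\<lambda>_. p)"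
  by (simp add: coeffs_in_def fun_algebraD(1))

lemma coeffs_in_add:
  assumes R: "fun_algebra R" and "coeffs_in R F" "coeffs_in R G"
  shows "coeffs_in R (\<lambda>x. F x + G x)"
  unfolding coeffs_in_def
proof
  fix i
  have "(\<lambda>x. coeff (F x + G x) i) = (\<lambda>x. coeff (F x) i) + (\<lambda>x. coeff (G x) i)" by (simp add: fun_eq_iff)
  then show "(\<lambda>x. coeff (F x + G x) i) \<in> R" using assms by (simp only: coeffs_in_def fun_algebraD(4)[OF R])
qed

lemma coeffs_in_singleton:
  assumes "fun_algebra R" "f \<in> R"
  shows "coeffs_in R (\<lambda>x. [:f x:])"
  unfolding coeffs_in_def
proof
  fix i
  show "(\<lambda>x. coeff [:f x:] i) \<in> R" using assms by (cases i) (auto intro: fun_algebraD(1))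
qed

lemma coeffs_in_prod:
  assumes R: "fun_algebra R" and "\<And>i. i \<in> I \<Longrightarrow> coeffs_in R (F i)"
  shows "coeffs_in R (\<lambda>x. \<Prod>i\<in>I. F i x)"
  using assms(2)
proof (induction I rule: infinite_finite_induct)
  case (insert i I)
  then have "coeffs_in R (\<lambda>x. F i x * (\<Prod>i\<in>I. F i x))" by (intro coeffs_in_mult[OF R]) auto
  then show ?case using insert.hyps by simp
qed (auto intro: coeffs_in_const[OF R])

lemma coeffs_in_linear_factor:
  assumes R: "fun_algebra R" and f: "f \<in> R"
  shows "coeffs_in R (\<lambda>x. [:- f x, 1:])"
proof -
  have "coeffs_in R (\<lambda>x. [:(- f) x:] + [:0, 1:])"
    by (intro coeffs_in_add[OF R] coeffs_in_singleton[OF R] coeffs_in_const[OF R] fun_algebraD(6)[OF R] f)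
  then show ?thesis by simp
qed

definition univariate :: "('k::comm_ring_1 \<Rightarrow> 'k) set"
  where "univariate = range poly"

lemma fun_algebra_univariate: "fun_algebra univariate"
  unfolding fun_algebra_def univariate_def
proof (intro conjI allI ballI)
  show "(\<lambda>_. c) \<in> range poly" for c :: 'a by (rule image_eqI[of _ _ "[:c:]"]) (auto simp: fun_eq_iff)
  fix f g :: "'a \<Rightarrow> 'a" assume "f \<in> range poly" "g \<in> range poly"
  then obtain p q where "f = poly p" "g = poly q" by auto
  then show "f + g \<in> range poly" "f * g \<in> range poly"
    by (auto simp: fun_eq_iff intro: image_eqI[of _ _ "p + q"] image_eqI[of _ _ "p * q"])
qed

lemma univariate_id: "(\<lambda>t. t) \<in> univariate"
  unfolding univariate_def by (rule image_eqI[of _ _ "[:0, 1:]"]) (auto simp: fun_eq_iff)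

lemma coeff_linear_mult:
  fixes H :: "'k::comm_ring_1 poly"
  shows "coeff ([:- y, 1:] * H) 0 = - y * coeff H 0"
    and "coeff ([:- y, 1:] * H) (Suc i) = coeff H i - y * coeff H (Suc i)"
  by simp_all

text \<open>
  Newton's identities in a form that avoids elementary symmetric functions: with
  \<open>H\<^sub>j = M / (X - y\<^sub>j)\<close>, the sums of \<open>y\<^sub>j\<^sup>s\<close> times a coefficient of \<open>H\<^sub>j\<close> are polynomial in the parameter.
  For \<open>s = 0\<close> these are the coefficients of \<open>M'\<close>; the power sums come from the leading coefficients.
\<close>

lemma power_sum_univariate:
  fixes y :: "'k::field \<Rightarrow> nat \<Rightarrow> 'k"
  assumes M: "coeffs_in univariate M" and y: "\<And>t. M t = (\<Prod>j<m. [:- y t j, 1:])"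
  shows "(\<lambda>t. \<Sum>j<m. y t j ^ s) \<in> univariate"
proof (cases "m = 0")
  case True
  then show ?thesis using fun_algebraD(1)[OF fun_algebra_univariate, of 0] by simp
next
  case False
  note U = fun_algebraD[OF fun_algebra_univariate]
  define H where "H t j = (\<Prod>l\<in>{..<m} - {j}. [:- y t l, 1:])" for t j
  define S where "S s i t = (\<Sum>j<m. y t j ^ s * coeff (H t j) i)" for s i t
  have MH: "M t = [:- y t j, 1:] * H t j" if "j < m" for t j
    unfolding y H_def using that by (intro prod.remove) auto
  have lead: "coeff (H t j) (m - 1) = 1" if "j < m" for t j
  proof -
    have "degree (H t j) = (\<Sum>l\<in>{..<m} - {j}. degree [:- y t l, 1:])"
      unfolding H_def by (rule degree_prod_sum_eq) auto
    then have "degree (H t j) = m - 1" using that by simp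
    moreover have "lead_coeff (H t j) = 1" unfolding H_def by (simp add: lead_coeff_prod)
    ultimately show ?thesis by simp
  qed
  have "S s i \<in> univariate" for i
  proof (induction s arbitrary: i)
    case 0
    have "S 0 i t = coeff (\<Sum>j<m. H t j) i" for t by (simp add: S_def coeff_sum)
    moreover have "(\<Sum>j<m. H t j) = pderiv (M t)" for t
      unfolding y pderiv_prod H_def by (simp add: pderiv_pCons)
    ultimately have "S 0 i = (\<lambda>_. of_nat (Suc i)) * (\<lambda>t. coeff (M t) (Suc i))"
      by (simp add: fun_eq_iff coeff_pderiv)
    moreover have "(\<lambda>t. coeff (M t) (Suc i)) \<in> univariate" using M by (simp add: coeffs_in_def)
    ultimately show ?case using U(5)[OF U(1)] by (simp only:)
  next
    case (Suc s)
    have top: "(\<lambda>t. \<Sum>j<m. y t j ^ s) = S s (m - 1)"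
      unfolding S_def[abs_def] using lead by (intro ext sum.cong) auto
    have Mi: "(\<lambda>t. coeff (M t) i) \<in> univariate" for i using M by (simp add: coeffs_in_def)
    have eq0: "S (Suc s) 0 t = - coeff (M t) 0 * S s (m - 1) t" for t
    proof -
      have "y t j ^ Suc s * coeff (H t j) 0 = - coeff (M t) 0 * y t j ^ s" if "j < m" for j
        unfolding MH[OF that] coeff_linear_mult by simp
      then have "S (Suc s) 0 t = (\<Sum>j<m. - coeff (M t) 0 * y t j ^ s)" unfolding S_def by (intro sum.cong) auto
      then show ?thesis using fun_cong[OF top, of t] by (simp add: sum_distrib_left sum_negf flip: sum_distrib_left)
    qed
    have eqS: "S (Suc s) (Suc i) t = S s i t + - coeff (M t) (Suc i) * S s (m - 1) t" for t i
    proof -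
      have "y t j ^ Suc s * coeff (H t j) (Suc i) = y t j ^ s * coeff (H t j) i + - coeff (M t) (Suc i) * y t j ^ s"
        if "j < m" for j
        unfolding MH[OF that] coeff_linear_mult by (simp add: algebra_simps)
      then have "S (Suc s) (Suc i) t = (\<Sum>j<m. y t j ^ s * coeff (H t j) i + - coeff (M t) (Suc i) * y t j ^ s)"
        unfolding S_def by (intro sum.cong) auto
      also have "\<dots> = S s i t + - coeff (M t) (Suc i) * (\<Sum>j<m. y t j ^ s)"
        by (simp only: S_def sum.distrib sum_distrib_left)
      finally show ?thesis unfolding fun_cong[OF top, of t] .
    qed
    show ?case
    proof (cases i)
      case 0
      have "S (Suc s) i = - (\<lambda>t. coeff (M t) 0) * S s (m - 1)" using eq0 by (simp add: fun_eq_iff 0)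
      then show ?thesis using U(5)[OF U(6)[OF Mi] Suc.IH] by (simp only:)
    next
      case (Suc i')
      have "S (Suc s) i = S s i' + - (\<lambda>t. coeff (M t) i) * S s (m - 1)" using eqS by (simp add: fun_eq_iff Suc)
      then show ?thesis using U(4)[OF Suc.IH U(5)[OF U(6)[OF Mi] Suc.IH]] by (simp only:)
    qed
  qed
  moreover have "(\<lambda>t. \<Sum>j<m. y t j ^ s) = S s (m - 1)"
    unfolding S_def[abs_def] using lead by (intro ext sum.cong) auto
  ultimately show ?thesis by simp
qed

text \<open>
  The sum runs over all maps \<open>h\<close> and not only over permutations: in this way the sum for a monomial is a
  product of power sums.
\<close>

lemma symmetric_sum_univariate:
  fixes y :: "'k::field \<Rightarrow> nat \<Rightarrow> 'k"
  assumes M: "coeffs_in univariate M" and y: "\<And>t. M t = (\<Prod>j<m. [:- y t j, 1:])"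
    and f: "f \<in> polyfuns m"
  shows "(\<lambda>t. \<Sum>h\<in>{..<m} \<rightarrow>\<^sub>E {..<m}. f (\<lambda>i. y t (h i))) \<in> univariate"
proof -
  note A = fun_algebra_univariate
  obtain p where p: "p \<in> mpolys m" "mpoly_eval p = f" using polyfun_mpoly_eval[OF f] by blast
  have "(\<Sum>h\<in>{..<m} \<rightarrow>\<^sub>E {..<m}. f (\<lambda>i. y t (h i))) =
    (\<Sum>a\<in>Poly_Mapping.keys p. Poly_Mapping.lookup p a * (\<Prod>i<m. \<Sum>j<m. y t j ^ Poly_Mapping.lookup a i))" for t
  proof -
    have "(\<Sum>h\<in>{..<m} \<rightarrow>\<^sub>E {..<m}. f (\<lambda>i. y t (h i))) =
      (\<Sum>a\<in>Poly_Mapping.keys p. Poly_Mapping.lookup p a * (\<Sum>h\<in>{..<m} \<rightarrow>\<^sub>E {..<m}. mono_eval a (\<lambda>i. y t (h i))))"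
      unfolding p(2)[symmetric] mpoly_eval_def by (subst sum.swap) (simp add: sum_distrib_left)
    also have "\<dots> = (\<Sum>a\<in>Poly_Mapping.keys p. Poly_Mapping.lookup p a * (\<Prod>i<m. \<Sum>j<m. y t j ^ Poly_Mapping.lookup a i))"
    proof (intro sum.cong refl arg_cong[where f = "(*) _"])
      fix a assume "a \<in> Poly_Mapping.keys p"
      then have "Poly_Mapping.keys a \<subseteq> {..<m}" using p(1) by (simp add: mpolys_def)
      then have "(\<Sum>h\<in>{..<m} \<rightarrow>\<^sub>E {..<m}. mono_eval a (\<lambda>i. y t (h i))) =
        (\<Sum>h\<in>{..<m} \<rightarrow>\<^sub>E {..<m}. \<Prod>i<m. y t (h i) ^ Poly_Mapping.lookup a i)"
        by (intro sum.cong refl mono_eval_superset) auto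
      also have "\<dots> = (\<Prod>i<m. \<Sum>j<m. y t j ^ Poly_Mapping.lookup a i)"
        by (rule prod_sum_PiE[symmetric]) auto
      finally show "(\<Sum>h\<in>{..<m} \<rightarrow>\<^sub>E {..<m}. mono_eval a (\<lambda>i. y t (h i))) =
        (\<Prod>i<m. \<Sum>j<m. y t j ^ Poly_Mapping.lookup a i)" .
    qed
    finally show ?thesis .
  qed
  then have "(\<lambda>t. \<Sum>h\<in>{..<m} \<rightarrow>\<^sub>E {..<m}. f (\<lambda>i. y t (h i))) =
    (\<Sum>a\<in>Poly_Mapping.keys p. (\<lambda>_. Poly_Mapping.lookup p a) * (\<Prod>i<m. (\<lambda>t. \<Sum>j<m. y t j ^ Poly_Mapping.lookup a i)))"
    by (simp add: fun_eq_iff sum_fun_apply prod_fun_apply)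
  moreover have "(\<Sum>a\<in>Poly_Mapping.keys p. (\<lambda>_. Poly_Mapping.lookup p a) * (\<Prod>i<m. (\<lambda>t. \<Sum>j<m. y t j ^ Poly_Mapping.lookup a i))) \<in> univariate"
    by (intro fun_algebra_sum[OF A] fun_algebraD(5)[OF A] fun_algebraD(1)[OF A] fun_algebra_prod[OF A]
        power_sum_univariate[OF M y])
  ultimately show ?thesis by simp
qed

lemma polyfun_cong:
  assumes "f \<in> polyfuns m" "\<And>i. i < m \<Longrightarrow> x i = y i"
  shows "f x = f y"
  using assms(1) by induction (auto simp: assms(2))

lemma monic_linear_factors:
  fixes p :: "'k::alg_closed_field poly"
  assumes "lead_coeff p = 1"
  shows "\<exists>y. p = (\<Prod>j<degree p. [:- y j, 1:])"
proof -
  have "p \<noteq> 0" using assms by auto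
  then obtain A where A: "size A = degree p" "p = smult (lead_coeff p) (\<Prod>x\<in>#A. [:-x, 1:])"
    using alg_closed_imp_factorization by blast
  obtain xs where xs: "mset xs = A" using ex_mset by blast
  have "(\<Prod>x\<in>#A. [:-x, 1:]) = prod_list (map (\<lambda>x. [:-x, 1:]) xs)"
    unfolding xs[symmetric] by (simp flip: mset_map add: prod_mset_prod_list)
  also have "\<dots> = (\<Prod>j<length xs. [:- (xs ! j), 1:])"
    by (simp add: prod.list_conv_set_nth atLeast0LessThan)
  finally show ?thesis using A xs assms by (intro exI[of _ "\<lambda>j. xs ! j"]) (metis size_mset smult_1_left)
qed

text \<open>
  In a family of monic polynomials whose coefficients are polynomials in \<open>t\<close>, an open condition on the
  roots that holds at one parameter holds at all but finitely many.
\<close>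

theorem generic_root_tuples:
  fixes M :: "'k::alg_closed_field \<Rightarrow> 'k poly"
  assumes M: "coeffs_in univariate M" and monic: "\<And>t. lead_coeff (M t) = 1" "\<And>t. degree (M t) = m"
    and x: "x \<in> distinct_tuples m" "M s = (\<Prod>j<m. [:- x j, 1:])" and f: "f \<in> polyfuns m" "f x \<noteq> 0"
  shows "\<exists>g. g \<noteq> 0 \<and> (\<forall>t. poly g t \<noteq> 0 \<longrightarrow>
    (\<exists>w\<in>distinct_tuples m. w ` {..<m} = {z. poly (M t) z = 0} \<and> f w \<noteq> 0))"
proof -
  have "\<exists>y. M t = (\<Prod>j<m. [:- y j, 1:])" for t using monic_linear_factors[OF monic(1)[of t]] monic(2) by simp
  then obtain y0 where y0: "\<And>t. M t = (\<Prod>j<m. [:- y0 t j, 1:])" by metis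
  define y where "y t = (if t = s then x else y0 t)" for t
  have y: "M t = (\<Prod>j<m. [:- y t j, 1:])" for t using y0 x(2) by (simp add: y_def)
  \<comment> \<open>The factors \<open>w i - x j\<close> remove every rearrangement of \<open>x\<close> other than \<open>x\<close> itself, so that the symmetric
    sum does not cancel at \<open>s\<close>; the factors \<open>w i - w j\<close> remove the maps that are not injective.\<close>
  define e where "e w = (\<Prod>i<m. \<Prod>j\<in>{..<m} - {i}. (w i - x j) * (w i - w j))" for w :: "nat \<Rightarrow> 'k"
  have e: "e \<in> polyfuns m"
    unfolding e_def[abs_def] by (intro polyfunsI polyfuns.const polyfuns.coord) auto
  define F where "F w = f w * e w" for w
  have F: "F \<in> polyfuns m" unfolding F_def[abs_def] by (intro polyfunsI f e)
  obtain g where g: "\<And>t. poly g t = (\<Sum>h\<in>{..<m} \<rightarrow>\<^sub>E {..<m}. F (\<lambda>i. y t (h i)))"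
    using symmetric_sum_univariate[OF M y F] unfolding univariate_def by (auto simp: fun_eq_iff)
  have injx: "inj_on x {..<m}" using x(1) by (simp add: distinct_tuples_def)
  have "poly g s \<noteq> 0"
  proof -
    define h0 where "h0 = (\<lambda>i\<in>{..<m}. i)"
    have "F (\<lambda>i. x (h i)) = 0" if h: "h \<in> {..<m} \<rightarrow>\<^sub>E {..<m}" "h \<noteq> h0" for h
    proof -
      have "\<exists>i<m. h i \<noteq> i"
      proof (rule ccontr)
        assume "\<not> ?thesis"
        then have "h = h0" using h(1) by (intro PiE_ext[OF h(1)]) (auto simp: h0_def)
        then show False using h(2) by simp
      qed
      then obtain i where i: "i < m" "h i \<noteq> i" by blast
      then have "h i \<in> {..<m} - {i}" using h(1) by auto
      then have "(\<Prod>j\<in>{..<m} - {i}. (x (h i) - x j) * (x (h i) - x (h j))) = 0"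
        by (intro prod_zero) auto
      then have "e (\<lambda>i. x (h i)) = 0" using i by (auto simp: e_def intro!: prod_zero)
      then show ?thesis by (simp add: F_def)
    qed
    then have "poly g s = (\<Sum>h\<in>{h0}. F (\<lambda>i. x (h i)))"
      unfolding g by (intro sum.mono_neutral_cong_right) (auto simp: h0_def y_def finite_PiE)
    also have "\<dots> = F x"
      using polyfun_cong[OF F, of "\<lambda>i. x (h0 i)" x] by (simp add: h0_def)
    also have "F x \<noteq> 0" using injx f(2) by (auto simp: F_def e_def inj_on_def)
    finally show ?thesis .
  qed
  then have "g \<noteq> 0" by auto
  moreover have "\<exists>w\<in>distinct_tuples m. w ` {..<m} = {z. poly (M t) z = 0} \<and> f w \<noteq> 0" if "poly g t \<noteq> 0" for t
  proof -
    obtain h where h: "h \<in> {..<m} \<rightarrow>\<^sub>E {..<m}" "F (\<lambda>i. y t (h i)) \<noteq> 0"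
      using \<open>poly g t \<noteq> 0\<close> unfolding g by (meson sum.not_neutral_contains_not_neutral)
    define w where "w = (\<lambda>i\<in>{..<m}. y t (h i))"
    have Fw: "F w \<noteq> 0" using polyfun_cong[OF F, of w "\<lambda>i. y t (h i)"] h(2) by (simp add: w_def)
    then have "e w \<noteq> 0" "f w \<noteq> 0" by (auto simp: F_def)
    have injw: "inj_on w {..<m}"
    proof (rule inj_onI, rule ccontr)
      fix i j assume ij: "i \<in> {..<m}" "j \<in> {..<m}" "w i = w j" "i \<noteq> j"
      then have "(\<Prod>j\<in>{..<m} - {i}. (w i - x j) * (w i - w j)) = 0" by (intro prod_zero) auto
      then have "e w = 0" using ij by (auto simp: e_def intro!: prod_zero)
      then show False using \<open>e w \<noteq> 0\<close> by simp
    qed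
    have "inj_on h {..<m}"
      using injw by (auto simp: inj_on_def w_def)
    moreover have "h ` {..<m} \<subseteq> {..<m}" using h(1) by auto
    ultimately have hm: "h ` {..<m} = {..<m}" by (simp add: endo_inj_surj)
    have "w ` {..<m} = y t ` h ` {..<m}" by (auto simp: w_def)
    also have "\<dots> = {z. poly (M t) z = 0}" unfolding hm y by (auto simp: poly_prod)
    finally have "w ` {..<m} = {z. poly (M t) z = 0}" .
    moreover have "w \<in> distinct_tuples m" using injw by (auto simp: distinct_tuples_def affine_space_def w_def)
    ultimately show ?thesis using \<open>f w \<noteq> 0\<close> by blast
  qed
  ultimately show ?thesis by blast
qed


section \<open>A family of closed sets of classes\<close>

text \<open>
  Its coefficients are, up to sign, the elementary symmetric functions of \<open>A\<close> translated by \<open>- a\<close>. They are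
  homogeneous under affine maps.
\<close>

definition centred :: "'k::comm_ring_1 set \<Rightarrow> 'k \<Rightarrow> 'k poly"
  where "centred A a = (\<Prod>c\<in>A. [:a - c, 1:])"

lemma coeff_prod_linear_scale:
  fixes e :: "'i \<Rightarrow> 'k::field"
  assumes "finite A" "\<alpha> \<noteq> 0" "l \<le> card A"
  shows "coeff (\<Prod>c\<in>A. [:\<alpha> * e c, 1:]) (card A - l) = \<alpha> ^ l * coeff (\<Prod>c\<in>A. [:e c, 1:]) (card A - l)"
proof -
  have "(\<Prod>c\<in>A. [:\<alpha> * e c, 1:]) = (\<Prod>c\<in>A. [:\<alpha>:] * ([:e c, 1:] \<circ>\<^sub>p [:0, 1 / \<alpha>:]))"
    using assms(2) by (intro prod.cong) (auto simp: pcompose_pCons)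
  also have "\<dots> = smult (\<alpha> ^ card A) ((\<Prod>c\<in>A. [:e c, 1:]) \<circ>\<^sub>p [:0, 1 / \<alpha>:])"
    unfolding prod.distrib pcompose_prod using assms(1) by (simp add: poly_const_pow)
  finally show ?thesis
    using assms(2,3) by (simp add: coeff_pcompose_linear power_divide field_simps flip: power_add)
qed

lemma centred_affine:
  fixes A :: "'k::field set"
  assumes "finite A" "\<alpha> \<noteq> 0" "l \<le> card A"
  shows "coeff (centred ((\<lambda>z. \<alpha> * z + \<beta>) ` A) (\<alpha> * a + \<beta>)) (card A - l) = \<alpha> ^ l * coeff (centred A a) (card A - l)"
proof -
  have "centred ((\<lambda>z. \<alpha> * z + \<beta>) ` A) (\<alpha> * a + \<beta>) = (\<Prod>c\<in>A. [:\<alpha> * (a - c), 1:])"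
    unfolding centred_def using assms(2) by (subst prod.reindex) (auto simp: inj_on_def algebra_simps)
  then show ?thesis unfolding centred_def by (simp only: coeff_prod_linear_scale[OF assms])
qed

lemma monic_eq_prod_roots:
  fixes p :: "'k::field poly"
  assumes "lead_coeff p = 1" "degree p = card A" "finite A" "\<And>z. z \<in> A \<Longrightarrow> poly p z = 0"
  shows "p = (\<Prod>z\<in>A. [:- z, 1:])"
proof -
  define W where "W = (\<Prod>z\<in>A. [:- z, 1:])"
  have "(\<Prod>z\<in>A. [:- id z, 1:] ^ 1) dvd p"
    by (rule prod_linear_powers_dvd) (use assms in \<open>auto simp: poly_eq_0_iff_dvd\<close>)
  then have "W dvd p" by (simp add: W_def)
  then obtain q where q: "p = W * q" by (elim dvdE)
  have W: "degree W = card A" "lead_coeff W = 1"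
    unfolding W_def by (subst degree_prod_sum_eq) (auto simp: lead_coeff_prod)
  have "p \<noteq> 0" using assms(1) by auto
  then have "degree q = 0" using q W assms(2) by (auto simp: degree_mult_eq)
  then obtain c where c: "q = [:c:]" by (auto elim: degree_eq_zeroE)
  have "lead_coeff p = lead_coeff W * lead_coeff q" unfolding q by (rule lead_coeff_mult)
  then have "c = 1" using assms(1) W(2) c by simp
  then show ?thesis using q c by (simp add: W_def)
qed

text \<open>
  The classes of sets with a point about which their first \<open>L\<close> elementary symmetric functions vanish. By
  homogeneity this does not depend on the representative.
\<close>

definition flat_classes :: "nat \<Rightarrow> nat \<Rightarrow> 'k::comm_ring_1 set set set"
  where "flat_classes m L = poly_class ` {A \<in> n_sets m. \<exists>a\<in>A. \<forall>l\<in>{1..L}. coeff (centred A a) (m - l) = 0}"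

lemma flat_classes_iff:
  fixes A :: "'k::{alg_closed_field, field_char_0} set"
  assumes m: "m \<ge> 2" and A: "A \<in> n_sets m" and L: "L \<le> m"
  shows "poly_class A \<in> flat_classes m L \<longleftrightarrow> (\<exists>a\<in>A. \<forall>l\<in>{1..L}. coeff (centred A a) (m - l) = 0)"
proof
  assume "poly_class A \<in> flat_classes m L"
  then obtain A' a where A': "A' \<in> n_sets m" "poly_class A = poly_class A'" "a \<in> A'"
    "\<forall>l\<in>{1..L}. coeff (centred A' a) (m - l) = 0" by (auto simp: flat_classes_def)
  then have "A' \<le>\<^sub>p A" by (simp add: poly_class_eq_iff poly_equiv_def)
  then obtain \<alpha> \<beta> where ab: "\<alpha> \<noteq> 0" "A = (\<lambda>z. \<alpha> * z + \<beta>) ` A'"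
    using affine_of_poly_red[OF A'(1) A m] by blast
  have fin: "finite A'" "card A' = m" using A'(1) by (auto simp: n_sets_def)
  have "coeff (centred A (\<alpha> * a + \<beta>)) (m - l) = 0" if "l \<in> {1..L}" for l
    using centred_affine[OF fin(1) ab(1), of l \<beta> a] A'(4) that L fin(2) by (simp add: ab(2))
  moreover have "\<alpha> * a + \<beta> \<in> A" using ab(2) A'(3) by auto
  ultimately show "\<exists>a\<in>A. \<forall>l\<in>{1..L}. coeff (centred A a) (m - l) = 0" by blast
qed (use A in \<open>auto simp: flat_classes_def\<close>)

lemma closedin_flat_classes:
  assumes m: "m \<ge> 2" and L: "L \<le> m"
  shows "closedin (n_classes_top m) (flat_classes m L :: 'k::{alg_closed_field, field_char_0} set set set)"
  unfolding closedin_n_classes_top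
proof
  show "flat_classes m L \<subseteq> (n_classes m :: 'k set set set)" by (auto simp: flat_classes_def n_classes_def)
  define c where "c i l x = coeff (\<Prod>j<m. [:x i - x j, 1:]) (m - l)" for i l and x :: "nat \<Rightarrow> 'k"
  define F where "F i = c i ` {1..L}" for i
  have cR: "c i l \<in> polyfuns m" if "i < m" for i l
  proof -
    have "coeffs_in (polyfuns m) (\<lambda>x. \<Prod>j<m. [:- (\<lambda>x. x j - x i) x, 1:] :: 'k poly)"
      using that by (intro coeffs_in_prod coeffs_in_linear_factor fun_algebra_polyfuns polyfunsI polyfuns.coord) auto
    then show ?thesis by (simp add: coeffs_in_def c_def[abs_def])
  qed
  have "{x \<in> distinct_tuples m. tuple_class m x \<in> flat_classes m L} = (\<Union>i\<in>{..<m}. {x \<in> distinct_tuples m. \<forall>f\<in>F i. f x = 0})"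
  proof (rule set_eqI)
    fix x :: "nat \<Rightarrow> 'k"
    show "x \<in> {x \<in> distinct_tuples m. tuple_class m x \<in> flat_classes m L} \<longleftrightarrow> x \<in> (\<Union>i\<in>{..<m}. {x \<in> distinct_tuples m. \<forall>f\<in>F i. f x = 0})"
    proof (cases "x \<in> distinct_tuples m")
      case x: True
      have inj: "inj_on x {..<m}" using x by (simp add: distinct_tuples_def)
      have cen: "centred (x ` {..<m}) a = (\<Prod>j<m. [:a - x j, 1:])" for a
        unfolding centred_def by (subst prod.reindex[OF inj]) simp
      show ?thesis
        using x flat_classes_iff[OF m distinct_tuple_n_set[OF x] L]
        by (simp add: tuple_class_def F_def c_def cen)
    qed auto
  qed
  moreover have "\<exists>F'\<subseteq>polyfuns m. (\<Union>i\<in>{..<m}. {x \<in> distinct_tuples m. \<forall>f\<in>F i. f x = 0}) = {x \<in> distinct_tuples m. \<forall>f\<in>F'. f x = (0 :: 'k)}"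
    using cR by (intro polyfuns_zero_finite_union[OF m] distinct_tuples_subset) (auto simp: F_def)
  ultimately show "\<exists>F'\<subseteq>polyfuns m. {x \<in> distinct_tuples m. tuple_class m x \<in> flat_classes m L} = {x \<in> distinct_tuples m. \<forall>f\<in>F'. f x = (0 :: 'k)}"
    by simp
qed

lemma closedin_singleton_class:
  fixes \<Xi> :: "'k::{alg_closed_field, field_char_0} set set"
  assumes m: "m \<ge> 2" and \<Xi>: "\<Xi> \<in> n_classes m"
  shows "closedin (n_classes_top m) {\<Xi>}"
proof -
  obtain y where y: "y \<in> slice m" "tuple_class m y = \<Xi>" using slice_class_surj[OF m \<Xi>] by blast
  define F where "F = (\<lambda>i x. x i - y i) ` {..<m}"
  have "F \<subseteq> polyfuns m" unfolding F_def by (auto intro!: polyfunsI polyfuns.coord polyfuns.const)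
  moreover have "{x \<in> slice m. \<forall>f\<in>F. f x = 0} = {y}"
  proof (intro equalityI subsetI)
    fix x assume x: "x \<in> {x \<in> slice m. \<forall>f\<in>F. f x = 0}"
    then have "x \<in> {..<m} \<rightarrow>\<^sub>E UNIV" "y \<in> {..<m} \<rightarrow>\<^sub>E UNIV" "\<forall>i<m. x i = y i"
      using y by (auto simp: slice_def distinct_tuples_def affine_space_def F_def)
    then have "x = y" by (intro PiE_ext) auto
    then show "x \<in> {y}" by simp
  qed (use y in \<open>auto simp: F_def\<close>)
  ultimately show ?thesis using closed_slice_image[OF m, of F] y(2) by simp
qed

lemma irreducible_closed_closure_of:
  assumes "\<Phi> \<subseteq> topspace X" "\<Phi> \<noteq> {}"
    and irr: "\<And>K L. closedin X K \<Longrightarrow> closedin X L \<Longrightarrow> \<Phi> \<subseteq> K \<union> L \<Longrightarrow> \<Phi> \<subseteq> K \<or> \<Phi> \<subseteq> L"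
  shows "irreducible_closed X (X closure_of \<Phi>)"
  unfolding irreducible_closed_def
proof (intro conjI allI impI)
  show "closedin X (X closure_of \<Phi>)" by simp
  have sub: "\<Phi> \<subseteq> X closure_of \<Phi>" using assms(1) by (rule closure_of_subset)
  then show "X closure_of \<Phi> \<noteq> {}" using assms(2) by blast
  fix K L assume KL: "closedin X K \<and> closedin X L \<and> X closure_of \<Phi> = K \<union> L"
  then have "\<Phi> \<subseteq> K \<or> \<Phi> \<subseteq> L" using irr[of K L] sub by auto
  then have "X closure_of \<Phi> \<subseteq> K \<or> X closure_of \<Phi> \<subseteq> L" 
    using closure_of_minimal[of \<Phi> K X] closure_of_minimal[of \<Phi> L X] KL by blast
  then show "X closure_of \<Phi> = K \<or> X closure_of \<Phi> = L" using KL by auto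
qed

text \<open>
  \<open>p \<equiv> 1 + c X\<^sup>L\<close> modulo \<open>X\<^bsup>L + 1\<^esup>\<close>. Applied to reflected polynomials, this compares the highest coefficients
  of products.
\<close>

definition starts_with :: "nat \<Rightarrow> 'k::comm_ring_1 \<Rightarrow> 'k poly \<Rightarrow> bool"
  where "starts_with L c p \<longleftrightarrow> coeff p 0 = 1 \<and> (\<forall>l. 0 < l \<and> l < L \<longrightarrow> coeff p l = 0) \<and> coeff p L = c"

lemma starts_with_cong:
  assumes "\<And>l. l \<le> L \<Longrightarrow> coeff p l = coeff q l" "starts_with L c q"
  shows "starts_with L c p"
  using assms by (simp add: starts_with_def)

lemma starts_with_mult:
  assumes L: "L > 0" and p: "starts_with L c p" and q: "starts_with L c' q"
  shows "starts_with L (c + c') (p * q)"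
proof -
  have co: "coeff (p * q) l = coeff p l + coeff q l" if "0 < l" "l \<le> L" for l
  proof -
    have "coeff (p * q) l = (\<Sum>j\<in>{0, l}. coeff p j * coeff q (l - j))"
      unfolding coeff_mult using p that by (intro sum.mono_neutral_right) (auto simp: starts_with_def)
    then show ?thesis using that p q by (simp add: starts_with_def)
  qed
  then show ?thesis using L p q by (simp add: starts_with_def coeff_mult_0)
qed

lemma starts_with_prod:
  assumes L: "L > 0" and "finite I" "\<And>i. i \<in> I \<Longrightarrow> starts_with L (c i) (p i)"
  shows "starts_with L (\<Sum>i\<in>I. c i) (\<Prod>i\<in>I. p i)"
  using assms(2,3)
proof (induction I rule: finite_induct)
  case empty
  then show ?case using L by (simp add: starts_with_def)
next
  case (insert i I)
  have "starts_with L (c i) (p i)" by (rule insert.prems) simp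
  moreover have "starts_with L (sum c I) (prod p I)" by (rule insert.IH) (rule insert.prems, simp)
  ultimately show ?case
    unfolding sum.insert[OF insert.hyps(1,2)] prod.insert[OF insert.hyps(1,2)] by (rule starts_with_mult[OF L])
qed


section \<open>Polynomials ramified at one point\<close>

text \<open>
  The value \<open>b0\<close> is taken at \<open>0\<close> with multiplicity at least \<open>r + 1\<close>, and elsewhere at the nonzero roots of \<open>Q\<close>.
\<close>

definition ramified :: "nat \<Rightarrow> 'k::comm_ring_1 \<Rightarrow> 'k poly \<Rightarrow> 'k poly"
  where "ramified r b0 Q = [:b0:] + monom 1 (Suc r) * Q"

text \<open>
  The product of the polynomials \<open>ramified r b0 Q - b\<close> with \<open>b \<in> B\<close>, divided by \<open>X\<^sup>r\<close>. Its roots are the points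
  over \<open>B\<close>, each of them simple if there are as many as its degree.
\<close>

definition fibre_union_poly :: "nat \<Rightarrow> 'k::comm_ring_1 set \<Rightarrow> 'k \<Rightarrow> 'k poly \<Rightarrow> 'k poly"
  where "fibre_union_poly r B b0 Q = [:0, 1:] * Q * (\<Prod>b\<in>B - {b0}. [:b0 - b:] + monom 1 (Suc r) * Q)"

definition monic_of_degree :: "nat \<Rightarrow> 'k::comm_ring_1 poly \<Rightarrow> bool"
  where "monic_of_degree N Q \<longleftrightarrow> coeff Q N = 1 \<and> (\<forall>j>N. coeff Q j = 0)"

lemma monic_of_degreeD:
  fixes Q :: "'k::idom poly"
  assumes "monic_of_degree N Q"
  shows "degree Q = N" "lead_coeff Q = 1" "Q \<noteq> 0"
proof -
  show "degree Q = N"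
    using assms by (intro antisym degree_le le_degree) (auto simp: monic_of_degree_def)
  then show "lead_coeff Q = 1" "Q \<noteq> 0" using assms by (auto simp: monic_of_degree_def)
qed

lemma ex_nonroot:
  fixes p :: "'k::{idom, ring_char_0} poly"
  assumes "p \<noteq> 0"
  shows "\<exists>t. poly p t \<noteq> 0"
proof -
  have "{t. poly p t = 0} \<noteq> UNIV" using poly_roots_finite[OF assms] infinite_UNIV_char_0 by metis
  then show ?thesis by blast
qed

text \<open>
  All roots have order \<open>1\<close>, and the orders add up to the degree.
\<close>

lemma card_roots_squarefree:
  fixes p :: "'k::{alg_closed_field, field_char_0} poly"
  assumes "p \<noteq> 0" "\<And>z. poly p z = 0 \<Longrightarrow> poly (pderiv p) z \<noteq> 0"
  shows "card {z. poly p z = 0} = degree p"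
proof -
  have "rsquarefree p" using assms(2) by (auto simp: rsquarefree_roots)
  then have "order z p = 1" if "poly p z = 0" for z
  proof -
    have "order z p = 0 \<or> order z p = 1" using \<open>rsquarefree p\<close> by (simp add: rsquarefree_def)
    moreover have "order z p \<noteq> 0" using that assms(1) by (simp add: order_eq_0_iff)
    ultimately show ?thesis by blast
  qed
  then have "(\<Sum>z | poly p z = 0. order z p) = (\<Sum>z | poly p z = 0. 1)" by (intro sum.cong) auto
  then show ?thesis using sum_order_eq_degree[OF assms(1)] by simp
qed

text \<open>
  Here \<open>d\<close> is the degree of the polynomials, \<open>r\<close> their ramification over \<open>B\<close>, \<open>N\<close> the degree of \<open>Q\<close>, and \<open>m\<close> the
  number of points over \<open>B\<close>.
\<close>

context
  fixes B :: "'k::{alg_closed_field, field_char_0} set" and b0 :: 'k and n r N d m :: nat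
  assumes B: "finite B" "b0 \<in> B" "card B = n" and n: "n \<ge> 2"
    and d: "d = Suc r + N" and m: "m + r = n * d"
begin

lemma parameter_bounds: "d \<ge> 1" "m = 1 + N + (n - 1) * d" "m \<ge> 2" "m > N" "n < m \<or> d = 1" "N < m - 1"
proof -
  show d1: "d \<ge> 1" using d by simp
  have "n * d = d + (n - 1) * d" using n by (cases n) auto
  then show m1: "m = 1 + N + (n - 1) * d" using m d by linarith
  have "(n - 1) * d \<ge> 1 * 1" using n d1 by (intro mult_mono) auto
  then show "m \<ge> 2" "m > N" "N < m - 1" using m1 by linarith+
  show "n < m \<or> d = 1"
  proof (cases "d = 1")
    case False
    then have "(n - 1) * d \<ge> (n - 1) * 2" using d1 by (intro mult_mono) auto
    then show ?thesis using m1 n by linarith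
  qed simp
qed

definition good :: "'k poly \<Rightarrow> bool"
  where "good Q \<longleftrightarrow> monic_of_degree N Q \<and> poly (ramified r b0 Q) -` B \<in> n_sets m"

abbreviation fib :: "'k poly \<Rightarrow> 'k set"
  where "fib Q \<equiv> poly (ramified r b0 Q) -` B"

lemma fib_eq_roots: "fib Q = {z. poly (fibre_union_poly r B b0 Q) z = 0}"
proof (rule set_eqI)
  fix z
  have "z \<in> fib Q \<longleftrightarrow> (\<exists>b\<in>B. b0 + z ^ Suc r * poly Q z = b)"
    by (simp add: ramified_def poly_monom)
  also have "\<dots> \<longleftrightarrow> (z ^ Suc r * poly Q z = 0 \<or> (\<exists>b\<in>B - {b0}. b0 - b + z ^ Suc r * poly Q z = 0))"
    using B(2) by (auto simp: algebra_simps)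
  also have "\<dots> \<longleftrightarrow> z \<in> {z. poly (fibre_union_poly r B b0 Q) z = 0}"
    using B(1) by (auto simp: fibre_union_poly_def poly_prod poly_monom)
  finally show "z \<in> fib Q \<longleftrightarrow> z \<in> {z. poly (fibre_union_poly r B b0 Q) z = 0}" .
qed

lemma monic_shifted:
  assumes "monic_of_degree N Q"
  shows "monic_of_degree d ([:c:] + monom 1 (Suc r) * Q)"
  using assms unfolding monic_of_degree_def d
  by (auto simp: coeff_monom_mult coeff_pCons split: nat.split)

lemma fibre_union_monic:
  assumes Q: "monic_of_degree N Q"
  shows "degree (fibre_union_poly r B b0 Q) = m" "lead_coeff (fibre_union_poly r B b0 Q) = 1"
proof -
  note Q' = monic_of_degreeD[OF Q] and F = monic_of_degreeD[OF monic_shifted[OF Q]]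
  have nz: "(\<Prod>b\<in>B - {b0}. [:b0 - b:] + monom 1 (Suc r) * Q) \<noteq> 0" using F(3) B(1) by simp
  have "degree (\<Prod>b\<in>B - {b0}. [:b0 - b:] + monom 1 (Suc r) * Q) = (\<Sum>b\<in>B - {b0}. d)"
    using F by (subst degree_prod_sum_eq) auto
  moreover have "card (B - {b0}) = n - 1" using B by simp
  ultimately have "degree (\<Prod>b\<in>B - {b0}. [:b0 - b:] + monom 1 (Suc r) * Q) = (n - 1) * d" by simp
  then show "degree (fibre_union_poly r B b0 Q) = m"
    unfolding fibre_union_poly_def parameter_bounds(2) using nz Q' by (simp add: degree_mult_eq del: mult_pCons_left)
  show "lead_coeff (fibre_union_poly r B b0 Q) = 1"
    unfolding fibre_union_poly_def lead_coeff_mult lead_coeff_prod Q'(2) F(2) by simp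
qed

lemma goodD:
  assumes "good Q"
  shows "monic_of_degree N Q" "fib Q \<in> n_sets m" "finite (fib Q)" "card (fib Q) = m"
    "fibre_union_poly r B b0 Q = (\<Prod>z\<in>fib Q. [:- z, 1:])" "0 \<in> fib Q"
proof -
  show Q: "monic_of_degree N Q" "fib Q \<in> n_sets m" using assms by (auto simp: good_def)
  then show f: "finite (fib Q)" "card (fib Q) = m" by (auto simp: n_sets_def)
  show "fibre_union_poly r B b0 Q = (\<Prod>z\<in>fib Q. [:- z, 1:])"
    using fibre_union_monic[OF Q(1)] f fib_eq_roots[of Q] by (intro monic_eq_prod_roots) auto
  show "0 \<in> fib Q" unfolding fib_eq_roots by (simp add: fibre_union_poly_def)
qed

text \<open>
  On a line of polynomials through a good one all but finitely many are good, and an open condition on the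
  points over \<open>B\<close> remains valid for some arrangement of them.
\<close>

lemma generic_good:
  assumes Q: "\<And>t. monic_of_degree N (Q + smult t R)" and s: "good (Q + smult s R)"
    and x: "x \<in> distinct_tuples m" "x ` {..<m} = fib (Q + smult s R)" and f: "f \<in> polyfuns m" "f x \<noteq> 0"
  shows "\<exists>g. g \<noteq> 0 \<and> (\<forall>t. poly g t \<noteq> 0 \<longrightarrow> good (Q + smult t R) \<and>
    (\<exists>w\<in>distinct_tuples m. w ` {..<m} = fib (Q + smult t R) \<and> f w \<noteq> 0))"
proof -
  note A = fun_algebra_univariate
  define M where "M t = fibre_union_poly r B b0 (Q + smult t R)" for t
  have id: "coeffs_in univariate (\<lambda>t. [:t:])"
    by (rule coeffs_in_singleton[OF A univariate_id])
  have "coeffs_in univariate (\<lambda>t. Q + [:t:] * R)"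
    by (intro coeffs_in_add[OF A] coeffs_in_mult[OF A] coeffs_in_const[OF A] id)
  then have L: "coeffs_in univariate (\<lambda>t. Q + smult t R)" by simp
  have M: "coeffs_in univariate M"
    unfolding M_def[abs_def] fibre_union_poly_def
    by (intro coeffs_in_mult[OF A] coeffs_in_prod[OF A] coeffs_in_add[OF A] coeffs_in_const[OF A] L)
  have monic: "lead_coeff (M t) = 1" "degree (M t) = m" for t
    using fibre_union_monic[OF Q[of t]] by (simp_all add: M_def)
  have inj: "inj_on x {..<m}" using x(1) by (simp add: distinct_tuples_def)
  have "M s = (\<Prod>j<m. [:- x j, 1:])"
    unfolding M_def goodD(5)[OF s] x(2)[symmetric] by (subst prod.reindex[OF inj]) simp
  from generic_root_tuples[OF M monic x(1) this f] obtain g where g: "g \<noteq> 0"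
    "\<forall>t. poly g t \<noteq> 0 \<longrightarrow> (\<exists>w\<in>distinct_tuples m. w ` {..<m} = {z. poly (M t) z = 0} \<and> f w \<noteq> 0)" by blast
  have "good (Q + smult t R) \<and> (\<exists>w\<in>distinct_tuples m. w ` {..<m} = fib (Q + smult t R) \<and> f w \<noteq> 0)"
    if "poly g t \<noteq> 0" for t
  proof -
    have "\<exists>w\<in>distinct_tuples m. w ` {..<m} = {z. poly (M t) z = 0} \<and> f w \<noteq> 0" using g(2) that by blast
    then obtain w where w: "w \<in> distinct_tuples m" "w ` {..<m} = {z. poly (M t) z = 0}" "f w \<noteq> 0" by blast
    have e: "w ` {..<m} = fib (Q + smult t R)" unfolding fib_eq_roots w(2) M_def ..
    then have "fib (Q + smult t R) \<in> n_sets m" using distinct_tuple_n_set[OF w(1)] by simp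
    then show ?thesis using Q w e by (auto simp: good_def)
  qed
  then show ?thesis using g(1) by blast
qed

lemma generic_good':
  assumes Q: "\<And>t. monic_of_degree N (Q + smult t R)" and s: "good (Q + smult s R)"
  shows "\<exists>g. g \<noteq> 0 \<and> (\<forall>t. poly g t \<noteq> 0 \<longrightarrow> good (Q + smult t R))"
proof -
  obtain x where x: "x \<in> distinct_tuples m" "x ` {..<m} = fib (Q + smult s R)"
    using n_set_distinct_tuple[OF goodD(2)[OF s]] .
  have "(\<lambda>_. 1) \<in> polyfuns m" by (rule polyfuns.const)
  from generic_good[OF Q s x this] show ?thesis by auto
qed

definition line_closed :: "'k poly set \<Rightarrow> bool"
  where "line_closed \<Q> \<longleftrightarrow> (\<forall>Q\<in>\<Q>. \<forall>Q'\<in>\<Q>. \<forall>t. Q + smult t (Q' - Q) \<in> \<Q>) \<and> (\<forall>Q\<in>\<Q>. monic_of_degree N Q)"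

definition family_classes :: "'k poly set \<Rightarrow> 'k set set set"
  where "family_classes \<Q> = {poly_class (fib Q) | Q. Q \<in> \<Q> \<and> good Q}"

lemma family_classes_below: "family_classes \<Q> \<subseteq> classes_below m (poly_class B)"
proof -
  have "poly_class (fib Q) \<le>\<^sub>c poly_class B" for Q
    unfolding class_red_poly_class poly_red_def by blast
  then show ?thesis
    by (auto simp: family_classes_def classes_below_def n_classes_def good_def)
qed

text \<open>
  If the classes of \<open>Q0\<close> and \<open>Q1\<close> lie outside \<open>K\<close> and \<open>L\<close>, then so do, for each of these closed sets, the classes of
  all but finitely many polynomials on the line through \<open>Q0\<close> and \<open>Q1\<close>; some class lies outside both.
\<close>

lemma family_irreducible:
  assumes \<Q>: "line_closed \<Q>"
    and K: "closedin (n_classes_top m) K" and L: "closedin (n_classes_top m) L"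
    and sub: "family_classes \<Q> \<subseteq> K \<union> L"
  shows "family_classes \<Q> \<subseteq> K \<or> family_classes \<Q> \<subseteq> L"
proof (rule ccontr)
  assume "\<not> ?thesis"
  then obtain Q0 Q1 where Q: "Q0 \<in> \<Q>" "good Q0" "poly_class (fib Q0) \<notin> K" "Q1 \<in> \<Q>" "good Q1" "poly_class (fib Q1) \<notin> L"
    unfolding family_classes_def by blast
  define R where "R = Q1 - Q0"
  have line: "Q0 + smult t R \<in> \<Q>" for t using \<Q> Q by (auto simp: line_closed_def R_def)
  have monic: "monic_of_degree N (Q0 + smult t R)" for t using line \<Q> by (auto simp: line_closed_def)
  have ends: "Q0 + smult 0 R = Q0" "Q0 + smult 1 R = Q1" by (simp_all add: R_def)
  have one: "\<exists>g. g \<noteq> 0 \<and> (\<forall>t. poly g t \<noteq> 0 \<longrightarrow> good (Q0 + smult t R) \<and> poly_class (fib (Q0 + smult t R)) \<notin> K)"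
    if K: "closedin (n_classes_top m) K" and s: "good (Q0 + smult s R)" "poly_class (fib (Q0 + smult s R)) \<notin> K" for K s
  proof -
    obtain F where F: "F \<subseteq> polyfuns m" "{x \<in> distinct_tuples m. tuple_class m x \<in> K} = {x \<in> distinct_tuples m. \<forall>f\<in>F. f x = 0}"
      using K[unfolded closedin_n_classes_top, THEN conjunct2] by (elim exE conjE) (rule that)
    obtain x where x: "x \<in> distinct_tuples m" "x ` {..<m} = fib (Q0 + smult s R)"
      using n_set_distinct_tuple[OF goodD(2)[OF s(1)]] .
    then have "tuple_class m x \<notin> K" using s(2) by (simp add: tuple_class_def)
    then have "x \<notin> {x \<in> distinct_tuples m. \<forall>f\<in>F. f x = 0}" using F(2) by blast
    then obtain f where f: "f \<in> F" "f x \<noteq> 0" using x(1) by blast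
    then have "f \<in> polyfuns m" using F(1) by blast
    from generic_good[OF monic s(1) x this f(2)] obtain g where g: "g \<noteq> 0"
      "\<forall>t. poly g t \<noteq> 0 \<longrightarrow> good (Q0 + smult t R) \<and> (\<exists>w\<in>distinct_tuples m. w ` {..<m} = fib (Q0 + smult t R) \<and> f w \<noteq> 0)"
      by blast
    have "poly_class (fib (Q0 + smult t R)) \<notin> K" if "poly g t \<noteq> 0" for t
    proof -
      have "\<exists>w\<in>distinct_tuples m. w ` {..<m} = fib (Q0 + smult t R) \<and> f w \<noteq> 0" using g(2) that by blast
      then obtain w where w: "w \<in> distinct_tuples m" "w ` {..<m} = fib (Q0 + smult t R)" "f w \<noteq> 0" by blast
      then have "w \<notin> {x \<in> distinct_tuples m. \<forall>f\<in>F. f x = 0}" using f(1) by blast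
      then have "tuple_class m w \<notin> K" using F(2) w(1) by blast
      then show ?thesis using w(2) by (simp add: tuple_class_def)
    qed
    then show ?thesis using g by blast
  qed
  obtain g0 where g0: "g0 \<noteq> 0" "\<forall>t. poly g0 t \<noteq> 0 \<longrightarrow> good (Q0 + smult t R) \<and> poly_class (fib (Q0 + smult t R)) \<notin> K"
    using one[OF K, of 0] Q(2,3) unfolding ends by blast
  obtain g1 where g1: "g1 \<noteq> 0" "\<forall>t. poly g1 t \<noteq> 0 \<longrightarrow> good (Q0 + smult t R) \<and> poly_class (fib (Q0 + smult t R)) \<notin> L"
    using one[OF L, of 1] Q(5,6) unfolding ends by blast
  have "g0 * g1 \<noteq> 0" using g0(1) g1(1) by simp
  then obtain t where "poly (g0 * g1) t \<noteq> 0" using ex_nonroot by blast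
  then have t: "poly g0 t \<noteq> 0" "poly g1 t \<noteq> 0" by auto
  then have "poly_class (fib (Q0 + smult t R)) \<in> family_classes \<Q>" using g0(2) line by (auto simp: family_classes_def)
  then show False using sub g0(2) g1(2) t by blast
qed

text \<open>
  Over \<open>b0\<close> lie \<open>0\<close> and the \<open>N\<close> roots of \<open>Q\<close>, and over each of the other \<open>n - 1\<close> points of \<open>B\<close> there are \<open>d\<close> points.
\<close>

lemma good_of_simple_fibres:
  assumes Q: "monic_of_degree N Q" "poly Q 0 \<noteq> 0" "\<And>z. poly Q z = 0 \<Longrightarrow> poly (pderiv Q) z \<noteq> 0"
    and simple: "\<And>z. poly (ramified r b0 Q) z \<in> B - {b0} \<Longrightarrow> poly (pderiv (ramified r b0 Q)) z \<noteq> 0"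
  shows "good Q"
proof -
  define P where "P = ramified r b0 Q"
  have Pm: "monic_of_degree d (P - [:b:])" for b
  proof -
    have "P - [:b:] = [:b0 - b:] + monom 1 (Suc r) * Q" by (simp add: P_def ramified_def)
    then show ?thesis using monic_shifted[OF Q(1)] by metis
  qed
  have degP: "degree P = d" using monic_of_degreeD(1)[OF Pm[of 0]] by simp
  have cb: "card {z. poly P z = b} = d" if b: "b \<in> B - {b0}" for b
  proof -
    have "poly (pderiv (P - [:b:])) z \<noteq> 0" if "poly (P - [:b:]) z = 0" for z
      using simple[of z] that b by (simp add: P_def pderiv_diff pderiv_pCons)
    then show ?thesis
      using card_roots_squarefree[of "P - [:b:]"] monic_of_degreeD[OF Pm[of b]] by simp
  qed
  have "card {z. poly Q z = 0} = N"
    using card_roots_squarefree[of Q] Q(3) monic_of_degreeD[OF Q(1)] by simp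
  moreover have "{z. poly P z = b0} = insert 0 {z. poly Q z = 0}"
    by (auto simp: P_def ramified_def poly_monom)
  moreover have "finite {z. poly Q z = 0}" using poly_roots_finite monic_of_degreeD(3)[OF Q(1)] by blast
  ultimately have cb0: "card {z. poly P z = b0} = N + 1" using Q(2) by simp
  have fin: "finite (fib Q)"
    unfolding P_def[symmetric] using finite_preimage_poly[of P B] degP parameter_bounds(1) B(1) by simp
  have "card (fib Q) = (\<Sum>z\<in>poly P -` B. 1)" unfolding P_def by simp
  also have "\<dots> = (\<Sum>b\<in>B. card {z. poly P z = b})"
    using preimage_poly_sum[of P B "\<lambda>_. 1::nat"] degP parameter_bounds(1) B(1) by simp
  also have "\<dots> = card {z. poly P z = b0} + (\<Sum>b\<in>B - {b0}. card {z. poly P z = b})"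
    by (rule sum.remove[OF B(1,2)])
  also have "\<dots> = N + 1 + (n - 1) * d" using cb cb0 B by simp
  finally have "card (fib Q) = m" using parameter_bounds(2) by simp
  then show ?thesis using Q(1) fin by (simp add: good_def n_sets_def)
qed

text \<open>
  A critical point \<open>z \<noteq> 0\<close> of \<open>P = b0 + X\<^bsup>r + 1\<^esup> (X\<^sup>N + q)\<close> satisfies \<open>d z\<^sup>N = - (r + 1) q\<close>, and its value satisfies
  \<open>(P(z) - b0)\<^sup>N = \<kappa> q\<^sup>d\<close> with a constant \<open>\<kappa> \<noteq> 0\<close>. Only finitely many \<open>q\<close> put such a value into \<open>B\<close>.
\<close>

lemma good_binomial:
  assumes N: "N > 0"
  shows "\<exists>q. good (monom 1 N + [:q:])"
proof -
  define \<kappa> :: 'k where "\<kappa> = (- of_nat (Suc r) / of_nat d) ^ Suc r * (of_nat N / of_nat d) ^ N"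
  have d0: "of_nat d \<noteq> (0::'k)" using parameter_bounds(1) by simp
  have \<kappa>: "\<kappa> \<noteq> 0" using d0 N unfolding \<kappa>_def by (simp del: of_nat_Suc)
  define bad where "bad = insert 0 (\<Union>b\<in>B. {q. poly (monom \<kappa> d - [:(b - b0) ^ N:]) q = 0})"
  have "monom \<kappa> d - [:c:] \<noteq> 0" for c
  proof
    assume "monom \<kappa> d - [:c:] = 0"
    then have "coeff (monom \<kappa> d - [:c:]) d = 0" by simp
    then show False using \<kappa> parameter_bounds(1) by (auto simp: coeff_pCons split: nat.splits)
  qed
  then have "finite {q. poly (monom \<kappa> d - [:c:]) q = 0}" for c by (rule poly_roots_finite)
  then have "finite bad" unfolding bad_def by (intro finite.insertI finite_UN_I B(1))
  then obtain q where q: "q \<notin> bad" using ex_new_if_finite[OF infinite_UNIV_char_0] by blast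
  have q0: "q \<noteq> 0" and qb: "\<And>b. b \<in> B \<Longrightarrow> \<kappa> * q ^ d \<noteq> (b - b0) ^ N" using q by (auto simp: bad_def poly_monom)
  define Q where "Q = monom 1 N + [:q:]"
  define P where "P = ramified r b0 Q"
  have P: "poly P z = b0 + z ^ Suc r * (z ^ N + q)" for z by (simp add: P_def ramified_def Q_def poly_monom)
  have P': "poly (pderiv P) z = z ^ r * (of_nat d * z ^ N + of_nat (Suc r) * q)" for z
  proof -
    obtain N' where N': "N = Suc N'" using N by (cases N) auto
    have "pderiv P = monom (of_nat (Suc r)) r * Q + monom 1 (Suc r) * monom (of_nat N) (N - 1)"
      unfolding P_def ramified_def Q_def pderiv_add pderiv_mult
      by (simp add: pderiv_monom pderiv_pCons algebra_simps del: of_nat_Suc)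
    then show ?thesis
      by (simp add: Q_def poly_monom d N' algebra_simps power_add)
  qed
  have "good Q"
  proof (rule good_of_simple_fibres)
    show "monic_of_degree N Q" using N by (auto simp: Q_def monic_of_degree_def coeff_pCons split: nat.split)
    show "poly Q 0 \<noteq> 0" using q0 N by (simp add: Q_def poly_monom power_0_left)
    show "poly (pderiv Q) z \<noteq> 0" if "poly Q z = 0" for z
    proof -
      have "z ^ N = - q" using that by (simp add: Q_def poly_monom eq_neg_iff_add_eq_0)
      then have "z \<noteq> 0" using q0 N by (auto simp: power_0_left)
      then show ?thesis using N by (simp add: Q_def pderiv_add pderiv_monom poly_monom pderiv_pCons)
    qed
    show "poly (pderiv (ramified r b0 Q)) z \<noteq> 0" if "poly (ramified r b0 Q) z \<in> B - {b0}" for z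
    proof
      assume "poly (pderiv (ramified r b0 Q)) z = 0"
      then have c: "z ^ r * (of_nat d * z ^ N + of_nat (Suc r) * q) = 0" using P' by (simp add: P_def)
      define b where "b = poly P z"
      have b: "b \<in> B" "b \<noteq> b0" using that by (auto simp: b_def P_def)
      have zb: "z ^ Suc r * (z ^ N + q) = b - b0" using P[of z] by (simp add: b_def)
      have "z \<noteq> 0" using zb b(2) by auto
      then have "of_nat d * z ^ N + of_nat (Suc r) * q = 0" using c by simp
      then have zN: "z ^ N = (- of_nat (Suc r) / of_nat d) * q" using d0
        by (simp add: field_simps eq_neg_iff_add_eq_0)
      have "z ^ N + q = (of_nat N / of_nat d) * q"
        unfolding zN using d0 d by (simp add: field_simps)
      moreover have "(z ^ Suc r) ^ N = (z ^ N) ^ Suc r" by (simp only: power_mult[symmetric] mult.commute)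
      ultimately have "(z ^ Suc r * (z ^ N + q)) ^ N = (z ^ N) ^ Suc r * ((of_nat N / of_nat d) * q) ^ N"
        by (simp only: power_mult_distrib)
      also have "\<dots> = \<kappa> * q ^ d"
        unfolding zN \<kappa>_def power_mult_distrib d power_add by (simp add: mult_ac del: power_Suc of_nat_Suc)
      finally show False using qb[OF b(1)] zb by simp
    qed
  qed
  then show ?thesis unfolding Q_def by blast
qed

lemma good_power:
  assumes N: "N = 0"
  shows "good 1"
proof (rule good_of_simple_fibres)
  show "monic_of_degree N (1 :: 'k poly)" using N by (auto simp: monic_of_degree_def)
  show "poly (pderiv (ramified r b0 1)) z \<noteq> 0" if "poly (ramified r b0 1) z \<in> B - {b0}" for z
  proof -
    have "z \<noteq> 0" using that by (auto simp: ramified_def poly_monom)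
    then show ?thesis by (simp add: ramified_def pderiv_add pderiv_monom pderiv_pCons poly_monom del: of_nat_Suc)
  qed
qed simp_all

definition sub_family :: "nat \<Rightarrow> 'k poly set"
  where "sub_family i = {Q. monic_of_degree N Q \<and> (\<forall>j\<ge>i. j \<noteq> N \<longrightarrow> coeff Q j = 0)}"

lemma line_closed_sub_family: "line_closed (sub_family i)"
  by (auto simp: line_closed_def sub_family_def monic_of_degree_def)

lemma sub_family_mono: "i \<le> j \<Longrightarrow> sub_family i \<subseteq> sub_family j"
  by (auto simp: sub_family_def)

text \<open>
  Each of the \<open>n - 1\<close> factors \<open>b0 - b + X\<^bsup>r + 1\<^esup> Q\<close> and \<open>Q\<close> itself contribute \<open>c\<close>; the constants \<open>b0 - b\<close> lie in
  lower degree, because \<open>L \<le> N < d\<close>.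
\<close>

lemma starts_with_fibre_union:
  assumes Q: "monic_of_degree N Q" and L: "0 < L" "L \<le> N" and s: "starts_with L c (reflect_poly Q)"
  shows "starts_with L (of_nat n * c) (reflect_poly (fibre_union_poly r B b0 Q))"
proof -
  have "starts_with L 0 (reflect_poly [:0, 1 :: 'k:])"
    using L by (auto simp: starts_with_def coeff_reflect_poly coeff_pCons split: nat.split)
  moreover have "starts_with L c (reflect_poly ([:e:] + monom 1 (Suc r) * Q))" for e
  proof -
    have deg: "degree ([:e:] + monom 1 (Suc r) * Q) = d" by (rule monic_of_degreeD(1)[OF monic_shifted[OF Q]])
    have "coeff (reflect_poly ([:e:] + monom 1 (Suc r) * Q)) l = coeff (reflect_poly Q) l" if "l \<le> L" for l
    proof -
      have "d - l = Suc (r + (N - l))" using that L d by simp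
      then show ?thesis
        unfolding coeff_reflect_poly deg monic_of_degreeD(1)[OF Q] using that L d
        by (simp add: coeff_monom_mult)
    qed
    then show ?thesis using s by (rule starts_with_cong)
  qed
  ultimately have "starts_with L (0 + c + (\<Sum>b\<in>B - {b0}. c)) (reflect_poly [:0, 1:] * reflect_poly Q *
      (\<Prod>b\<in>B - {b0}. reflect_poly ([:b0 - b:] + monom 1 (Suc r) * Q)))"
    using L B(1) s by (intro starts_with_mult starts_with_prod) auto
  moreover have "0 + c + (\<Sum>b\<in>B - {b0}. c) = of_nat n * c"
  proof -
    have "card (B - {b0}) = n - 1" using B by simp
    moreover have "of_nat n = (1 :: 'k) + of_nat (n - 1)" using n by (simp add: of_nat_diff)
    ultimately show ?thesis by (simp add: algebra_simps)
  qed
  ultimately show ?thesis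
    unfolding fibre_union_poly_def reflect_poly_mult reflect_poly_prod by (simp only:)
qed

lemma fibre_union_top_coeffs:
  assumes Q: "monic_of_degree N Q" and L: "0 < L" "L \<le> N" and z: "\<And>l. 0 < l \<Longrightarrow> l < L \<Longrightarrow> coeff Q (N - l) = 0"
  shows "\<And>l. 0 < l \<Longrightarrow> l < L \<Longrightarrow> coeff (fibre_union_poly r B b0 Q) (m - l) = 0"
    and "coeff (fibre_union_poly r B b0 Q) (m - L) = of_nat n * coeff Q (N - L)"
proof -
  have "starts_with L (coeff Q (N - L)) (reflect_poly Q)"
    using Q L z monic_of_degreeD(1)[OF Q] by (auto simp: starts_with_def coeff_reflect_poly monic_of_degree_def)
  then have s: "starts_with L (of_nat n * coeff Q (N - L)) (reflect_poly (fibre_union_poly r B b0 Q))"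
    by (rule starts_with_fibre_union[OF Q L])
  have c: "coeff (reflect_poly (fibre_union_poly r B b0 Q)) l = coeff (fibre_union_poly r B b0 Q) (m - l)" if "l \<le> L" for l
    using that L parameter_bounds(4) fibre_union_monic(1)[OF Q] by (simp add: coeff_reflect_poly)
  show "coeff (fibre_union_poly r B b0 Q) (m - l) = 0" if "0 < l" "l < L" for l
    using c[of l] s that by (simp add: starts_with_def)
  show "coeff (fibre_union_poly r B b0 Q) (m - L) = of_nat n * coeff Q (N - L)"
    using c[of L] s by (simp add: starts_with_def)
qed

lemma centred_fib_0: "good Q \<Longrightarrow> centred (fib Q) 0 = fibre_union_poly r B b0 Q"
  by (simp add: centred_def goodD(5))

text \<open>
  The vanishing coefficients of \<open>Q\<close> below \<open>X\<^sup>N\<close> are visible in the symmetric functions about the ramification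
  point \<open>0\<close>.
\<close>

lemma family_in_flat_classes:
  assumes "i < N"
  shows "family_classes (sub_family i) \<subseteq> flat_classes m (N - i)"
proof
  fix \<Xi> assume "\<Xi> \<in> family_classes (sub_family i)"
  then obtain Q where Q: "Q \<in> sub_family i" "good Q" "\<Xi> = poly_class (fib Q)" by (auto simp: family_classes_def)
  have z: "coeff Q (N - l) = 0" if "0 < l" "l \<le> N - i" for l using Q(1) that assms by (auto simp: sub_family_def)
  have "coeff (centred (fib Q) 0) (m - l) = 0" if "l \<in> {1..N - i}" for l
    unfolding centred_fib_0[OF Q(2)]
    using fibre_union_top_coeffs(2)[OF goodD(1)[OF Q(2)], of l] z that by auto
  then show "\<Xi> \<in> flat_classes m (N - i)"
    unfolding Q(3) using goodD(6)[OF Q(2)] parameter_bounds(4)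
    by (subst flat_classes_iff[OF parameter_bounds(3) goodD(2)[OF Q(2)]]) (simp, intro bexI[of _ 0] ballI, assumption+)
qed

lemma coeff_centred_second:
  fixes A :: "'k set"
  assumes "finite A" "card A = m"
  shows "coeff (centred A a) (m - 1) = of_nat m * a + coeff (centred A 0) (m - 1)"
proof -
  have "coeff (centred A a) (m - 1) = (\<Sum>c\<in>A. a - c)" for a
  proof -
    have "starts_with 1 (\<Sum>c\<in>A. a - c) (\<Prod>c\<in>A. reflect_poly [:a - c, 1:])"
      by (rule starts_with_prod) (use assms in \<open>auto simp: starts_with_def coeff_reflect_poly\<close>)
    then have "starts_with 1 (\<Sum>c\<in>A. a - c) (reflect_poly (centred A a))"
      by (simp only: centred_def reflect_poly_prod)
    moreover have "degree (centred A a) = m"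
      unfolding centred_def using assms by (subst degree_prod_sum_eq) auto
    ultimately show ?thesis using parameter_bounds(3) by (simp add: starts_with_def coeff_reflect_poly)
  qed
  then show ?thesis using assms by (simp add: sum_subtractf sum_negf)
qed

text \<open>
  On the line \<open>Q\<^sub>t = X\<^sup>N + t X\<^sup>i + q\<close> the symmetric function of order \<open>L = N - i\<close> about \<open>0\<close> is \<open>n t\<close> up to sign, so \<open>0\<close> is
  not a point as required by \<open>flat_classes\<close>. Such a point \<open>a\<close> has to be the mean of the set. For \<open>L \<ge> 2\<close> the mean
  is \<open>0\<close>. For \<open>L = 1\<close> it is \<open>- n t / m\<close>, and for generic \<open>t\<close> the value of the polynomial there is not in \<open>B\<close>.
\<close>

lemma family_not_in_flat_classes:
  assumes i: "0 < i" "i < N"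
  shows "\<not> family_classes (sub_family (Suc i)) \<subseteq> flat_classes m (N - i)"
proof
  assume sub: "family_classes (sub_family (Suc i)) \<subseteq> flat_classes m (N - i)"
  have n0: "of_nat n \<noteq> (0 :: 'k)" "of_nat m \<noteq> (0 :: 'k)" using n parameter_bounds(3) by auto
  define L where "L = N - i"
  have L: "0 < L" "L \<le> N" "N - L = i" using i by (auto simp: L_def)
  obtain q where q: "good (monom 1 N + [:q:])" using good_binomial i by auto
  define R where "R = monom (1 :: 'k) i"
  define Q where "Q t = monom 1 N + [:q:] + smult t R" for t
  have cQ: "coeff (Q t) j = (if j = N then 1 else if j = i then t else if j = 0 then q else 0)" for t j
    using i by (cases j) (auto simp: Q_def R_def)
  have Qm: "monic_of_degree N (Q t)" for t using i by (auto simp: monic_of_degree_def cQ)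
  have Qs: "Q t \<in> sub_family (Suc i)" for t using Qm by (auto simp: sub_family_def cQ)
  have "good (monom 1 N + [:q:] + smult 0 R)" using q by simp
  then obtain g where g: "g \<noteq> 0" "\<And>t. poly g t \<noteq> 0 \<Longrightarrow> good (Q t)"
    using generic_good'[of "monom 1 N + [:q:]" R 0] Qm unfolding Q_def by blast
  define \<rho> :: 'k where "\<rho> = - of_nat n / of_nat m"
  have "n \<noteq> m" using parameter_bounds(5) i d by auto
  then have l0: "\<rho> \<noteq> 0" "\<rho> + 1 \<noteq> 0" using n0 by (auto simp: \<rho>_def field_simps)
  \<comment> \<open>For \<open>i = N - 1\<close>, this is the value at \<open>\<rho> t\<close> of the polynomial belonging to \<open>Q\<^sub>t\<close>, minus \<open>b\<close>,
    as a polynomial in \<open>t\<close>.\<close>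
  define h where "h b = [:b0 - b:] + monom (\<rho> ^ Suc r) (Suc r) * (monom (\<rho> ^ N + \<rho> ^ (N - 1)) N + [:q:])" for b
  have h0: "h b \<noteq> 0" for b
  proof
    assume "h b = 0"
    then have "coeff (h b) d = 0" by simp
    moreover have "coeff (h b) d = \<rho> ^ Suc r * (\<rho> ^ (N - 1) * (\<rho> + 1))"
    proof -
      obtain N' where N': "N = Suc N'" using i by (cases N) auto
      show ?thesis unfolding h_def d by (simp add: coeff_monom_mult N' algebra_simps)
    qed
    ultimately show False using l0 by simp
  qed
  have "g * [:0, 1:] * (\<Prod>b\<in>B. h b) \<noteq> 0" using g(1) h0 B(1) by (simp del: mult_pCons_right)
  then obtain t where "poly (g * [:0, 1:] * (\<Prod>b\<in>B. h b)) t \<noteq> 0" using ex_nonroot by blast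
  then have t: "poly g t \<noteq> 0" "t \<noteq> 0" "\<And>b. b \<in> B \<Longrightarrow> poly (h b) t \<noteq> 0" using B(1) by (auto simp: poly_prod)
  have gd: "good (Q t)" by (rule g(2)[OF t(1)])
  define A where "A = fib (Q t)"
  have A: "finite A" "card A = m" "A \<in> n_sets m" using goodD[OF gd] by (auto simp: A_def)
  have cA: "centred A 0 = fibre_union_poly r B b0 (Q t)" unfolding A_def by (rule centred_fib_0[OF gd])
  note top = fibre_union_top_coeffs[OF Qm[of t] L(1,2), folded cA]
  have z: "coeff (Q t) (N - l) = 0" if "0 < l" "l < L" for l using that i by (auto simp: cQ L_def)
  have "poly_class A \<in> flat_classes m L" using sub Qs gd unfolding A_def L_def family_classes_def by blast
  then obtain a where a: "a \<in> A" "\<And>l. l \<in> {1..L} \<Longrightarrow> coeff (centred A a) (m - l) = 0"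
    using flat_classes_iff[OF parameter_bounds(3) A(3), of L] L parameter_bounds(4) by auto
  have "of_nat m * a + coeff (centred A 0) (m - 1) = 0"
    using a(2)[of 1] L by (subst coeff_centred_second[OF A(1,2), of a, symmetric]) simp
  moreover have nt: "coeff (centred A 0) (m - L) = of_nat n * t" using top(2)[OF z] L by (simp add: cQ)
  ultimately show False
  proof (cases "L = 1")
    case True
    then have "of_nat m * a = - (of_nat n * t)"
      using nt \<open>of_nat m * a + coeff (centred A 0) (m - 1) = 0\<close> by (simp add: eq_neg_iff_add_eq_0)
    then have at: "a = \<rho> * t" using n0 by (simp add: \<rho>_def field_simps)
    have iN: "N = Suc i" using True L i by simp
    obtain b where b: "b \<in> B" "poly (ramified r b0 (Q t)) a = b" using a(1) by (auto simp: A_def)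
    have "poly (ramified r b0 (Q t)) a - b = poly (h b) t"
      unfolding ramified_def Q_def R_def h_def at iN
      by (simp add: poly_monom power_mult_distrib algebra_simps)
    then show False using b t(3)[OF b(1)] by simp
  next
    case False
    then have "coeff (centred A 0) (m - 1) = 0" using top(1)[OF z, of 1] L by simp
    then have "a = 0" using \<open>of_nat m * a + coeff (centred A 0) (m - 1) = 0\<close> n0 by simp
    then show False using a(2)[of L] L nt t(2) n0 by simp
  qed
qed

text \<open>
  On the line \<open>X\<^sup>N + q + t\<close>, an affine map with factor \<open>\<alpha>\<close> between two of the sets has to respect the symmetric
  functions about \<open>0\<close> of the orders \<open>N\<close> and \<open>m - 1\<close>, both of which are proportional to \<open>q + t\<close>. As \<open>N < m - 1\<close>,
  eliminating \<open>\<alpha>\<close> leaves a nontrivial equation for \<open>t\<close> for each point \<open>a\<close> that the map may send to \<open>0\<close>.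
\<close>

lemma family_two_classes:
  assumes N: "N > 0" and \<Xi>: "\<Xi> \<in> family_classes (sub_family 1)"
  shows "\<exists>\<Xi>'\<in>family_classes (sub_family 1). \<Xi>' \<noteq> \<Xi>"
proof (rule ccontr)
  assume neg: "\<not> ?thesis"
  have n0: "of_nat n \<noteq> (0 :: 'k)" using n by auto
  obtain Q1 where Q1: "good Q1" "\<Xi> = poly_class (fib Q1)" using \<Xi> by (auto simp: family_classes_def)
  define A1 where "A1 = fib Q1"
  have A1: "finite A1" "card A1 = m" "A1 \<in> n_sets m" using goodD[OF Q1(1)] by (auto simp: A1_def)
  obtain q where q: "good (monom 1 N + [:q:])" using good_binomial[OF N] by auto
  define Q where "Q t = monom 1 N + [:q:] + smult t 1" for t
  have cQ: "coeff (Q t) j = (if j = N then 1 else if j = 0 then q + t else 0)" for t j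
    using N by (cases j) (auto simp: Q_def)
  have Qm: "monic_of_degree N (Q t)" for t by (auto simp: monic_of_degree_def cQ)
  have Qs: "Q t \<in> sub_family 1" for t using Qm by (auto simp: sub_family_def cQ)
  have "good (monom 1 N + [:q:] + smult 0 1)" using q by simp
  then obtain g where g: "g \<noteq> 0" "\<And>t. poly g t \<noteq> 0 \<Longrightarrow> good (Q t)"
    using generic_good'[of "monom 1 N + [:q:]" 1 0] Qm unfolding Q_def by blast
  define K where "K = (\<Prod>b\<in>B - {b0}. b0 - b)"
  define c where "c l a = coeff (centred A1 a) (m - l)" for l a
  have c1: "c (m - 1) a \<noteq> 0" if a: "a \<in> A1" for a
  proof -
    have "centred A1 a = [:0, 1:] * (\<Prod>c\<in>A1 - {a}. [:a - c, 1:])"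
      unfolding centred_def using prod.remove[OF A1(1) a, of "\<lambda>c. [:a - c, 1:]"] by simp
    moreover have "m - (m - 1) = Suc 0" using parameter_bounds(3) by simp
    ultimately have "c (m - 1) a = poly (\<Prod>c\<in>A1 - {a}. [:a - c, 1:]) 0"
      by (simp add: c_def poly_0_coeff_0)
    then show ?thesis using A1(1) by (auto simp: poly_prod)
  qed
  \<comment> \<open>The equation that is left when \<open>\<alpha>\<close> is eliminated.\<close>
  define e where "e a = smult (of_nat n ^ (m - 1) * c (m - 1) a ^ N) ([:q, 1:] ^ (m - 1)) -
      smult (K ^ N * c N a ^ (m - 1)) ([:q, 1:] ^ N)" for a
  have e0: "e a \<noteq> 0" if "a \<in> A1" for a
  proof
    assume "e a = 0"
    then have "coeff (e a) (m - 1) = 0" by simp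
    moreover have "coeff ([:q, 1:] ^ N) (m - 1) = 0"
      using parameter_bounds(6) by (intro coeff_eq_0) (simp add: degree_power_eq)
    moreover have "coeff ([:q, 1:] ^ (m - 1)) (m - 1) = 1"
      using lead_coeff_power[of "[:q, 1:]" "m - 1"] by (simp add: degree_power_eq)
    ultimately show False using n0 c1[OF that] by (simp add: e_def)
  qed
  have "g * (\<Prod>a\<in>A1. e a) \<noteq> 0" using g(1) e0 A1(1) by simp
  then obtain t where "poly (g * (\<Prod>a\<in>A1. e a)) t \<noteq> 0" using ex_nonroot by blast
  then have t: "poly g t \<noteq> 0" "\<And>a. a \<in> A1 \<Longrightarrow> poly (e a) t \<noteq> 0" using A1(1) by (auto simp: poly_prod)
  have gd: "good (Q t)" by (rule g(2)[OF t(1)])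
  define A where "A = fib (Q t)"
  have A: "A \<in> n_sets m" using goodD[OF gd] by (auto simp: A_def)
  have cA: "centred A 0 = fibre_union_poly r B b0 (Q t)" unfolding A_def by (rule centred_fib_0[OF gd])
  have "poly_class A \<in> family_classes (sub_family 1)" using gd Qs by (auto simp: family_classes_def A_def)
  then have "poly_class A = poly_class A1" using neg Q1(2) by (auto simp: A1_def)
  then have "A1 \<le>\<^sub>p A" by (simp add: poly_class_eq_iff poly_equiv_def)
  then obtain \<alpha> \<beta> where ab: "\<alpha> \<noteq> 0" "A = (\<lambda>z. \<alpha> * z + \<beta>) ` A1"
    using affine_of_poly_red[OF A1(3) A parameter_bounds(3)] by blast
  have "0 \<in> A" using goodD(6)[OF gd] by (simp add: A_def)
  then obtain a where a: "a \<in> A1" "\<alpha> * a + \<beta> = 0" using ab(2) by force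
  have ca: "coeff (fibre_union_poly r B b0 (Q t)) (m - l) = \<alpha> ^ l * c l a" if "l \<le> m" for l
    using centred_affine[OF A1(1) ab(1), of l \<beta> a] that unfolding A1(2) ab(2)[symmetric] a(2) cA c_def by simp
  have "coeff (fibre_union_poly r B b0 (Q t)) (m - N) = of_nat n * (q + t)"
    using fibre_union_top_coeffs(2)[OF Qm[of t] N order_refl] N by (auto simp: cQ)
  then have 1: "of_nat n * (q + t) = \<alpha> ^ N * c N a" using ca[of N] parameter_bounds(4) by simp
  have "coeff (fibre_union_poly r B b0 (Q t)) (m - (m - 1)) = (q + t) * K"
  proof -
    have "m - (m - 1) = Suc 0" using parameter_bounds(3) by simp
    then have "coeff (fibre_union_poly r B b0 (Q t)) (m - (m - 1)) =
        coeff (Q t * (\<Prod>b\<in>B - {b0}. [:b0 - b:] + monom 1 (Suc r) * Q t)) 0"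
      by (simp add: fibre_union_poly_def mult.assoc)
    also have "\<dots> = (q + t) * K"
    proof -
      have "coeff (\<Prod>b\<in>B - {b0}. [:b0 - b:] + monom 1 (Suc r) * Q t) 0 = K"
        by (simp add: K_def poly_prod poly_monom flip: poly_0_coeff_0)
      moreover have "coeff (Q t) 0 = q + t" using N by (simp add: cQ)
      ultimately show ?thesis by (simp add: coeff_mult_0)
    qed
    finally show ?thesis .
  qed
  then have 2: "(q + t) * K = \<alpha> ^ (m - 1) * c (m - 1) a" using ca[of "m - 1"] by simp
  have "(of_nat n * (q + t)) ^ (m - 1) * c (m - 1) a ^ N = ((q + t) * K) ^ N * c N a ^ (m - 1)"
    unfolding 1 2 power_mult_distrib by (simp add: power_mult[symmetric] mult.commute mult.left_commute)
  moreover have "poly (e a) t = (of_nat n * (q + t)) ^ (m - 1) * c (m - 1) a ^ N - ((q + t) * K) ^ N * c N a ^ (m - 1)"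
    by (simp add: e_def power_mult_distrib mult_ac)
  ultimately have "poly (e a) t = 0" by simp
  then show False using t(2)[OF a(1)] by simp
qed

text \<open>
  For \<open>N > 0\<close> the polynomial \<open>X\<^sup>N\<close>, the only one in the family with \<open>i = 0\<close>, is not good. The chain starts with
  a single class instead.
\<close>

theorem chain_exists:
  "\<exists>C. (\<forall>i\<le>N. irreducible_closed (subtopology (n_classes_top m) (classes_below m (poly_class B))) (C i)) \<and>
    (\<forall>i<N. C i \<subset> C (Suc i))"
proof -
  define S where "S = classes_below m (poly_class B)"
  define X where "X = subtopology (n_classes_top m) S"
  have SN: "S \<subseteq> n_classes m" by (auto simp: S_def classes_below_def)
  have top: "topspace X = S" using SN by (auto simp: X_def)
  define \<Phi> where "\<Phi> i = family_classes (sub_family i)" for i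
  have \<Phi>S: "\<Phi> i \<subseteq> S" for i unfolding \<Phi>_def S_def by (rule family_classes_below)
  have "\<exists>\<Xi>. \<Xi> \<in> S \<and> (0 < N \<longrightarrow> \<Xi> \<in> \<Phi> 1)"
  proof (cases "N = 0")
    case True
    have "monic_of_degree N (1 :: 'k poly)" using True by (auto simp: monic_of_degree_def)
    then have "1 \<in> sub_family 1" by (auto simp: sub_family_def)
    then have "poly_class (fib 1) \<in> \<Phi> 1"
      using good_power[OF True] unfolding \<Phi>_def family_classes_def by blast
    then show ?thesis using \<Phi>S True by blast
  next
    case False
    then obtain q where q: "good (monom 1 N + [:q:])" using good_binomial by blast
    have "monom 1 N + [:q:] \<in> sub_family 1"
      using goodD(1)[OF q] by (auto simp: sub_family_def coeff_pCons split: nat.split)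
    then have "poly_class (fib (monom 1 N + [:q:])) \<in> \<Phi> 1" using q by (auto simp: \<Phi>_def family_classes_def)
    then show ?thesis using \<Phi>S by blast
  qed
  then obtain \<Xi> where \<Xi>: "\<Xi> \<in> S" "0 < N \<Longrightarrow> \<Xi> \<in> \<Phi> 1" by blast
  define C where "C i = (if i = 0 then {\<Xi>} else X closure_of \<Phi> i)" for i
  have mono: "\<Phi> i \<subseteq> \<Phi> j" if "i \<le> j" for i j
    using sub_family_mono[OF that] by (auto simp: \<Phi>_def family_classes_def)
  have sub: "\<Phi> i \<subseteq> X closure_of \<Phi> i" for i using \<Phi>S top by (intro closure_of_subset) simp
  have irr0: "irreducible_closed X {\<Xi>}"
  proof -
    have "closedin (n_classes_top m) {\<Xi>}" using \<Xi>(1) SN by (intro closedin_singleton_class parameter_bounds(3)) auto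
    moreover have "{\<Xi>} = {\<Xi>} \<inter> S" using \<Xi>(1) by auto
    ultimately have "closedin X {\<Xi>}" unfolding X_def closedin_subtopology by blast
    moreover have "{\<Xi>} = K \<or> {\<Xi>} = L" if "{\<Xi>} = K \<union> L" for K L
      using that subset_singletonD[of K \<Xi>] by blast
    ultimately show ?thesis unfolding irreducible_closed_def by blast
  qed
  have irr: "irreducible_closed X (X closure_of \<Phi> i)" if "0 < i" "i \<le> N" for i
  proof (rule irreducible_closed_closure_of)
    show "\<Phi> i \<subseteq> topspace X" using \<Phi>S top by simp
    have "\<Xi> \<in> \<Phi> i" using \<Xi>(2) mono[of 1 i] that by auto
    then show "\<Phi> i \<noteq> {}" by blast
    fix K L assume KL: "closedin X K" "closedin X L" "\<Phi> i \<subseteq> K \<union> L"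
    obtain K' where K': "closedin (n_classes_top m) K'" "K = K' \<inter> S" using KL(1) unfolding X_def closedin_subtopology by auto
    obtain L' where L': "closedin (n_classes_top m) L'" "L = L' \<inter> S" using KL(2) unfolding X_def closedin_subtopology by auto
    have "\<Phi> i \<subseteq> K' \<or> \<Phi> i \<subseteq> L'"
      unfolding \<Phi>_def
      by (rule family_irreducible[OF line_closed_sub_family K'(1) L'(1)]) (use KL(3) K'(2) L'(2) in \<open>auto simp: \<Phi>_def\<close>)
    then show "\<Phi> i \<subseteq> K \<or> \<Phi> i \<subseteq> L" using \<Phi>S[of i] K'(2) L'(2) by blast
  qed
  have "C i \<subset> C (Suc i)" if i: "i < N" for i
  proof (cases "i = 0")
    case True
    have "\<Xi> \<in> \<Phi> 1" using \<Xi>(2) i True by simp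
    moreover obtain \<Xi>' where "\<Xi>' \<in> \<Phi> 1" "\<Xi>' \<noteq> \<Xi>"
      using family_two_classes[of \<Xi>] i \<open>\<Xi> \<in> \<Phi> 1\<close> unfolding \<Phi>_def by auto
    ultimately show ?thesis using sub[of 1] True by (auto simp: C_def)
  next
    case False
    define E where "E = flat_classes m (N - i) \<inter> S"
    have "closedin (n_classes_top m) (flat_classes m (N - i) :: 'k set set set)"
      using parameter_bounds(4) by (intro closedin_flat_classes parameter_bounds(3)) simp
    then have "closedin X E" unfolding X_def E_def closedin_subtopology by blast
    moreover have "\<Phi> i \<subseteq> E" using family_in_flat_classes[OF i] \<Phi>S[of i] by (auto simp: E_def \<Phi>_def)
    ultimately have "X closure_of \<Phi> i \<subseteq> E" by (intro closure_of_minimal)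
    moreover have "\<not> \<Phi> (Suc i) \<subseteq> E" using family_not_in_flat_classes[of i] False i by (auto simp: E_def \<Phi>_def)
    moreover have "X closure_of \<Phi> i \<subseteq> X closure_of \<Phi> (Suc i)" by (intro closure_of_mono mono) simp
    ultimately show ?thesis using sub[of "Suc i"] False by (auto simp: C_def)
  qed
  moreover have "irreducible_closed X (C i)" if "i \<le> N" for i using irr0 irr that by (simp add: C_def)
  ultimately show ?thesis unfolding X_def S_def by blast
qed

end


section \<open>The dimension\<close>

lemma krull_dim_eqI:
  assumes ex: "\<exists>C. (\<forall>i\<le>N. irreducible_closed X (C i)) \<and> (\<forall>i<N. C i \<subset> C (Suc i))"
    and bound: "\<And>k C. (\<And>i. i \<le> k \<Longrightarrow> irreducible_closed X (C i)) \<Longrightarrow> (\<And>i. i < k \<Longrightarrow> C i \<subset> C (Suc i)) \<Longrightarrow> k \<le> N"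
  shows "krull_dim X = ereal (real N)"
  unfolding krull_dim_def
proof (rule antisym)
  show "Sup {ereal (real d) | d. \<exists>C. (\<forall>i\<le>d. irreducible_closed X (C i)) \<and> (\<forall>i<d. C i \<subset> C (Suc i))} \<le> ereal (real N)"
  proof (rule Sup_least)
    fix x assume "x \<in> {ereal (real d) | d. \<exists>C. (\<forall>i\<le>d. irreducible_closed X (C i)) \<and> (\<forall>i<d. C i \<subset> C (Suc i))}"
    then obtain d C where d: "x = ereal (real d)" "\<forall>i\<le>d. irreducible_closed X (C i)" "\<forall>i<d. C i \<subset> C (Suc i)"
      by blast
    have "d \<le> N" by (rule bound[of d C]) (use d in blast)+
    then show "x \<le> ereal (real N)" using d(1) by simp
  qed
  show "ereal (real N) \<le> Sup {ereal (real d) | d. \<exists>C. (\<forall>i\<le>d. irreducible_closed X (C i)) \<and> (\<forall>i<d. C i \<subset> C (Suc i))}"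
    by (rule Sup_upper) (use ex in blast)
qed

text \<open>
  Both bounds depend on the degree \<open>d\<close> through \<open>m - 1 - (n - 1) d\<close>, which is largest for the least possible
  degree.
\<close>

lemma krull_dim_classes_below:
  fixes B :: "'k::{alg_closed_field, field_char_0} set"
  assumes B: "B \<in> n_sets n" and n: "n \<ge> 2" and m: "m \<ge> 2"
    and d: "m \<le> n * d" "(n - 1) * d + 1 + N = m" and least: "\<And>d'. m \<le> n * d' \<Longrightarrow> d \<le> d'"
  shows "krull_dim (subtopology (n_classes_top m) (classes_below m (poly_class B))) = ereal (real N)"
proof (rule krull_dim_eqI)
  have Bf: "finite B" "card B = n" using B by (auto simp: n_sets_def)
  then obtain b0 where b0: "b0 \<in> B" using n by fastforce
  have nd: "n * d' = (n - 1) * d' + d'" for d' using n by (cases n) auto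
  define r where "r = n * d - m"
  have "d = Suc r + N" "m + r = n * d" using d nd[of d] by (simp_all add: r_def)
  then show "\<exists>C. (\<forall>i\<le>N. irreducible_closed (subtopology (n_classes_top m) (classes_below m (poly_class B))) (C i)) \<and>
      (\<forall>i<N. C i \<subset> C (Suc i))"
    by (rule chain_exists[OF Bf(1) b0 Bf(2) n])
  fix k C
  assume C: "\<And>i. i \<le> k \<Longrightarrow> irreducible_closed (subtopology (n_classes_top m) (classes_below m (poly_class B))) (C i)"
    "\<And>i. i < k \<Longrightarrow> C i \<subset> C (Suc i)"
  have "card B \<ge> 2" using Bf n by simp
  from chain_length_bound[where C = C and k = k, OF m Bf(1) this C] obtain d' where d': "m \<le> n * d'" "k + 1 + n * d' \<le> m + d'"
    unfolding Bf(2) by blast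
  have "(n - 1) * d \<le> (n - 1) * d'" using least[OF d'(1)] by simp
  then show "k \<le> N" using d'(2) nd[of d'] d(2) by linarith
qed

theorem theorem44:
  fixes n m e t :: nat
    and \<Theta> :: "'k::{alg_closed_field, field_char_0} set set"
  assumes "n \<ge> 2" and "m > n"
    and "\<exists>\<gamma>::nat. real m / real n \<le> real \<gamma> \<and> real \<gamma> \<le> (real m - 1) / (real n - 1)"
    and "\<Theta> \<in> n_classes n"
    and "int e = \<lfloor>real m / real n\<rfloor>" and "m = e * n + t"
  shows "krull_dim (subtopology (n_classes_top m) (classes_below m \<Theta>)) =
    (if t = 0 then ereal (real e - 1) else ereal (real e - real n + real t))"
proof -
  obtain B where B: "B \<in> n_sets n" "\<Theta> = poly_class B" using assms(4) by (auto simp: n_classes_def)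
  obtain \<gamma> :: nat where "real m / real n \<le> real \<gamma>" "real \<gamma> \<le> (real m - 1) / (real n - 1)" using assms(3) by blast
  then have "real m \<le> real n * real \<gamma>" "real \<gamma> * (real n - 1) \<le> real m - 1"
    using assms(1) by (simp_all add: field_simps)
  then have g1: "real m \<le> real (n * \<gamma>)" and g2: "real (\<gamma> * (n - 1) + 1) \<le> real m"
    using assms(1) by (simp_all add: of_nat_diff)
  have \<gamma>: "m \<le> n * \<gamma>" "\<gamma> * (n - 1) + 1 \<le> m" using g1 g2 unfolding of_nat_le_iff by simp_all
  \<comment> \<open>By the definition of \<open>e\<close>, the remainder \<open>t\<close> is less than \<open>n\<close>.\<close>
  have "real m < (real e + 1) * real n"
  proof -
    have "real m / real n < real e + 1" using assms(5) by linarith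
    then show ?thesis using assms(1) by (simp add: divide_less_eq)
  qed
  then have "real m < real ((e + 1) * n)" by (simp add: algebra_simps)
  then have mlt: "m < (e + 1) * n" unfolding of_nat_less_iff .
  then have t: "t < n" using assms(6) by simp
  define d where "d = (if t = 0 then e else e + 1)"
  have mnd: "m \<le> n * d" using assms(6) t by (simp add: d_def algebra_simps)
  have least: "d \<le> d'" if "m \<le> n * d'" for d'
  proof (cases "t = 0")
    case True
    then have "e * n \<le> d' * n" using that assms(6) by (simp add: mult.commute)
    then show ?thesis using True assms(1) by (simp add: d_def)
  next
    case False
    then have "e * n < d' * n" using that unfolding assms(6) mult.commute[of n d'] by linarith
    then show ?thesis using False by (simp add: d_def)
  qed
  have "d * (n - 1) \<le> \<gamma> * (n - 1)" by (intro mult_le_mono1 least \<gamma>(1))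
  then have dm: "(n - 1) * d + 1 \<le> m" using \<gamma>(2) by (subst mult.commute) linarith
  define N where "N = m - 1 - (n - 1) * d"
  have N: "(n - 1) * d + 1 + N = m" using dm by (simp add: N_def)
  have "krull_dim (subtopology (n_classes_top m) (classes_below m \<Theta>)) = ereal (real N)"
    unfolding B(2) using assms(1,2) by (intro krull_dim_classes_below[OF B(1) _ _ mnd N least]) auto
  moreover have "real N = (if t = 0 then real e - 1 else real e - real n + real t)"
  proof -
    have "real ((n - 1) * d + 1 + N) = real m" by (simp only: N)
    then have "real N = real m - 1 - (real n - 1) * real d" using assms(1) by (simp add: of_nat_diff)
    then show ?thesis using assms(6) by (cases "t = 0") (simp_all add: d_def algebra_simps)
  qed
  ultimately show ?thesis by simp
qed

end
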